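(* Let $\alpha>1$, and let $W$, $J_\alpha$, $M_0,M_1,M_{-1}$ be as defined in the context. Define the following operators on functions $F(\varphi,s)$ that are smooth in $\varphi$ and extend holomorphically in $s$ to $\mathbb{C}$, where $F(\varphi,s\pm i)$ denotes the value of the holomorphic extension in $s$ at $s\pm i$ ($i^2=-1$): $$Q_0F(\varphi,s)=-\frac{(-\tfrac12+is)(-\alpha+\tfrac12+is)}{2is}F(\varphi,s+i)+\frac{(\tfrac12+is)(\alpha-\tfrac12+is)}{2is}F(\varphi,s-i)-\frac{-\alpha+\tfrac12+is}{2is(-\tfrac12+is)}\frac{\partial^2}{\partial\varphi^2}F(\varphi,s+i),$$ $$Q_1F(\varphi,s)=e^{i\varphi}\Bigl[\frac{(\tfrac12+is)(-\alpha+\tfrac12+is)}{2is}F(\varphi,s+i)+\frac{(\tfrac12+is)(\alpha-\tfrac12+is)}{2is}F(\varphi,s-i)-\frac{-\alpha+\tfrac12+is}{2is(-\tfrac12+is)}\frac{\partial^2}{\partial\varphi^2}F(\varphi,s+i)+\frac{-\alpha+\tfrac12+is}{-\tfrac12+is}\,\frac{1}{i}\frac{\partial}{\partial\varphi}F(\varphi,s+i)\Bigr],$$ $$Q_{-1}F(\varphi,s)=e^{-i\varphi}\Bigl[\frac{(\tfrac12+is)(-\alpha+\tfrac12+is)}{2is}F(\varphi,s+i)+\frac{(\tfrac12+is)(\alpha-\tfrac12+is)}{2is}F(\varphi,s-i)-\frac{-\alpha+\tfrac12+is}{2is(-\tfrac12+is)}\frac{\partial^2}{\partial\varphi^2}F(\varphi,s+i)-\frac{-\alpha+\tfrac12+is}{-\tfrac12+is}\,\frac{1}{i}\frac{\partial}{\partial\varphi}F(\varphi,s+i)\Bigr].$$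 Then the operator $J_\alpha$ transforms $M_0,M_1,M_{-1}$ into $Q_0,Q_1,Q_{-1}$ respectively, i.e. for every $f\in W$, $$Q_0J_\alpha f=J_\alpha M_0f,\qquad Q_1J_\alpha f=J_\alpha M_1f,\qquad Q_{-1}J_\alpha f=J_\alpha M_{-1}f,$$ as identities between functions of $(\varphi,s)$, $\varphi\in[0,2\pi]$, $s\in\mathbb{R}\setminus\{0\}$.
   Context: Let $\mathrm{D}=\{z\in\mathbb{C}:|z|<1\}$ and let $\{dz\}$ denote Lebesgue measure on $\mathrm{D}$. Fix $\alpha>1$. $H_\alpha$ is the Hilbert space of holomorphic functions $f$ on $\mathrm{D}$ with $\int_{\mathrm{D}}|f(z)|^2(1-|z|^2)^{\alpha-2}\{dz\}<\infty$ and inner product $\langle f,g\rangle_\alpha=\frac{\alpha-1}{\pi}\int_{\mathrm{D}}f(z)\overline{g(z)}(1-|z|^2)^{\alpha-2}\{dz\}$; $\overline{H}_\alpha$ is the complex conjugate space of antiholomorphic functions, with the same inner product formula. $H_\alpha\otimes\overline{H}_\alpha$ is the Hilbert space of functions $f(z,\overline u)$ on $\mathrm{D}\times\mathrm{D}$, holomorphic in $z$ and antiholomorphic in $u$, with inner product $$\langle f_1,f_2\rangle=\frac{(\alpha-1)^2}{\pi^2}\iint_{\mathrm{D}\times\mathrm{D}}f_1(z,\overline u)\overline{f_2(z,\overline u)}(1-|z|^2)^{\alpha-2}(1-|u|^2)^{\alpha-2}\{dz\}\{du\}.$$ $W\subset H_\alpha\otimes\overline{H}_\alpha$ is the subspace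 of all $f(z,\overline u)$ that admit an analytic continuation (holomorphic in $z$, antiholomorphic in $u$) to a bidisk $|z|<1+\delta$, $|u|<1+\delta$ for some $\delta>0$ (depending on $f$). For $|z|<1$, $|u|<1$, $\varphi\in[0,2\pi]$, $s\in\mathbb{R}$, set $$K_\alpha(\varphi,s;z,u)=\frac{(1-\overline z e^{i\varphi})^{-1/2-is}(1-ue^{-i\varphi})^{-1/2-is}}{(1-\overline z u)^{\alpha-1/2-is}}$$ (principal branches of powers), and $$J_\alpha f(\varphi,s)=\iint_{\mathrm{D}\times\mathrm{D}}K_\alpha(\varphi,s;z,u)\,f(z,\overline u)\,(1-|z|^2)^{\alpha-2}(1-|u|^2)^{\alpha-2}\{dz\}\{du\}.$$ For $f\in W$ and fixed $\varphi$, the function $s\mapsto J_\alpha f(\varphi,s)$ extends holomorphically to all $s\in\mathbb{C}$; values of $J_\alpha f$ at non-real $s$ mean values of this extension. The operators acting on functions $f(z,\overline u)$ are $$M_0=z\frac{\partial}{\partial z}+\overline u\frac{\partial}{\partial\overline u}+\alpha,\qquad M_1=z^2\frac{\partial}{\partial z}+\alpha z+\frac{\partial}{\partial\overline u},\qquad M_{-1}=\overline u^2\frac{\partial}{\partial\overline u}+\alpha\overline u+\frac{\partial}{\partial z}.$$ *)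

theory Defs
  imports "HOL-Analysis.Analysis"
begin

text \<open>
  A function \<open>f(z, \<bar>u)\<close>, holomorphic in \<open>z\<close> and antiholomorphic in \<open>u\<close>, is represented by a
  function \<open>f :: complex \<Rightarrow> complex \<Rightarrow> complex\<close> that is holomorphic in both arguments; its value at
  the point \<open>(z, u)\<close> is \<open>f z (cnj u)\<close>.  Thus the derivative with respect to the conjugate of \<open>u\<close>
  is the complex derivative in the second argument.
\<close>

abbreviation disk :: "complex set" where
  "disk \<equiv> ball 0 1"

text \<open>
  Holomorphy in two complex variables on the product of two open sets.
\<close>

definition holomorphic2_on ::
    "(complex \<Rightarrow> complex \<Rightarrow> complex) \<Rightarrow> complex set \<Rightarrow> complex set \<Rightarrow> bool" where
  "holomorphic2_on f S T \<longleftrightarrow>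
     continuous_on (S \<times> T) (\<lambda>(z, w). f z w) \<and>
     (\<forall>w\<in>T. (\<lambda>z. f z w) holomorphic_on S) \<and>
     (\<forall>z\<in>S. (\<lambda>w. f z w) holomorphic_on T)"

definition weight :: "real \<Rightarrow> complex \<Rightarrow> real" where
  "weight \<alpha> z = (1 - (cmod z)\<^sup>2) powr (\<alpha> - 2)"

text \<open>
  The underlying set of the Hilbert space \<open>H\<^sub>\<alpha> \<otimes> \<bar>H\<^sub>\<alpha>\<close>.  Only the values of \<open>f\<close> on
  \<open>disk \<times> disk\<close> are relevant.
\<close>

definition HH :: "real \<Rightarrow> (complex \<Rightarrow> complex \<Rightarrow> complex) set" where
  "HH \<alpha> = {f. holomorphic2_on f disk disk \<and>
     set_integrable lborel (disk \<times> disk)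
       (\<lambda>(z, u). (cmod (f z (cnj u)))\<^sup>2 * weight \<alpha> z * weight \<alpha> u)}"

definition W :: "real \<Rightarrow> (complex \<Rightarrow> complex \<Rightarrow> complex) set" where
  "W \<alpha> = {f \<in> HH \<alpha>. \<exists>\<delta>>0. \<exists>g. holomorphic2_on g (ball 0 (1 + \<delta>)) (ball 0 (1 + \<delta>)) \<and>
     (\<forall>z\<in>disk. \<forall>w\<in>disk. g z w = f z w)}"

text \<open>
  On complex numbers, \<open>powr\<close> is the principal branch.  All three bases below lie in the right
  half-plane.
\<close>

definition K :: "real \<Rightarrow> real \<Rightarrow> real \<Rightarrow> complex \<Rightarrow> complex \<Rightarrow> complex" where
  "K \<alpha> \<phi> s z u =
     (1 - cnj z * exp (\<i> * of_real \<phi>)) powr (- 1/2 - \<i> * of_real s) *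
     (1 - u * exp (- \<i> * of_real \<phi>)) powr (- 1/2 - \<i> * of_real s) /
     (1 - cnj z * u) powr (of_real \<alpha> - 1/2 - \<i> * of_real s)"

definition J :: "real \<Rightarrow> (complex \<Rightarrow> complex \<Rightarrow> complex) \<Rightarrow> real \<Rightarrow> real \<Rightarrow> complex" where
  "J \<alpha> f \<phi> s = set_lebesgue_integral lborel (disk \<times> disk)
     (\<lambda>(z, u). K \<alpha> \<phi> s z u * f z (cnj u) * of_real (weight \<alpha> z) * of_real (weight \<alpha> u))"

definition M0 :: "real \<Rightarrow> (complex \<Rightarrow> complex \<Rightarrow> complex) \<Rightarrow> complex \<Rightarrow> complex \<Rightarrow> complex" where
  "M0 \<alpha> f z w = z * deriv (\<lambda>x. f x w) z + w * deriv (\<lambda>y. f z y) w + of_real \<alpha> * f z w"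

definition M1 :: "real \<Rightarrow> (complex \<Rightarrow> complex \<Rightarrow> complex) \<Rightarrow> complex \<Rightarrow> complex \<Rightarrow> complex" where
  "M1 \<alpha> f z w = z\<^sup>2 * deriv (\<lambda>x. f x w) z + of_real \<alpha> * z * f z w + deriv (\<lambda>y. f z y) w"

definition Mm1 :: "real \<Rightarrow> (complex \<Rightarrow> complex \<Rightarrow> complex) \<Rightarrow> complex \<Rightarrow> complex \<Rightarrow> complex" where
  "Mm1 \<alpha> f z w = w\<^sup>2 * deriv (\<lambda>y. f z y) w + of_real \<alpha> * w * f z w + deriv (\<lambda>x. f x w) z"

text \<open>
  Holomorphic extension to the complex plane of a function on the real line.  If an extension
  exists, it is unique by the identity theorem; \<open>ext\<close> is meaningful only in that case.
\<close>

definition entire_extension :: "(real \<Rightarrow> complex) \<Rightarrow> (complex \<Rightarrow> complex) \<Rightarrow> bool" where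
  "entire_extension g h \<longleftrightarrow> h holomorphic_on UNIV \<and> (\<forall>s. h (of_real s) = g s)"

definition ext :: "(real \<Rightarrow> complex) \<Rightarrow> complex \<Rightarrow> complex" where
  "ext g = (THE h. entire_extension g h)"

definition D\<phi> :: "(real \<Rightarrow> complex) \<Rightarrow> real \<Rightarrow> complex" where
  "D\<phi> g \<phi> = vector_derivative g (at \<phi>)"

definition smooth :: "(real \<Rightarrow> complex) \<Rightarrow> bool" where
  "smooth g \<longleftrightarrow> (\<forall>n \<phi>. (D\<phi> ^^ n) g differentiable (at \<phi>))"

text \<open>
  The functions \<open>F(\<phi>, s)\<close> on which the operators \<open>Q\<close> act.  The variable \<open>\<phi>\<close> ranges over the whole
  real line (\<open>J \<alpha> f\<close> is \<open>2\<pi>\<close>-periodic in it), so no one-sided derivatives are needed.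
\<close>

definition Q_domain :: "(real \<Rightarrow> real \<Rightarrow> complex) set" where
  "Q_domain = {F. (\<forall>\<phi>. \<exists>h. entire_extension (F \<phi>) h) \<and> (\<forall>w. smooth (\<lambda>\<phi>. ext (F \<phi>) w))}"

definition Q0 :: "real \<Rightarrow> (real \<Rightarrow> real \<Rightarrow> complex) \<Rightarrow> real \<Rightarrow> real \<Rightarrow> complex" where
  "Q0 \<alpha> F \<phi> s = (let a = complex_of_real \<alpha>; t = complex_of_real s;
       Fp = (\<lambda>\<theta>. ext (F \<theta>) (t + \<i>)); Fm = (\<lambda>\<theta>. ext (F \<theta>) (t - \<i>)) in
     - ((- 1/2 + \<i> * t) * (- a + 1/2 + \<i> * t) / (2 * \<i> * t)) * Fp \<phi>
     + ((1/2 + \<i> * t) * (a - 1/2 + \<i> * t) / (2 * \<i> * t)) * Fm \<phi>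
     - ((- a + 1/2 + \<i> * t) / (2 * \<i> * t * (- 1/2 + \<i> * t))) * D\<phi> (D\<phi> Fp) \<phi>)"

definition Q1 :: "real \<Rightarrow> (real \<Rightarrow> real \<Rightarrow> complex) \<Rightarrow> real \<Rightarrow> real \<Rightarrow> complex" where
  "Q1 \<alpha> F \<phi> s = (let a = complex_of_real \<alpha>; t = complex_of_real s;
       Fp = (\<lambda>\<theta>. ext (F \<theta>) (t + \<i>)); Fm = (\<lambda>\<theta>. ext (F \<theta>) (t - \<i>)) in
     exp (\<i> * of_real \<phi>) *
     (((1/2 + \<i> * t) * (- a + 1/2 + \<i> * t) / (2 * \<i> * t)) * Fp \<phi>
     + ((1/2 + \<i> * t) * (a - 1/2 + \<i> * t) / (2 * \<i> * t)) * Fm \<phi>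
     - ((- a + 1/2 + \<i> * t) / (2 * \<i> * t * (- 1/2 + \<i> * t))) * D\<phi> (D\<phi> Fp) \<phi>
     + ((- a + 1/2 + \<i> * t) / (- 1/2 + \<i> * t)) * (1 / \<i>) * D\<phi> Fp \<phi>))"

definition Qm1 :: "real \<Rightarrow> (real \<Rightarrow> real \<Rightarrow> complex) \<Rightarrow> real \<Rightarrow> real \<Rightarrow> complex" where
  "Qm1 \<alpha> F \<phi> s = (let a = complex_of_real \<alpha>; t = complex_of_real s;
       Fp = (\<lambda>\<theta>. ext (F \<theta>) (t + \<i>)); Fm = (\<lambda>\<theta>. ext (F \<theta>) (t - \<i>)) in
     exp (- \<i> * of_real \<phi>) *
     (((1/2 + \<i> * t) * (- a + 1/2 + \<i> * t) / (2 * \<i> * t)) * Fp \<phi>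
     + ((1/2 + \<i> * t) * (a - 1/2 + \<i> * t) / (2 * \<i> * t)) * Fm \<phi>
     - ((- a + 1/2 + \<i> * t) / (2 * \<i> * t * (- 1/2 + \<i> * t))) * D\<phi> (D\<phi> Fp) \<phi>
     - ((- a + 1/2 + \<i> * t) / (- 1/2 + \<i> * t)) * (1 / \<i>) * D\<phi> Fp \<phi>))"

end

theory Submission
  imports Defs "HOL-Complex_Analysis.Complex_Analysis" "HOL-Real_Asymp.Real_Asymp"
begin

unbundle no fps_syntax

text \<open>
  Write \<open>\<langle>k, h\<rangle>\<close> for the integral of \<open>k (cnj z) u * h z (cnj u)\<close> over the bidisk with respect to the two
  weights.  For \<open>k\<close> and \<open>h\<close> holomorphic on a larger bidisk it is determined by the Taylor coefficients, the
  monomials being orthogonal, and the recursion for the moments of the weight shows that in each variable the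
  Euler operator is symmetric, that \<open>d/dz\<close> is adjoint to \<open>z\<^sup>2 d/dz + \<alpha> z\<close>, and that a dilation can be
  moved from one factor to the other.

  The transform \<open>J\<close> is \<open>\<langle>k, f\<rangle>\<close> with the kernel \<open>k = (1 - Z e) powr (-p) (1 - U / e) powr (-p)
  (1 - Z U) powr (p - \<alpha>)\<close>, where \<open>e = exp (\<i> \<phi>)\<close> and \<open>p = 1/2 + \<i> s\<close>.  It is singular on the boundary,
  but its absolute value is integrable, so by dominated convergence a dilation of \<open>f\<close> can still be moved to
  the kernel.  The dilated kernel is smooth up to the boundary, entire in \<open>p\<close> and holomorphic in \<open>\<phi>\<close> on a
  strip, so that \<open>J f\<close> extends to complex \<open>s\<close> and can be differentiated under the integral.  The adjoints of
  \<open>M0\<close>, \<open>M1\<close>, \<open>Mm1\<close> then act on the kernel, where shifting \<open>s\<close> by \<open>\<plusminus> \<i>\<close>, that is \<open>p\<close> by \<open>\<mp> 1\<close>,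
  multiplies by a rational function, and the three relations become identities between rational functions.
\<close>

section \<open>Lebesgue measure on the disk\<close>

text \<open>The defining integral is used for real \<open>s\<close> only. There the two boundary
  factors of the kernel have exponent -1/2, and up to a constant their product is dominated by a sum
  of two terms of exponent -1; this exponent and the exponent \<alpha> - 1/2 of the factor in
  \<open>Z * U\<close> both stay below the threshold \<alpha> of the integral estimates. At the
  parameter \<open>p + 1\<close>, which the relations require, the same integral need not converge
  absolutely when \<alpha> is close to 1, and differentiating in the angle makes the singularity
  worse. The values of the extension must therefore come from another formula for the same function.
  The dilation supplies it, at the expense of the room between the unit bidisk and the larger bidisk
  to which \<open>f\<close> continues. No integration by parts and no boundary terms appear, because
  adjointness is checked on Taylor coefficients; the boundary singularity has to be estimated only
  in the limit that lets the dilation pass to the kernel.\<close>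

lemma emeasure_box_vec2:
  fixes l u :: complex
  assumes "\<And>b. b \<in> Basis \<Longrightarrow> l \<bullet> b \<le> u \<bullet> b"
  shows "emeasure lborel (box (vector [Re l, Im l] :: real^2) (vector [Re u, Im u])) =
    (\<Prod>b\<in>Basis. (u - l) \<bullet> b)"
proof -
  have le: "Re l \<le> Re u" "Im l \<le> Im u"
    using assms[of 1] assms[of \<i>] by (auto simp: Basis_complex_def)
  have "(\<Prod>b\<in>(Basis::(real^2) set). (vector [Re u, Im u] - vector [Re l, Im l]) \<bullet> b)
      = (Re u - Re l) * (Im u - Im l)"
    by (simp add: Basis_vec_def UNION_singleton_eq_range inner_axis  axis_eq_axis prod.reindex inj_on_def)
       (simp add: UNIV_2)
  moreover have "(\<Prod>b\<in>Basis. (u - l) \<bullet> b) = (Re u - Re l) * (Im u - Im l)"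
    by (simp add: Basis_complex_def complex_eq_iff)
  moreover have "\<forall>b\<in>(Basis::(real^2) set). vector [Re l, Im l] \<bullet> b \<le> vector [Re u, Im u] \<bullet> b"
    using le by (auto simp: Basis_vec_def inner_axis UNIV_2 forall_2)
  ultimately show ?thesis
    by (simp add: emeasure_lborel_box_eq)
qed

text \<open>Orthogonal maps of \<open>real^2\<close> preserve Lebesgue measure; rotation invariance
  on \<open>complex\<close> is transported from there along this identification of the two
  planes.\<close>

definition vec2_complex :: "real^2 \<Rightarrow> complex" where
  "vec2_complex v = Complex (v $ 1) (v $ 2)"

lemma vec2_complex_measurable [measurable]: "vec2_complex \<in> borel_measurable borel"
proof -
  have "vec2_complex = (\<lambda>v. of_real (v $ 1) + \<i> * of_real (v $ 2))"
    by (auto simp: vec2_complex_def complex_eq_iff)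
  moreover have "(\<lambda>v::real^2. of_real (v $ 1) + \<i> * of_real (v $ 2)) \<in> borel_measurable borel"
    by (intro borel_measurable_continuous_onI continuous_intros)
  ultimately show ?thesis
    by (simp only:)
qed

lemma vec2_complex_vimage_box:
  "vec2_complex -` box l u = box (vector [Re l, Im l]) (vector [Re u, Im u])"
  by (auto simp: vec2_complex_def in_box_complex_iff mem_box_cart forall_2 in_box_complex_iff)

lemma distr_vec2_complex: "distr lborel borel vec2_complex = lborel"
proof (rule sym, rule lborel_eqI)
  fix l u :: complex
  assume "\<And>b. b \<in> Basis \<Longrightarrow> l \<bullet> b \<le> u \<bullet> b"
  then show "emeasure (distr lborel borel vec2_complex) (box l u) = (\<Prod>b\<in>Basis. (u - l) \<bullet> b)"
    using emeasure_box_vec2[of l u]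
    by (simp add: emeasure_distr vec2_complex_vimage_box)
qed simp

lemma lborel_distr_complex_rotation:
  assumes c: "cmod c = 1"
  shows "distr lborel borel ((*) c) = (lborel :: complex measure)"
proof (rule sym, rule lborel_eqI)
  fix l u :: complex
  assume lu: "\<And>b. b \<in> Basis \<Longrightarrow> l \<bullet> b \<le> u \<bullet> b"
  \<comment> \<open>\<open>T\<close> is multiplication by \<open>cnj c\<close>, the inverse
    rotation: the preimage of a box under multiplication by \<open>c\<close> is the image of that
    box under \<open>T\<close>.\<close>
  define T :: "real^2 \<Rightarrow> real^2" where
    "T v = vector [Re c * v$1 + Im c * v$2, Re c * v$2 - Im c * v$1]" for v
  have c2: "(Re c)\<^sup>2 + (Im c)\<^sup>2 = 1"
    using c by (simp add: cmod_def)
  have "linear T"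
    by (rule linearI) (auto simp: T_def vec_eq_iff forall_2 algebra_simps)
  moreover have "norm (T v) = norm v" for v
  proof -
    have "(norm (T v))\<^sup>2 = ((Re c)\<^sup>2 + (Im c)\<^sup>2) * (norm v)\<^sup>2"
      by (simp only: power2_norm_eq_inner)
         (simp add: inner_vec_def sum_2 T_def power2_eq_square algebra_simps)
    then show ?thesis
      by (simp add: c2)
  qed
  ultimately have T: "orthogonal_transformation T"
    by (simp add: orthogonal_transformation)
  have vT: "vec2_complex (T v) = cnj c * vec2_complex v" for v
    by (simp add: T_def vec2_complex_def complex_eq_iff)
  have inj: "vec2_complex v = vec2_complex w \<longleftrightarrow> v = w" for v w
    by (auto simp: vec2_complex_def vec_eq_iff forall_2)
  have surj: "\<exists>v. vec2_complex v = z" for z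
    by (rule exI[of _ "vector [Re z, Im z]"]) (simp add: vec2_complex_def)
  have cc: "c * cnj c = 1"
    using c by (simp add: complex_norm_square[symmetric])
  have ccx: "cnj c * (c * x) = x" "c * (cnj c * x) = x" for x
    using cc by (simp_all add: mult.assoc[symmetric] mult.commute[of "cnj c"])
  define S where "S = vec2_complex -` box l u"
  have S: "S = box (vector [Re l, Im l]) (vector [Re u, Im u])"
    unfolding S_def by (rule vec2_complex_vimage_box)
  have TS: "vec2_complex -` ((*) c -` box l u) = T ` S"
  proof (intro set_eqI iffI)
    fix v assume v: "v \<in> vec2_complex -` ((*) c -` box l u)"
    obtain w where w: "vec2_complex w = c * vec2_complex v"
      using surj by blast
    then have "vec2_complex (T w) = vec2_complex v"
      by (simp add: vT ccx)
    then have "v = T w" using inj by simp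
    moreover have "w \<in> S" using v w by (simp add: S_def)
    ultimately show "v \<in> T ` S" by blast
  next
    fix v assume "v \<in> T ` S"
    then obtain w where "w \<in> S" "v = T w" by blast
    then show "v \<in> vec2_complex -` ((*) c -` box l u)"
      by (simp add: vT ccx S_def)
  qed
  have Sm: "S \<in> lmeasurable"
    by (simp add: S)
  have TSb: "T ` S \<in> sets borel"
    unfolding TS[symmetric]
    by (intro measurable_sets_borel[where M = borel] vec2_complex_measurable) auto
  have "emeasure (distr lborel borel ((*) c)) (box l u) = emeasure lborel ((*) c -` box l u)"
    by (simp add: emeasure_distr)
  also have "\<dots> = emeasure (distr lborel borel vec2_complex) ((*) c -` box l u)"
    by (simp add: distr_vec2_complex)
  also have "\<dots> = emeasure lborel (T ` S)"
    by (subst emeasure_distr) (auto simp: TS intro!: measurable_sets_borel[where f="(*) c" and M=borel])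
  also have "\<dots> = emeasure lebesgue (T ` S)"
    using TSb by simp
  also have "\<dots> = emeasure lebesgue S"
    using measure_orthogonal_image[OF T Sm] measurable_orthogonal_image[OF T Sm] Sm
    by (simp add: emeasure_eq_measure2)
  also have "\<dots> = (\<Prod>b\<in>Basis. (u - l) \<bullet> b)"
    using emeasure_box_vec2[OF lu] by (simp add: S)
  finally show "emeasure (distr lborel borel ((*) c)) (box l u) = (\<Prod>b\<in>Basis. (u - l) \<bullet> b)" .
qed simp

lemma emeasure_disk_norm_greater:
  assumes "0 \<le> x" "x < 1"
  shows "emeasure lborel {z::complex\<in>disk. x < (cmod z)\<^sup>2} = ennreal (pi * (1 - x))"
proof -
  have vol: "emeasure lborel (cball (0::complex) r) = ennreal (pi * r\<^sup>2)"
       "emeasure lborel (ball (0::complex) r) = ennreal (pi * r\<^sup>2)" if "r \<ge> 0" for r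
    using emeasure_cball[OF that, of "0::complex"] emeasure_ball[OF that, of "0::complex"] by (auto simp: eval_unit_ball_vol)
  have "sqrt x < cmod z \<longleftrightarrow> x < (cmod z)\<^sup>2" for z
    using real_sqrt_less_iff[of x "(cmod z)\<^sup>2"] by simp
  then have eq: "{z::complex\<in>disk. x < (cmod z)\<^sup>2} = disk - cball 0 (sqrt x)"
    by (intro set_eqI) (simp only: mem_Collect_eq Diff_iff mem_cball dist_0_norm not_le)
  have sub: "cball 0 (sqrt x) \<subseteq> (disk :: complex set)"
    using assms by (simp add: cball_subset_ball_iff)
  have "emeasure lborel (disk - cball 0 (sqrt x) :: complex set) = ennreal (pi * 1) - ennreal (pi * x)"
    using vol(1)[of "sqrt x"] vol(2)[of 1] assms sub by (subst emeasure_Diff) auto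
  also have "\<dots> = ennreal (pi * (1 - x))"
    using assms by (simp add: ennreal_minus algebra_simps)
  finally show ?thesis by (simp only: eq)
qed

text \<open>The part of the disk where |z|^2 exceeds x has area pi (1 - x), so the squared modulus
  is uniformly distributed on [0, 1] with total mass pi. This reduces radial integrals to one real
  variable without polar coordinates.\<close>

lemma distr_disk_norm_square:
  "distr (restrict_space lborel disk) borel (\<lambda>z::complex. (cmod z)\<^sup>2)
   = density lborel (\<lambda>t. ennreal (pi * indicator {0..1} t))"
proof (rule measure_eqI_lessThan)
  let ?M = "distr (restrict_space lborel disk) borel (\<lambda>z::complex. (cmod z)\<^sup>2)"
  let ?N = "density lborel (\<lambda>t. ennreal (pi * indicator {0..1} t)) :: real measure"
  have M: "emeasure ?M {x<..} = emeasure lborel {z::complex\<in>disk. x < (cmod z)\<^sup>2}" for x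
    by (subst emeasure_distr)
       (auto simp: emeasure_restrict_space space_restrict_space intro!: measurable_restrict_space1 arg_cong[where f="emeasure lborel"])
  have N: "emeasure ?N {x<..} = ennreal pi * emeasure lborel ({0..1} \<inter> {x<..})" for x
  proof -
    have "emeasure ?N {x<..} = (\<integral>\<^sup>+t. ennreal pi * indicator ({0..1} \<inter> {x<..}) t \<partial>lborel)"
      by (subst emeasure_density) (auto intro!: nn_integral_cong simp: indicator_def)
    then show ?thesis by (simp add: nn_integral_cmult)
  qed
  have eq: "emeasure ?M {x<..} = emeasure ?N {x<..}" for x
  proof -
    consider "x < 0" | "0 \<le> x" "x < 1" | "1 \<le> x" by linarith
    then show ?thesis
    proof cases
      case 1
      have "{z::complex\<in>disk. x < (cmod z)\<^sup>2} = disk"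
        using less_le_trans[OF 1 zero_le_power2] by blast
      moreover have "{0..1} \<inter> {x<..} = {0..1}"
        using 1 by auto
      ultimately show ?thesis
        unfolding M N using emeasure_ball[of 1 "0::complex"] by (simp add: eval_unit_ball_vol)
    next
      case 2
      have "{0..1} \<inter> {x<..} = {x<..1}" using 2 by auto
      moreover have "ennreal (pi * (1 - x)) = ennreal pi * ennreal (1 - x)"
        by (rule ennreal_mult) (use 2 in auto)
      ultimately show ?thesis
        unfolding M N using 2 emeasure_disk_norm_greater[OF 2] by (metis emeasure_lborel_Ioc less_imp_le)
    next
      case 3
      have *: "{z::complex\<in>disk. x < (cmod z)\<^sup>2} = {}"
      proof -
        have "(cmod z)\<^sup>2 \<le> 1" if "z \<in> disk" for z :: complex
          using that by (simp add: power_le_one)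
        with 3 show ?thesis by fastforce
      qed
      moreover have "{0..1} \<inter> {x<..} = {}" using 3 by auto
      ultimately show ?thesis by (simp only: M N) simp
    qed
  qed
  show "emeasure ?M {x<..} = emeasure ?N {x<..}" for x by (fact eq)
  show "emeasure ?M {x<..} < \<infinity>" for x
  proof -
    have "emeasure lborel {z::complex\<in>disk. x < (cmod z)\<^sup>2} \<le> emeasure lborel (disk::complex set)"
      by (rule emeasure_mono) auto
    also have "\<dots> < \<infinity>"
      using emeasure_bounded_finite[OF bounded_ball] by simp
    finally show ?thesis unfolding M .
  qed
qed auto

text \<open>The space itself is restricted to \<open>disk\<close>, so pointwise hypotheses are only
  needed there. The normalising factor of the inner product is absent, as it is in
  \<open>J\<close>.\<close>

definition disk_measure :: "real \<Rightarrow> complex measure" where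
  "disk_measure \<alpha> = density (restrict_space lborel disk) (\<lambda>z. ennreal (weight \<alpha> z))"

lemma space_disk_measure [simp]: "space (disk_measure \<alpha>) = disk"
  by (simp add: disk_measure_def space_restrict_space)

lemma sets_disk_measure: "sets (disk_measure \<alpha>) = sets (restrict_space borel disk)"
  by (simp add: disk_measure_def sets_restrict_space)

lemma measurable_disk_measure [simp]:
  "measurable (disk_measure \<alpha>) N = measurable (restrict_space borel disk) N"
  "measurable N (disk_measure \<alpha>) = measurable N (restrict_space borel disk)"
  by (intro measurable_cong_sets; simp add: sets_disk_measure)+

lemma rotation_measurable_disk:
  assumes "cmod c = 1"
  shows "(*) c \<in> measurable (restrict_space borel disk) (restrict_space borel disk)"
  using assms by (intro measurable_restrict_space3) (auto simp: norm_mult)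

lemma weight_nonneg [simp]: "weight \<alpha> z \<ge> 0"
  by (simp add: weight_def)

lemma weight_measurable [measurable]: "weight \<alpha> \<in> borel_measurable borel"
  unfolding weight_def by measurable

lemma weight_measurable' [measurable]: "weight \<alpha> \<in> borel_measurable (restrict_space lborel S)"
  by (rule measurable_restrict_space1) simp

lemma nn_integral_disk_measure_norm:
  assumes [measurable]: "f \<in> borel_measurable borel"
  shows "(\<integral>\<^sup>+z. f ((cmod z)\<^sup>2) \<partial>disk_measure \<alpha>) =
    ennreal pi * (\<integral>\<^sup>+t\<in>{0..1}. ennreal ((1 - t) powr (\<alpha> - 2)) * f t \<partial>lborel)"
proof -
  have [measurable]: "(\<lambda>z::complex. f ((cmod z)\<^sup>2)) \<in> borel_measurable (restrict_space lborel disk)"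
    by (rule measurable_restrict_space1) simp
  have [measurable]: "(\<lambda>z::complex. (cmod z)\<^sup>2) \<in> borel_measurable (restrict_space lborel disk)"
    by (rule measurable_restrict_space1) simp
  let ?g = "\<lambda>t. ennreal ((1 - t) powr (\<alpha> - 2)) * f t"
  have "(\<integral>\<^sup>+z. f ((cmod z)\<^sup>2) \<partial>disk_measure \<alpha>) =
      (\<integral>\<^sup>+z. ?g ((cmod z)\<^sup>2) \<partial>restrict_space lborel disk)"
    unfolding disk_measure_def
    by (subst nn_integral_density) (auto simp: weight_def)
  also have "\<dots> = (\<integral>\<^sup>+t. ?g t \<partial>distr (restrict_space lborel disk) borel (\<lambda>z. (cmod z)\<^sup>2))"
    by (subst nn_integral_distr) auto
  also have "\<dots> = (\<integral>\<^sup>+t. ennreal (pi * indicator {0..1} t) * ?g t \<partial>lborel)"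
    by (simp add: distr_disk_norm_square nn_integral_density)
  also have "\<dots> = (\<integral>\<^sup>+t. ennreal pi * (?g t * indicator {0..1} t) \<partial>lborel)"
    by (intro nn_integral_cong) (auto simp: indicator_def)
  also have "\<dots> = ennreal pi * (\<integral>\<^sup>+t\<in>{0..1}. ?g t \<partial>lborel)"
    by (rule nn_integral_cmult) auto
  finally show ?thesis .
qed

text \<open>With t = |z|^2 the integral of |z|^(2n) against the weight becomes pi times an Euler
  Beta integral; the closed form gives access to the two-term recursion of the Beta
  function.\<close>

definition moment :: "real \<Rightarrow> nat \<Rightarrow> real" where
  "moment \<alpha> n = pi * Beta (real n + 1) (\<alpha> - 1)"

lemma moment_pos: "\<alpha> > 1 \<Longrightarrow> moment \<alpha> n > 0"
  by (simp add: moment_def Beta_def Gamma_real_pos)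

lemma moment_Suc:
  assumes "\<alpha> > 1"
  shows "(real n + \<alpha>) * moment \<alpha> (Suc n) = (real n + 1) * moment \<alpha> n"
proof -
  have "(real n + 1 + (\<alpha> - 1)) * Beta (real n + 1 + 1) (\<alpha> - 1) = (real n + 1) * Beta (real n + 1) (\<alpha> - 1)"
    by (rule Beta_plus1_left) (auto dest: nonpos_Ints_nonpos)
  then show ?thesis
    by (simp add: moment_def algebra_simps)
qed

lemma nn_integral_disk_measure_power:
  assumes "\<alpha> > 1"
  shows "(\<integral>\<^sup>+z. ennreal ((cmod z)\<^sup>2 ^ n) \<partial>disk_measure \<alpha>) = ennreal (moment \<alpha> n)"
proof -
  let ?g = "\<lambda>t::real. t powr (real n + 1 - 1) * (1 - t) powr (\<alpha> - 1 - 1)"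
  have hi: "(?g has_integral Beta (real n + 1) (\<alpha> - 1)) {0..1}"
    using assms by (intro has_integral_Beta_real) auto
  have "(\<integral>\<^sup>+z. ennreal ((cmod z)\<^sup>2 ^ n) \<partial>disk_measure \<alpha>)
      = ennreal pi * (\<integral>\<^sup>+t\<in>{0..1}. ennreal ((1 - t) powr (\<alpha> - 2)) * ennreal (t ^ n) \<partial>lborel)"
    by (rule nn_integral_disk_measure_norm) auto
  also have "(\<integral>\<^sup>+t\<in>{0..1}. ennreal ((1 - t) powr (\<alpha> - 2)) * ennreal (t ^ n) \<partial>lborel) =
    (\<integral>\<^sup>+t\<in>{0..1}. ennreal (?g t) \<partial>lborel)"
  proof (rule nn_integral_cong_AE)
    \<comment> \<open>The point 0 has to be discarded: for \<open>n = 0\<close> the left side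
      contains \<open>0 ^ 0 = 1\<close>, the right side \<open>0 powr 0 = 0\<close>.\<close>
    show "AE t in lborel. ennreal ((1 - t) powr (\<alpha> - 2)) * ennreal (t ^ n) * indicator {0..1} t =
        ennreal (?g t) * indicator {0..1} t"
    proof (rule AE_mp[OF AE_lborel_singleton[of 0]], rule AE_I2, rule impI)
      fix t :: real assume "t \<noteq> 0"
      show "ennreal ((1 - t) powr (\<alpha> - 2)) * ennreal (t ^ n) * indicator {0..1} t =
        ennreal (?g t) * indicator {0..1} t"
      proof (cases "t \<in> {0..1}")
        case True
        with \<open>t \<noteq> 0\<close> show ?thesis by (simp add: powr_realpow ennreal_mult'[symmetric] mult.commute)
      qed simp
    qed
  qed
  also have "\<dots> = ennreal (Beta (real n + 1) (\<alpha> - 1))"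
  proof (rule nn_integral_has_integral_lebesgue'[OF _ hi])
    show "\<And>t. 0 \<le> ?g t" by simp
  qed
  finally show ?thesis
    by (simp add: moment_def ennreal_mult')
qed

lemma finite_measure_disk_measure:
  assumes "\<alpha> > 1"
  shows "finite_measure (disk_measure \<alpha>)"
proof
  have "emeasure (disk_measure \<alpha>) (space (disk_measure \<alpha>)) = ennreal (moment \<alpha> 0)"
    using nn_integral_disk_measure_power[OF assms, of 0] by simp
  then show "emeasure (disk_measure \<alpha>) (space (disk_measure \<alpha>)) \<noteq> \<infinity>"
    by simp
qed

lemma distr_disk_measure_rotation:
  assumes c: "cmod c = 1"
  shows "distr (disk_measure \<alpha>) (disk_measure \<alpha>) ((*) c) = disk_measure \<alpha>"
proof (rule measure_eqI)
  fix A assume "A \<in> sets (distr (disk_measure \<alpha>) (disk_measure \<alpha>) ((*) c))"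
  then have A: "A \<in> sets (restrict_space borel disk)"
    by (simp add: sets_disk_measure)
  then have A': "A \<in> sets borel" "A \<subseteq> disk"
    by (auto simp: sets_restrict_space)
  have mc: "(*) c \<in> measurable (restrict_space borel disk) (disk_measure \<alpha>)"
    using rotation_measurable_disk[OF c] by simp
  have "(*) c -` A \<in> sets borel"
    using A'(1) by (intro measurable_sets_borel[where M = borel]) auto
  moreover have "z \<in> disk" if "c * z \<in> A" for z
  proof -
    have "c * z \<in> disk" using that A'(2) by blast
    then show ?thesis using c by (simp add: norm_mult)
  qed
  ultimately have B: "(*) c -` A \<in> sets borel" "(*) c -` A \<subseteq> disk"
    by (simp, intro subsetI, simp only: vimage_eq)
  have em: "emeasure (disk_measure \<alpha>) B = (\<integral>\<^sup>+z. ennreal (weight \<alpha> z) * indicator B z \<partial>lborel)"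
    if "B \<in> sets borel" "B \<subseteq> disk" for B
  proof -
    have [measurable]: "B \<in> sets (restrict_space lborel disk)" "B \<in> sets borel"
      using that by (auto simp: sets_restrict_space)
    have "emeasure (disk_measure \<alpha>) B = (\<integral>\<^sup>+z. ennreal (weight \<alpha> z) * indicator B z \<partial>restrict_space lborel disk)"
      unfolding disk_measure_def by (subst emeasure_density) auto
    also have "\<dots> = (\<integral>\<^sup>+z. ennreal (weight \<alpha> z) * indicator B z * indicator disk z \<partial>lborel)"
      by (subst nn_integral_restrict_space) auto
    also have "\<dots> = (\<integral>\<^sup>+z. ennreal (weight \<alpha> z) * indicator B z \<partial>lborel)"
      using that by (intro nn_integral_cong) (auto simp: indicator_def)
    finally show ?thesis .
  qed
  have "emeasure (distr (disk_measure \<alpha>) (disk_measure \<alpha>) ((*) c)) A = emeasure (disk_measure \<alpha>) ((*) c -` A)"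
    using mc A B(2) by (subst emeasure_distr) (auto simp: sets_disk_measure Int_absorb2)
  also have "\<dots> = (\<integral>\<^sup>+z. ennreal (weight \<alpha> z) * indicator ((*) c -` A) z \<partial>lborel)"
    by (rule em[OF B])
  also have "\<dots> = (\<integral>\<^sup>+z. ennreal (weight \<alpha> (c * z)) * indicator A (c * z) \<partial>lborel)"
    using c by (intro nn_integral_cong) (auto simp: weight_def norm_mult indicator_def)
  also have "\<dots> = (\<integral>\<^sup>+z. ennreal (weight \<alpha> z) * indicator A z \<partial>distr lborel borel ((*) c))"
    using A' by (subst nn_integral_distr) auto
  also have "\<dots> = emeasure (disk_measure \<alpha>) A"
    by (simp add: lborel_distr_complex_rotation[OF c] em[OF A'])
  finally show "emeasure (distr (disk_measure \<alpha>) (disk_measure \<alpha>) ((*) c)) A = emeasure (disk_measure \<alpha>) A" .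
qed simp

text \<open>For distinct exponents, rotation by the angle pi / (n - m) preserves the measure and
  multiplies the integrand by -1, so the integral equals its own negative.\<close>

lemma integral_disk_measure_monomial:
  assumes a: "\<alpha> > 1"
  shows "(\<integral>z. cnj z ^ m * z ^ n \<partial>disk_measure \<alpha>) = (if m = n then of_real (moment \<alpha> n) else 0)"
proof (cases "m = n")
  case True
  have eq: "cnj z ^ m * z ^ n = complex_of_real ((cmod z)\<^sup>2 ^ n)" for z
    unfolding of_real_power[of _ n] complex_norm_square power_mult_distrib
    by (simp only: True mult.commute)
  have "(\<integral>z. cnj z ^ m * z ^ n \<partial>disk_measure \<alpha>) = (\<integral>z. complex_of_real ((cmod z)\<^sup>2 ^ n) \<partial>disk_measure \<alpha>)"
    by (simp only: eq)
  also have "\<dots> = of_real (\<integral>z. (cmod z)\<^sup>2 ^ n \<partial>disk_measure \<alpha>)"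
    by (rule integral_complex_of_real)
  also have "(\<integral>z. (cmod z)\<^sup>2 ^ n \<partial>disk_measure \<alpha>) = moment \<alpha> n"
    using moment_pos[OF a, of n]
    by (intro nn_integral_eq_integrable[THEN iffD1, THEN conjunct2])
       (simp_all add: nn_integral_disk_measure_power[OF a] measurable_restrict_space1)
  finally show ?thesis using True by simp
next
  case False
  define d where "d = int n - int m"
  define c where "c = cis (pi / of_int d)"
  have d: "d \<noteq> 0" using False by (simp add: d_def)
  have c: "cmod c = 1" by (simp add: c_def)
  have cc: "c * cnj c = 1"
    using c by (simp add: complex_norm_square[symmetric])
  have cd: "cnj c ^ m * c ^ n = -1"
  proof -
    have "cnj c ^ m * c ^ n = cis (of_int d * (pi / of_int d))"
      by (simp add: c_def cis_cnj Complex.DeMoivre cis_mult d_def algebra_simps diff_divide_distrib)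
    then show ?thesis using d by simp
  qed
  let ?f = "\<lambda>z. cnj z ^ m * z ^ n"
  have mf: "?f \<in> borel_measurable (restrict_space borel disk)"
    by (intro borel_measurable_continuous_on_restrict continuous_intros)
  have mc: "(*) c \<in> measurable (disk_measure \<alpha>) (disk_measure \<alpha>)"
    using rotation_measurable_disk[OF c] by simp
  have "(\<integral>z. ?f z \<partial>disk_measure \<alpha>) = (\<integral>z. ?f z \<partial>distr (disk_measure \<alpha>) (disk_measure \<alpha>) ((*) c))"
    by (simp add: distr_disk_measure_rotation[OF c])
  also have "\<dots> = (\<integral>z. ?f (c * z) \<partial>disk_measure \<alpha>)"
    using mf by (subst integral_distr[OF mc]) simp_all
  also have "\<dots> = (\<integral>z. (cnj c ^ m * c ^ n) * ?f z \<partial>disk_measure \<alpha>)"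
    by (simp add: power_mult_distrib mult_ac)
  also have "\<dots> = - (\<integral>z. ?f z \<partial>disk_measure \<alpha>)"
    by (simp add: cd)
  finally have "(\<integral>z. ?f z \<partial>disk_measure \<alpha>) = 0" by (simp add: eq_neg_iff_add_eq_0)
  then show ?thesis using False by simp
qed

section \<open>The pairing of holomorphic functions of one variable\<close>

text \<open>Constants are integrable on a finite measure space, so a summable sequence of uniform
  bounds is enough to integrate term by term.\<close>

lemma (in finite_measure) sums_integral_dominated:
  fixes f :: "nat \<Rightarrow> 'a \<Rightarrow> complex"
  assumes meas: "\<And>n. f n \<in> borel_measurable M"
    and bound: "\<And>n x. x \<in> space M \<Longrightarrow> norm (f n x) \<le> B n" and B: "summable B"
    and sums: "\<And>x. x \<in> space M \<Longrightarrow> (\<lambda>n. f n x) sums F x"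
  shows "(\<lambda>n. integral\<^sup>L M (f n)) sums integral\<^sup>L M F"
proof -
  have int: "integrable M (f n)" for n
    using bound by (intro integrable_const_bound[where B = "B n"] AE_I2 meas)
  have summ: "summable (\<lambda>n. norm (f n x))" if "x \<in> space M" for x
    using bound[OF that] by (intro summable_comparison_test'[OF B, of 0]) auto
  have "norm (\<integral>x. norm (f n x) \<partial>M) \<le> measure M (space M) * B n" for n
  proof -
    have "(\<integral>x. norm (f n x) \<partial>M) \<le> (\<integral>x. B n \<partial>M)"
      using bound int by (intro integral_mono) auto
    then show ?thesis
      by simp
  qed
  then have "summable (\<lambda>n. \<integral>x. norm (f n x) \<partial>M)"
    by (intro summable_comparison_test'[OF summable_mult[OF B], of 0])
  then have "(\<lambda>n. integral\<^sup>L M (f n)) sums (\<integral>x. (\<Sum>n. f n x) \<partial>M)"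
    using summ by (intro sums_integral int AE_I2)
  also have "(\<integral>x. (\<Sum>n. f n x) \<partial>M) = integral\<^sup>L M F"
    using sums by (intro Bochner_Integration.integral_cong) (auto simp: sums_iff)
  finally show ?thesis .
qed

lemma power_series_summable_norm_coeffs:
  fixes a :: "nat \<Rightarrow> complex"
  assumes "R > 1" "\<And>z. z \<in> ball 0 R \<Longrightarrow> (\<lambda>n. a n * z ^ n) sums g z"
  shows "summable (\<lambda>n. cmod (a n))"
proof -
  \<comment> \<open>Convergence at a point of modulus strictly between 1 and \<open>R\<close> forces
    absolute convergence at 1.\<close>
  define x where "x = complex_of_real ((1 + R) / 2)"
  have x: "cmod x < R" "1 < cmod x"
    unfolding x_def norm_of_real using assms(1) by auto
  have "summable (\<lambda>n. a n * x ^ n)"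
    using assms(2)[of x] x by (auto simp: sums_iff)
  then have "summable (\<lambda>n. norm (a n * 1 ^ n))"
    by (rule powser_insidea) (use x in simp)
  then show ?thesis by simp
qed

text \<open>Parseval's identity in bilinear form: \<open>g\<close> is evaluated at
  \<open>cnj z\<close>, so no coefficient is conjugated. The series of \<open>h\<close> is
  integrated against a monomial first, where orthogonality leaves a single term, and the series of
  \<open>g\<close> afterwards.\<close>

lemma pairing_sums:
  assumes \<alpha>: "\<alpha> > 1" and R: "R > 1"
    and g: "\<And>z. z \<in> ball 0 R \<Longrightarrow> (\<lambda>n. a n * z ^ n) sums g z"
    and h: "\<And>z. z \<in> ball 0 R \<Longrightarrow> (\<lambda>n. b n * z ^ n) sums h z"
  shows "(\<lambda>n. a n * b n * of_real (moment \<alpha> n)) sums (\<integral>z. g (cnj z) * h z \<partial>disk_measure \<alpha>)"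
proof -
  interpret finite_measure "disk_measure \<alpha>"
    by (rule finite_measure_disk_measure[OF \<alpha>])
  have sa: "summable (\<lambda>n. cmod (a n))" and sb: "summable (\<lambda>n. cmod (b n))"
    using power_series_summable_norm_coeffs[OF R g] power_series_summable_norm_coeffs[OF R h] by auto
  have pow: "cmod z ^ n \<le> 1" if "z \<in> disk" for z n
    using that by (intro power_le_one) auto
  have meas: "(\<lambda>z. cnj z ^ m * z ^ n) \<in> borel_measurable (restrict_space borel disk)" for m n
    by (intro borel_measurable_continuous_on_restrict continuous_intros)
  have mono: "(\<integral>z. cnj z ^ m * h z \<partial>disk_measure \<alpha>) = b m * of_real (moment \<alpha> m)" for m
  proof -
    have "(\<lambda>n. \<integral>z. b n * (cnj z ^ m * z ^ n) \<partial>disk_measure \<alpha>) sums (\<integral>z. cnj z ^ m * h z \<partial>disk_measure \<alpha>)"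
    proof (rule sums_integral_dominated[OF _ _ sb])
      fix n z assume "z \<in> space (disk_measure \<alpha>)"
      then have z: "z \<in> disk" by simp
      show "cmod (b n * (cnj z ^ m * z ^ n)) \<le> cmod (b n)"
        using mult_left_mono[OF pow[OF z, of "m + n"], of "cmod (b n)"]
        by (simp add: norm_mult norm_power power_add)
    next
      fix z assume "z \<in> space (disk_measure \<alpha>)"
      then have "(\<lambda>n. cnj z ^ m * (b n * z ^ n)) sums (cnj z ^ m * h z)"
        using R by (intro sums_mult h) auto
      then show "(\<lambda>n. b n * (cnj z ^ m * z ^ n)) sums (cnj z ^ m * h z)"
        by (simp add: mult_ac)
    qed (use meas in simp)
    moreover have "(\<lambda>n. \<integral>z. b n * (cnj z ^ m * z ^ n) \<partial>disk_measure \<alpha>)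
        = (\<lambda>n. if n = m then b m * of_real (moment \<alpha> m) else 0)"
      by (auto simp: integral_disk_measure_monomial[OF \<alpha>])
    ultimately show ?thesis
      using sums_single[of m "\<lambda>_. b m * of_real (moment \<alpha> m)"] by (simp add: sums_unique2)
  qed
  \<comment> \<open>Nothing is assumed about \<open>h\<close> except its series. Uniform convergence
    on the closed disk gives the continuity from which measurability in the second summation is
    obtained.\<close>
  have h_cont: "continuous_on disk h"
  proof -
    have "continuous_on (cball 0 1) (\<lambda>z. \<Sum>n. b n * z ^ n)"
    proof (rule uniform_limit_theorem[OF _ Weierstrass_m_test[OF _ sb]])
      show "\<And>n x. x \<in> cball 0 1 \<Longrightarrow> cmod (b n * x ^ n) \<le> cmod (b n)"
        by (auto simp: norm_mult norm_power intro!: mult_left_le power_le_one)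
    qed (auto intro!: always_eventually continuous_intros)
    then have "continuous_on disk (\<lambda>z. \<Sum>n. b n * z ^ n)"
      by (rule continuous_on_subset) auto
    then show ?thesis
      using h R by (subst continuous_on_cong[OF refl, of _ h "\<lambda>z. \<Sum>n. b n * z ^ n"])
        (auto simp: sums_iff)
  qed
  have h_bound: "cmod (h z) \<le> (\<Sum>n. cmod (b n))" if "z \<in> disk" for z
  proof -
    have s: "(\<lambda>n. b n * z ^ n) sums h z"
      using h R that by auto
    have le: "cmod (b n * z ^ n) \<le> cmod (b n)" for n
      using pow[OF that, of n] by (simp add: norm_mult norm_power mult_left_le)
    have "cmod (\<Sum>n. b n * z ^ n) \<le> (\<Sum>n. cmod (b n))"
      by (rule norm_suminf_le[OF le sb])
    with s show ?thesis by (simp add: sums_iff)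
  qed
  have "(\<lambda>n. \<integral>z. a n * (cnj z ^ n * h z) \<partial>disk_measure \<alpha>) sums (\<integral>z. g (cnj z) * h z \<partial>disk_measure \<alpha>)"
  proof (rule sums_integral_dominated[OF _ _ summable_mult2[OF sa]])
    fix n z assume "z \<in> space (disk_measure \<alpha>)"
    then have z: "z \<in> disk" by simp
    show "cmod (a n * (cnj z ^ n * h z)) \<le> cmod (a n) * (\<Sum>n. cmod (b n))"
      using mult_left_mono[OF mult_mono[OF pow[OF z, of n] h_bound[OF z] zero_le_one norm_ge_zero], of "cmod (a n)"]
      by (simp add: norm_mult norm_power)
  next
    fix z assume "z \<in> space (disk_measure \<alpha>)"
    then have "(\<lambda>n. a n * cnj z ^ n * h z) sums (g (cnj z) * h z)"
      using R by (intro sums_mult2 g) auto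
    then show "(\<lambda>n. a n * (cnj z ^ n * h z)) sums (g (cnj z) * h z)"
      by (simp add: mult_ac)
  next
    show "(\<lambda>z. a n * (cnj z ^ n * h z)) \<in> borel_measurable (disk_measure \<alpha>)" for n
      using h_cont by (simp, intro borel_measurable_continuous_on_restrict continuous_intros)
  qed
  then show ?thesis
    by (simp add: mono mult.assoc)
qed

section \<open>Operators on Taylor coefficients and their adjoints in one variable\<close>

lemma power_series_mult_z:
  fixes a :: "nat \<Rightarrow> complex"
  assumes "(\<lambda>n. a n * z ^ n) sums s"
  shows "(\<lambda>n. (case n of 0 \<Rightarrow> 0 | Suc k \<Rightarrow> a k) * z ^ n) sums (z * s)"
proof -
  have "(\<lambda>n. z * (a n * z ^ n)) sums (z * s)"
    by (rule sums_mult[OF assms])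
  then have "(\<lambda>n. (case Suc n of 0 \<Rightarrow> 0 | Suc k \<Rightarrow> a k) * z ^ Suc n) sums (z * s)"
    by (simp add: mult_ac)
  from sums_Suc[OF this] show ?thesis by simp
qed

definition taylor :: "(complex \<Rightarrow> complex) \<Rightarrow> nat \<Rightarrow> complex" where
  "taylor g n = (deriv ^^ n) g 0 / fact n"

lemma taylor_sums:
  assumes "g holomorphic_on ball 0 R" "z \<in> ball 0 R"
  shows "(\<lambda>n. taylor g n * z ^ n) sums g z"
  using holomorphic_power_series[OF assms] by (simp add: taylor_def)

lemma taylor_deriv_sums:
  assumes "g holomorphic_on ball 0 R" "z \<in> ball 0 R"
  shows "(\<lambda>n. of_nat (Suc n) * taylor g (Suc n) * z ^ n) sums deriv g z"
proof -
  have "taylor (deriv g) n = of_nat (Suc n) * taylor g (Suc n)" for n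
    by (simp add: taylor_def funpow_Suc_right field_simps del: funpow.simps of_nat_Suc)
  then show ?thesis
    using taylor_sums[of "deriv g" R z] assms holomorphic_deriv[OF assms(1) open_ball] by simp
qed

lemma taylor_euler_sums:
  assumes "g holomorphic_on ball 0 R" "z \<in> ball 0 R"
  shows "(\<lambda>n. of_nat n * taylor g n * z ^ n) sums (z * deriv g z)"
proof -
  have "of_nat n * taylor g n = (case n of 0 \<Rightarrow> 0 | Suc k \<Rightarrow> of_nat (Suc k) * taylor g (Suc k))" for n
    by (cases n) auto
  then show ?thesis
    using power_series_mult_z[OF taylor_deriv_sums[OF assms]] by simp
qed

text \<open>On coefficients a dilation is multiplication by \<open>r ^ n\<close>, and in the
  Parseval sum this factor may be attached to either function.\<close>

lemma pairing_dilation: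
  assumes "\<alpha> > 1" "R > 1" "g holomorphic_on ball 0 R" "h holomorphic_on ball 0 R" "cmod r \<le> 1"
  shows "(\<integral>z. g (r * cnj z) * h z \<partial>disk_measure \<alpha>) = (\<integral>z. g (cnj z) * h (r * z) \<partial>disk_measure \<alpha>)"
proof -
  have r: "r * z \<in> ball 0 R" if "z \<in> ball 0 R" for z
    using that assms(5) mult_left_le_one_le[of "cmod z" "cmod r"] by (auto simp: norm_mult)
  have "(\<lambda>n. (taylor g n * r ^ n) * taylor h n * of_real (moment \<alpha> n)) sums
     (\<integral>z. g (r * cnj z) * h z \<partial>disk_measure \<alpha>)"
    using taylor_sums[OF assms(3) r] taylor_sums[OF assms(4)]
    by (intro pairing_sums[OF assms(1,2)]) (auto simp: power_mult_distrib mult.assoc)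
  moreover have "(\<lambda>n. taylor g n * (taylor h n * r ^ n) * of_real (moment \<alpha> n)) sums
     (\<integral>z. g (cnj z) * h (r * z) \<partial>disk_measure \<alpha>)"
    using taylor_sums[OF assms(3)] taylor_sums[OF assms(4) r]
    by (intro pairing_sums[OF assms(1,2)]) (auto simp: power_mult_distrib mult.assoc)
  ultimately show ?thesis
    by (simp add: mult_ac sums_unique2)
qed

lemma pairing_commute:
  assumes "\<alpha> > 1" "R > 1" "g holomorphic_on ball 0 R" "h holomorphic_on ball 0 R"
  shows "(\<integral>z. g (cnj z) * h z \<partial>disk_measure \<alpha>) = (\<integral>z. h (cnj z) * g z \<partial>disk_measure \<alpha>)"
  using pairing_sums[OF assms(1,2) taylor_sums[OF assms(3)] taylor_sums[OF assms(4)]]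
    pairing_sums[OF assms(1,2) taylor_sums[OF assms(4)] taylor_sums[OF assms(3)]]
  by (simp add: mult_ac sums_unique2)

lemma pairing_euler:
  assumes "\<alpha> > 1" "R > 1" "g holomorphic_on ball 0 R" "h holomorphic_on ball 0 R"
  shows "(\<integral>z. (cnj z * deriv g (cnj z)) * h z \<partial>disk_measure \<alpha>) =
    (\<integral>z. g (cnj z) * (z * deriv h z) \<partial>disk_measure \<alpha>)"
  using pairing_sums[OF assms(1,2) taylor_euler_sums[OF assms(3)] taylor_sums[OF assms(4)]]
    pairing_sums[OF assms(1,2) taylor_sums[OF assms(3)] taylor_euler_sums[OF assms(4)]]
  by (simp add: mult_ac sums_unique2)

text \<open>Term by term this is \<open>moment_Suc\<close>. The outer factor \<open>z\<close> on the
  right shifts the index by one and removes the constant term of that factor, which matches the loss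
  of \<open>taylor g 0\<close> under differentiation on the left.\<close>

lemma pairing_deriv:
  assumes "\<alpha> > 1" "R > 1" "g holomorphic_on ball 0 R" "h holomorphic_on ball 0 R"
  shows "(\<integral>z. deriv g (cnj z) * h z \<partial>disk_measure \<alpha>) =
    (\<integral>z. g (cnj z) * (z * (z * deriv h z + of_real \<alpha> * h z)) \<partial>disk_measure \<alpha>)"
proof -
  define b where "b n = (of_nat n + of_real \<alpha>) * taylor h n" for n
  have "(\<lambda>n. b n * z ^ n) sums (z * deriv h z + of_real \<alpha> * h z)" if "z \<in> ball 0 R" for z
    using sums_add[OF taylor_euler_sums[OF assms(4) that] sums_mult[OF taylor_sums[OF assms(4) that]], of "of_real \<alpha>"]
    by (simp add: b_def algebra_simps)
  from power_series_mult_z[OF this]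
  have sh: "\<And>z. z \<in> ball 0 R \<Longrightarrow> (\<lambda>n. (case n of 0 \<Rightarrow> 0 | Suc k \<Rightarrow> b k) * z ^ n) sums
     (z * (z * deriv h z + of_real \<alpha> * h z))" .
  have 1: "(\<lambda>n. of_nat (Suc n) * taylor g (Suc n) * taylor h n * of_real (moment \<alpha> n)) sums
    (\<integral>z. deriv g (cnj z) * h z \<partial>disk_measure \<alpha>)"
    by (rule pairing_sums[OF assms(1,2) taylor_deriv_sums[OF assms(3)] taylor_sums[OF assms(4)]])
  have 2: "(\<lambda>n. taylor g n * (case n of 0 \<Rightarrow> 0 | Suc k \<Rightarrow> b k) * of_real (moment \<alpha> n)) sums
    (\<integral>z. g (cnj z) * (z * (z * deriv h z + of_real \<alpha> * h z)) \<partial>disk_measure \<alpha>)"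
    by (rule pairing_sums[OF assms(1,2) taylor_sums[OF assms(3)] sh])
  have eq: "of_nat (Suc n) * taylor g (Suc n) * taylor h n * of_real (moment \<alpha> n) =
     taylor g (Suc n) * b n * of_real (moment \<alpha> (Suc n))" for n
  proof -
    have "complex_of_real (real (Suc n) * moment \<alpha> n) = of_real ((real n + \<alpha>) * moment \<alpha> (Suc n))"
      using moment_Suc[OF assms(1), of n] by (simp add: add.commute)
    then have "of_nat (Suc n) * complex_of_real (moment \<alpha> n) =
        (of_nat n + of_real \<alpha>) * of_real (moment \<alpha> (Suc n))"
      unfolding of_real_mult of_real_add of_real_of_nat_eq .
    then show ?thesis
      unfolding b_def by (metis (no_types, lifting) mult.assoc mult.commute)
  qed
  then have "(\<lambda>n. taylor g (Suc n) * b n * of_real (moment \<alpha> (Suc n))) sums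
    (\<integral>z. deriv g (cnj z) * h z \<partial>disk_measure \<alpha>)"
    using 1 by (simp only: eq)
  then have "(\<lambda>n. taylor g n * (case n of 0 \<Rightarrow> 0 | Suc k \<Rightarrow> b k) * of_real (moment \<alpha> n)) sums
    (\<integral>z. deriv g (cnj z) * h z \<partial>disk_measure \<alpha>)"
    using sums_Suc[of "\<lambda>n. taylor g n * (case n of 0 \<Rightarrow> 0 | Suc k \<Rightarrow> b k) * of_real (moment \<alpha> n)"]
    by simp
  with 2 show ?thesis by (rule sums_unique2[symmetric])
qed

text \<open>The mirror image of \<open>pairing_deriv\<close>: the pairing is symmetric, so the two
  functions may exchange their roles.\<close>

lemma pairing_shift:
  assumes "\<alpha> > 1" "R > 1" "g holomorphic_on ball 0 R" "h holomorphic_on ball 0 R"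
  shows "(\<integral>z. (cnj z * (cnj z * deriv g (cnj z) + of_real \<alpha> * g (cnj z))) * h z \<partial>disk_measure \<alpha>) =
    (\<integral>z. g (cnj z) * deriv h z \<partial>disk_measure \<alpha>)"
proof -
  have "(\<lambda>z. z * (z * deriv g z + of_real \<alpha> * g z)) holomorphic_on ball 0 R"
    using assms(3) by (intro holomorphic_intros open_ball)
  from pairing_commute[OF assms(1,2) this assms(4)] show ?thesis
    unfolding pairing_deriv[OF assms(1,2,4,3), symmetric]
      pairing_commute[OF assms(1,2,3) holomorphic_deriv[OF assms(4) open_ball]] .
qed

text \<open>The squared binomial coefficients grow like n^(2b - 2) and the moments decay like n^(1 -
  \<alpha>), so the terms behave like n^(2b - 1 - \<alpha>). Raabe's test sees this from the ratio
  of consecutive terms alone: its limit 1 + \<alpha> - 2b exceeds 1 exactly when 2b <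
  \<alpha>.\<close>

lemma summable_gbinomial_square_moment:
  assumes \<alpha>: "\<alpha> > 1" and b: "0 < b" "2 * b < \<alpha>"
  shows "summable (\<lambda>n. ((-b) gchoose n)\<^sup>2 * moment \<alpha> n)"
proof (rule raabes_test_convergence)
  have nz: "(-b) gchoose n \<noteq> 0" for n
    using b by (auto simp: gbinomial_prod_rev)
  have pos: "((-b) gchoose n)\<^sup>2 * moment \<alpha> n > 0" for n
    using nz moment_pos[OF \<alpha>] by simp
  then show "\<forall>\<^sub>F n in sequentially. 0 < ((-b) gchoose n)\<^sup>2 * moment \<alpha> n"
    by simp
  have ratio: "((-b) gchoose n)\<^sup>2 * moment \<alpha> n / (((-b) gchoose Suc n)\<^sup>2 * moment \<alpha> (Suc n))
     = (real n + 1) * (real n + \<alpha>) / (real n + b)\<^sup>2" for n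
  proof -
    have 1: "(real n + 1) * ((-b) gchoose Suc n) = - ((real n + b) * ((-b) gchoose n))"
      using gbinomial_mult_1[of "-b" n] by (simp add: algebra_simps)
    have 2: "(real n + \<alpha>) * moment \<alpha> (Suc n) = (real n + 1) * moment \<alpha> n"
      by (rule moment_Suc[OF \<alpha>])
    have "((real n + 1) * ((-b) gchoose Suc n))\<^sup>2 = ((real n + b) * ((-b) gchoose n))\<^sup>2"
      unfolding 1 by simp
    then have "((-b) gchoose n)\<^sup>2 * moment \<alpha> n * (real n + b)\<^sup>2 * (real n + 1) =
       (real n + 1) * (real n + \<alpha>) * (((-b) gchoose Suc n)\<^sup>2 * moment \<alpha> (Suc n)) * (real n + 1)"
      using 2 by algebra
    then have "((-b) gchoose n)\<^sup>2 * moment \<alpha> n * (real n + b)\<^sup>2 =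
       (real n + 1) * (real n + \<alpha>) * (((-b) gchoose Suc n)\<^sup>2 * moment \<alpha> (Suc n))"
      by (simp add: mult_cancel_right)
    then show ?thesis
      using pos[of "Suc n"] b by (subst frac_eq_eq) auto
  qed
  have "(\<lambda>n. real n * ((real n + 1) * (real n + \<alpha>) / (real n + b)\<^sup>2 - 1)) \<longlonglongrightarrow> 1 + \<alpha> - 2 * b"
    by real_asymp
  then have "(\<lambda>n. ereal (real n * ((real n + 1) * (real n + \<alpha>) / (real n + b)\<^sup>2 - 1))) \<longlonglongrightarrow> ereal (1 + \<alpha> - 2 * b)"
    by simp
  then have "liminf (\<lambda>n. ereal (real n * ((real n + 1) * (real n + \<alpha>) / (real n + b)\<^sup>2 - 1))) = ereal (1 + \<alpha> - 2 * b)"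
    by (intro lim_imp_Liminf) auto
  then show "1 < liminf (\<lambda>n. ereal (real n * (((-b) gchoose n)\<^sup>2 * moment \<alpha> n / (((-b) gchoose Suc n)\<^sup>2 * moment \<alpha> (Suc n)) - 1)))"
    unfolding ratio using b by simp
qed

text \<open>The following integral estimates go back to Forelli and Rudin; the bound comes from Parseval's
  identity for the function \<open>(1 - a z) powr (- \<beta> / 2)\<close>.\<close>

lemma forelli_rudin_inside:
  assumes \<alpha>: "\<alpha> > 1" and \<beta>: "0 < \<beta>" "\<beta> < \<alpha>" and a: "cmod a < 1"
  shows "(\<integral>\<^sup>+z. ennreal (cmod (1 - a * z) powr (-\<beta>)) \<partial>disk_measure \<alpha>) \<le>
    ennreal (\<Sum>n. ((-\<beta>/2) gchoose n)\<^sup>2 * moment \<alpha> n)"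
proof -
  \<comment> \<open>The binomial series converges up to the radius \<open>1 / cmod a\<close>; for
    \<open>a = 0\<close> any radius above 1 will do.\<close>
  define R where "R = (if a = 0 then 2 else 1 / cmod a)"
  have R: "R > 1" using a by (simp add: R_def)
  have az: "cmod (a * z) < 1" if "z \<in> ball 0 R" for z
    using that by (auto simp: R_def norm_mult field_simps split: if_splits)
  define q where "q n = (-\<beta>/2) gchoose n" for n
  define g where "g z = (1 - a * z) powr of_real (-\<beta>/2)" for z
  \<comment> \<open>\<open>g'\<close> has the conjugate coefficients of \<open>g\<close>. Hence
    \<open>g' (cnj z)\<close> is the conjugate of \<open>g z\<close>, and the bilinear pairing of
    the two integrates the squared modulus of \<open>g\<close>.\<close>
  define g' where "g' z = (1 - cnj a * z) powr of_real (-\<beta>/2)" for z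
  have q: "of_real (-\<beta>/2) gchoose n = complex_of_real (q n)" for n
    by (simp add: gbinomial_prod_rev q_def)
  have g: "(\<lambda>n. of_real (q n) * (-a) ^ n * z ^ n) sums g z" if "z \<in> ball 0 R" for z
    using gen_binomial_complex[of "- (a * z)" "of_real (-\<beta>/2)"] az[OF that] unfolding q
    by (simp add: g_def power_mult_distrib[symmetric] mult.assoc)
  have g': "(\<lambda>n. of_real (q n) * (-cnj a) ^ n * z ^ n) sums g' z" if "z \<in> ball 0 R" for z
    using gen_binomial_complex[of "- (cnj a * z)" "of_real (-\<beta>/2)"] az[of "z"] that unfolding q
    by (simp add: g'_def power_mult_distrib[symmetric] mult.assoc norm_mult)
  have gg: "g' (cnj z) * g z = of_real (cmod (1 - a * z) powr (-\<beta>))" if "z \<in> disk" for z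
  proof -
    have lt: "cmod (a * z) < 1" using az[of z] that R by simp
    have "Re (a * z) < 1" using lt abs_Re_le_cmod[of "a * z"] by linarith
    then have "g' (cnj z) = cnj (g z)"
      unfolding g_def g'_def by (subst cnj_powr) auto
    then have "g' (cnj z) * g z = of_real ((cmod (g z))\<^sup>2)"
      by (simp only: complex_norm_square mult.commute)
    also have "cmod (g z) = cmod (1 - a * z) powr (-\<beta>/2)"
      unfolding g_def by (subst norm_powr_real_powr') auto
    also have "\<dots>\<^sup>2 = cmod (1 - a * z) powr (-\<beta>)"
      by (simp add: power2_eq_square powr_add[symmetric])
    finally show ?thesis .
  qed
  have "(\<lambda>n. of_real (q n) * (-cnj a) ^ n * (of_real (q n) * (-a) ^ n) * of_real (moment \<alpha> n)) sums
    (\<integral>z. g' (cnj z) * g z \<partial>disk_measure \<alpha>)"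
    by (rule pairing_sums[OF \<alpha> R g' g])
  moreover have "of_real (q n) * (-cnj a) ^ n * (of_real (q n) * (-a) ^ n) * of_real (moment \<alpha> n)
     = complex_of_real ((q n)\<^sup>2 * moment \<alpha> n * (cmod a)\<^sup>2 ^ n)" for n
  proof -
    have pn: "(-cnj a) ^ n * (-a) ^ n = complex_of_real ((cmod a)\<^sup>2) ^ n"
      unfolding complex_norm_square power_mult_distrib[symmetric] by (simp add: mult.commute)
    show ?thesis unfolding of_real_mult of_real_power[of "(cmod a)\<^sup>2" n] power2_eq_square[of "q n"]
      by (simp only: mult_ac flip: pn)
  qed
  moreover have "(\<integral>z. g' (cnj z) * g z \<partial>disk_measure \<alpha>) =
      of_real (\<integral>z. cmod (1 - a * z) powr (-\<beta>) \<partial>disk_measure \<alpha>)"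
    unfolding integral_complex_of_real[symmetric]
    by (intro Bochner_Integration.integral_cong) (simp_all add: gg)
  ultimately have sums: "(\<lambda>n. (q n)\<^sup>2 * moment \<alpha> n * (cmod a)\<^sup>2 ^ n) sums
      (\<integral>z. cmod (1 - a * z) powr (-\<beta>) \<partial>disk_measure \<alpha>)"
    by (simp only: sums_of_real_iff)
  have summ: "summable (\<lambda>n. (q n)\<^sup>2 * moment \<alpha> n)"
    using summable_gbinomial_square_moment[OF \<alpha>, of "\<beta>/2"] \<beta> by (simp add: q_def)
  have le: "(\<integral>z. cmod (1 - a * z) powr (-\<beta>) \<partial>disk_measure \<alpha>) \<le> (\<Sum>n. (q n)\<^sup>2 * moment \<alpha> n)"
  proof (rule sums_le[OF _ sums summable_sums[OF summ]])
    fix n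
    show "(q n)\<^sup>2 * moment \<alpha> n * (cmod a)\<^sup>2 ^ n \<le> (q n)\<^sup>2 * moment \<alpha> n"
      using a moment_pos[OF \<alpha>, of n]
      by (intro mult_left_le mult_nonneg_nonneg power_le_one) auto
  qed
  interpret finite_measure "disk_measure \<alpha>"
    by (rule finite_measure_disk_measure[OF \<alpha>])
  have "(\<lambda>z. cmod (1 - a * z) powr (-\<beta>)) \<in> borel_measurable (restrict_space borel disk)"
    by (intro measurable_restrict_space1) simp
  moreover have "norm (cmod (1 - a * z) powr (-\<beta>)) \<le> (1 - cmod a) powr (-\<beta>)"
    if "z \<in> disk" for z
  proof -
    have "cmod (a * z) \<le> cmod a"
      using that by (simp add: norm_mult mult_left_le)
    moreover have "1 - cmod (a * z) \<le> cmod (1 - a * z)"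
      using norm_triangle_ineq2[of 1 "a * z"] by simp
    ultimately show ?thesis
      using a \<beta> by (auto intro!: powr_mono2')
  qed
  ultimately have "integrable (disk_measure \<alpha>) (\<lambda>z. cmod (1 - a * z) powr (-\<beta>))"
    by (intro integrable_const_bound AE_I2) auto
  then have "(\<integral>\<^sup>+z. ennreal (cmod (1 - a * z) powr (-\<beta>)) \<partial>disk_measure \<alpha>) =
     ennreal (\<integral>z. cmod (1 - a * z) powr (-\<beta>) \<partial>disk_measure \<alpha>)"
    by (intro nn_integral_eq_integral) auto
  also have "\<dots> \<le> ennreal (\<Sum>n. (q n)\<^sup>2 * moment \<alpha> n)"
    by (intro ennreal_leI le)
  finally show ?thesis by (simp add: q_def)
qed

lemma forelli_rudin:
  assumes \<alpha>: "\<alpha> > 1" and \<beta>: "0 < \<beta>" "\<beta> < \<alpha>" and a: "cmod a \<le> 1"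
  shows "(\<integral>\<^sup>+z. ennreal (cmod (1 - a * z) powr (-\<beta>)) \<partial>disk_measure \<alpha>) \<le>
    ennreal (\<Sum>n. ((-\<beta>/2) gchoose n)\<^sup>2 * moment \<alpha> n)"
proof -
  \<comment> \<open>The bound for \<open>t k * a\<close> does not depend on \<open>k\<close>.
    Fatou's lemma carries it over to a parameter on the unit circle, where the integrand is
    unbounded on the disk.\<close>
  define t where "t k = complex_of_real (1 - 1 / (real k + 2))" for k
  define u where "u k z = ennreal (cmod (1 - t k * a * z) powr (-\<beta>))" for k z
  have t: "t \<longlonglongrightarrow> 1"
  proof -
    have "(\<lambda>k. 1 - 1 / (real k + 2)) \<longlonglongrightarrow> 1" by real_asymp
    from tendsto_of_real[OF this, where 'a = complex] show ?thesis
      unfolding t_def by (simp only: of_real_1)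
  qed
  have lim: "(\<lambda>k. u k z) \<longlonglongrightarrow> ennreal (cmod (1 - a * z) powr (-\<beta>))" if "z \<in> disk" for z
  proof -
    have "cmod (a * z) < 1"
      using that a mult_left_le_one_le[of "cmod z" "cmod a"] by (auto simp: norm_mult)
    then have "1 - 1 * a * z \<noteq> 0" by auto
    then have "(\<lambda>k. cmod (1 - t k * a * z) powr (-\<beta>)) \<longlonglongrightarrow> cmod (1 - 1 * a * z) powr (-\<beta>)"
      by (intro tendsto_intros t) auto
    then show ?thesis unfolding u_def by (intro tendsto_ennrealI) simp
  qed
  have "(\<integral>\<^sup>+z. ennreal (cmod (1 - a * z) powr (-\<beta>)) \<partial>disk_measure \<alpha>) =
     (\<integral>\<^sup>+z. liminf (\<lambda>k. u k z) \<partial>disk_measure \<alpha>)"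
    using lim_imp_Liminf[OF sequentially_bot lim] by (intro nn_integral_cong) simp
  also have "\<dots> \<le> liminf (\<lambda>k. \<integral>\<^sup>+z. u k z \<partial>disk_measure \<alpha>)"
    unfolding u_def by (intro nn_integral_liminf) (auto intro!: measurable_restrict_space1)
  also have "\<dots> \<le> liminf (\<lambda>k::nat. ennreal (\<Sum>n. ((-\<beta>/2) gchoose n)\<^sup>2 * moment \<alpha> n))"
  proof (intro Liminf_mono always_eventually allI)
    fix k
    have "cmod (t k * a) = (1 - 1 / (real k + 2)) * cmod a"
      unfolding t_def norm_mult norm_of_real by simp
    also have "\<dots> < 1"
    proof -
      have "(1 - 1 / (real k + 2)) * cmod a \<le> (1 - 1 / (real k + 2)) * 1"
        using a by (intro mult_left_mono) auto
      then show ?thesis by (rule le_less_trans) simp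
    qed
    finally show "(\<integral>\<^sup>+z. u k z \<partial>disk_measure \<alpha>) \<le> ennreal (\<Sum>n. ((-\<beta>/2) gchoose n)\<^sup>2 * moment \<alpha> n)"
      unfolding u_def by (rule forelli_rudin_inside[OF \<alpha> \<beta>])
  qed
  finally show ?thesis by (simp add: Liminf_const)
qed

section \<open>Holomorphic functions of two variables\<close>

definition d1 :: "(complex \<Rightarrow> complex \<Rightarrow> complex) \<Rightarrow> complex \<Rightarrow> complex \<Rightarrow> complex" where
  "d1 f z w = deriv (\<lambda>x. f x w) z"

definition d2 :: "(complex \<Rightarrow> complex \<Rightarrow> complex) \<Rightarrow> complex \<Rightarrow> complex \<Rightarrow> complex" where
  "d2 f z w = deriv (\<lambda>y. f z y) w"

lemma holomorphic2_swap:
  "holomorphic2_on f S T \<Longrightarrow> holomorphic2_on (\<lambda>z w. f w z) T S"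
  unfolding holomorphic2_on_def
  using continuous_on_compose2[of "S \<times> T" "\<lambda>(z, w). f z w" "T \<times> S" prod.swap]
  by (auto simp: case_prod_unfold continuous_on_swap product_swap)

lemma holomorphic2_subset:
  "holomorphic2_on f S T \<Longrightarrow> S' \<subseteq> S \<Longrightarrow> T' \<subseteq> T \<Longrightarrow> holomorphic2_on f S' T'"
  unfolding holomorphic2_on_def
  by (meson Sigma_mono continuous_on_subset holomorphic_on_subset subset_eq)

lemma continuous_on_case_prod_compose:
  assumes "continuous_on (S \<times> T) (\<lambda>(z, w). f z w)" "continuous_on A p" "continuous_on A q"
    "\<And>x. x \<in> A \<Longrightarrow> p x \<in> S" "\<And>x. x \<in> A \<Longrightarrow> q x \<in> T"
  shows "continuous_on A (\<lambda>x. f (p x) (q x))"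
  using continuous_on_compose2[of "S \<times> T" "\<lambda>(z, w). f z w" A "\<lambda>x. (p x, q x)"] assms
  by (auto simp: image_subset_iff intro!: continuous_on_Pair)

lemma holomorphic2_continuous_compose:
  assumes "holomorphic2_on f S T" "continuous_on A p" "continuous_on A q"
    "\<And>x. x \<in> A \<Longrightarrow> p x \<in> S" "\<And>x. x \<in> A \<Longrightarrow> q x \<in> T"
  shows "continuous_on A (\<lambda>x. f (p x) (q x))"
  using assms(1) unfolding holomorphic2_on_def
  by (blast intro: continuous_on_case_prod_compose[OF _ assms(2-5)])

lemma holomorphic2_holomorphic_fst:
  "holomorphic2_on f S T \<Longrightarrow> w \<in> T \<Longrightarrow> (\<lambda>z. f z w) holomorphic_on S"
  by (simp add: holomorphic2_on_def)

lemma holomorphic2_holomorphic_snd: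
  "holomorphic2_on f S T \<Longrightarrow> z \<in> S \<Longrightarrow> (\<lambda>w. f z w) holomorphic_on T"
  by (simp add: holomorphic2_on_def)

text \<open>Cauchy's formula is written over the fixed interval [0, 1], in the form to which the
  theorems on continuity and differentiation of parameter integrals apply.\<close>

lemma d1_integral:
  assumes f: "holomorphic2_on f S T" and r: "cball z0 r \<subseteq> S" and z: "z \<in> ball z0 r" and w: "w \<in> T"
  shows "d1 f z w = 1 / (2 * of_real pi * \<i>) * integral (cbox 0 1)
     (\<lambda>t. f (circlepath z0 r t) w / (circlepath z0 r t - z)\<^sup>2 * (2 * pi * \<i> * r * exp (2 * of_real pi * \<i> * t)))"
proof -
  have fw: "(\<lambda>x. f x w) holomorphic_on S"
    by (rule holomorphic2_holomorphic_fst[OF f w])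
  have "continuous_on (cball z0 r) (\<lambda>x. f x w)"
    by (rule continuous_on_subset[OF holomorphic_on_imp_continuous_on[OF fw] r])
  moreover have "(\<lambda>x. f x w) holomorphic_on ball z0 r"
    using r ball_subset_cball by (intro holomorphic_on_subset[OF fw]) blast
  ultimately have "d1 f z w = 1 / (2 * of_real pi * \<i>) *
      contour_integral (circlepath z0 r) (\<lambda>u. f u w / (u - z)\<^sup>2)"
    unfolding d1_def by (intro DERIV_imp_deriv Cauchy_derivative_integral_circlepath z)
  also have "contour_integral (circlepath z0 r) (\<lambda>u. f u w / (u - z)\<^sup>2) = integral {0..1}
     (\<lambda>t. f (circlepath z0 r t) w / (circlepath z0 r t - z)\<^sup>2 * vector_derivative (circlepath z0 r) (at t))"
    by (rule contour_integral_integral)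
  finally show ?thesis
    by (simp add: vector_derivative_circlepath)
qed

lemma circlepath_minus_nonzero:
  assumes "z \<in> ball z0 r"
  shows "circlepath z0 r t - z \<noteq> 0"
proof -
  have "dist z0 (circlepath z0 r t) = \<bar>r\<bar>"
    by (simp add: circlepath dist_norm norm_mult)
  then show ?thesis using assms by auto
qed

lemma continuous_on_circlepath: "continuous_on A (circlepath z0 r)"
  unfolding circlepath by (intro continuous_intros)

lemma continuous_on_d1:
  assumes f: "holomorphic2_on f S T" and "open S" "open T"
  shows "continuous_on (S \<times> T) (\<lambda>(z, w). d1 f z w)"
proof (rule continuous_at_imp_continuous_on, rule ballI)
  fix x assume "x \<in> S \<times> T"
  then obtain z0 w0 where x: "x = (z0, w0)" and z0: "z0 \<in> S" and w0: "w0 \<in> T" by auto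
  obtain r where r: "r > 0" "cball z0 r \<subseteq> S"
    using \<open>open S\<close> z0 open_contains_cball by blast
  let ?g = "\<lambda>x t. f (circlepath z0 r t) (snd x) / (circlepath z0 r t - fst x)\<^sup>2 * (2 * pi * \<i> * r * exp (2 * of_real pi * \<i> * t))"
  have sph: "circlepath z0 r t \<in> cball z0 r" for t
    using r by (simp add: circlepath dist_norm norm_mult)
  have "continuous_on ((ball z0 r \<times> T) \<times> cbox 0 1) (\<lambda>(x, t). ?g x t)"
    unfolding case_prod_unfold
    by (intro continuous_intros holomorphic2_continuous_compose[OF f] continuous_on_compose2[OF continuous_on_circlepath])
       (use sph r circlepath_minus_nonzero in auto)
  then have "continuous_on (ball z0 r \<times> T) (\<lambda>x. integral (cbox 0 1) (?g x))"
    by (rule integral_continuous_on_param)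
  then have "continuous_on (ball z0 r \<times> T) (\<lambda>x. 1 / (2 * of_real pi * \<i>) * integral (cbox 0 1) (?g x))"
    by (intro continuous_intros)
  then have "continuous_on (ball z0 r \<times> T) (\<lambda>(z, w). d1 f z w)"
    by (rule continuous_on_eq) (auto simp: d1_integral[OF f r(2)])
  moreover have "open (ball z0 r \<times> T)" "x \<in> ball z0 r \<times> T"
    using \<open>open T\<close> r w0 by (auto simp: x open_Times)
  ultimately show "isCont (\<lambda>(z, w). d1 f z w) x"
    using continuous_on_eq_continuous_at by blast
qed

lemma continuous_on_d2:
  assumes f: "holomorphic2_on f S T" and "open S" "open T"
  shows "continuous_on (S \<times> T) (\<lambda>(z, w). d2 f z w)"
proof -
  have "continuous_on (T \<times> S) (\<lambda>(z, w). d1 (\<lambda>z w. f w z) z w)"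
    by (rule continuous_on_d1[OF holomorphic2_swap[OF f] assms(3,2)])
  from continuous_on_compose2[OF this continuous_on_swap[of "S \<times> T"]]
  have "continuous_on (S \<times> T) (\<lambda>x. case prod.swap x of (z, w) \<Rightarrow> d1 (\<lambda>z w. f w z) z w)"
    by (simp only: product_swap order_refl)
  then show ?thesis
    by (rule continuous_on_eq) (simp add: d1_def d2_def case_prod_unfold)
qed

text \<open>Holomorphy in \<open>w\<close> is the delicate part. The Cauchy integral in the first
  variable is differentiated in \<open>w\<close> by Leibniz' rule, and the joint continuity this
  requires is that of \<open>d2 f\<close>, already known from the same Cauchy integral with the
  variables exchanged.\<close>

lemma holomorphic2_d1:
  assumes f: "holomorphic2_on f S T" and S: "open S" and T: "open T"
  shows "holomorphic2_on (d1 f) S T"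
  unfolding holomorphic2_on_def
proof (intro conjI ballI)
  show "continuous_on (S \<times> T) (\<lambda>(z, w). d1 f z w)"
    by (rule continuous_on_d1[OF assms])
  show "(\<lambda>z. d1 f z w) holomorphic_on S" if "w \<in> T" for w
    unfolding d1_def by (intro holomorphic_deriv holomorphic2_holomorphic_fst[OF f that] S)
  show "(\<lambda>w. d1 f z0 w) holomorphic_on T" if z0: "z0 \<in> S" for z0
  proof -
    obtain r where r: "r > 0" "cball z0 r \<subseteq> S"
      using S z0 open_contains_cball by blast
    have sph: "circlepath z0 r t \<in> S" for t
      using r by (auto simp: circlepath dist_norm norm_mult)
    have z0r: "z0 \<in> ball z0 r" using r by simp
    let ?k = "\<lambda>t. 2 * pi * \<i> * r * exp (2 * of_real pi * \<i> * complex_of_real t)"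
    let ?g = "\<lambda>w t. f (circlepath z0 r t) w / (circlepath z0 r t - z0)\<^sup>2 * ?k t"
    let ?g' = "\<lambda>w t. d2 f (circlepath z0 r t) w / (circlepath z0 r t - z0)\<^sup>2 * ?k t"
    have d1: "d1 f z0 w = 1 / (2 * of_real pi * \<i>) * integral (cbox 0 1) (?g w)" if "w \<in> T" for w
      by (rule d1_integral[OF f r(2) z0r that])
    have "(\<lambda>w. d1 f z0 w) field_differentiable (at w0)" if w0: "w0 \<in> T" for w0
    proof -
      obtain \<rho> where \<rho>: "\<rho> > 0" "ball w0 \<rho> \<subseteq> T"
        using T w0 open_contains_ball by blast
      have "(\<lambda>w. integral (cbox 0 1) (?g w)) holomorphic_on ball w0 \<rho>"
      proof (rule leibniz_rule_holomorphic)
        fix w t assume w: "w \<in> ball w0 \<rho>"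
        have "(\<lambda>w. f (circlepath z0 r t) w) field_differentiable (at w)"
          using holomorphic2_holomorphic_snd[OF f sph] T w \<rho>(2)
          by (intro holomorphic_on_imp_differentiable_at) auto
        then have "((\<lambda>w. f (circlepath z0 r t) w) has_field_derivative d2 f (circlepath z0 r t) w) (at w)"
          unfolding d2_def by (simp add: field_differentiable_derivI)
        then have "((\<lambda>w. f (circlepath z0 r t) w) has_field_derivative d2 f (circlepath z0 r t) w) (at w within ball w0 \<rho>)"
          by (rule has_field_derivative_at_within)
        then show "((\<lambda>w. ?g w t) has_field_derivative ?g' w t) (at w within ball w0 \<rho>)"
          by (intro DERIV_cmult_right DERIV_cdivide)
      next
        fix w assume "w \<in> ball w0 \<rho>"
        then show "?g w integrable_on cbox 0 1"
          using sph r \<rho> circlepath_minus_nonzero[OF z0r]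
          by (intro integrable_continuous continuous_intros holomorphic2_continuous_compose[OF f]
            continuous_on_circlepath) auto
      next
        have d2: "continuous_on (S \<times> T) (\<lambda>(z, w). d2 f z w)"
          by (rule continuous_on_d2[OF assms])
        have "continuous_on (ball w0 \<rho> \<times> cbox 0 1) (\<lambda>x. d2 f (circlepath z0 r (snd x)) (fst x))"
          by (rule continuous_on_case_prod_compose[OF d2])
            (use sph \<rho> in \<open>auto intro!: continuous_intros continuous_on_compose2[OF continuous_on_circlepath]\<close>)
        then show "continuous_on (ball w0 \<rho> \<times> cbox 0 1) (\<lambda>(w, t). ?g' w t)"
          unfolding case_prod_unfold
          by (intro continuous_intros continuous_on_compose2[OF continuous_on_circlepath])
            (use circlepath_minus_nonzero[OF z0r] in auto)
      qed simp
      then have "(\<lambda>w. 1 / (2 * of_real pi * \<i>) * integral (cbox 0 1) (?g w)) holomorphic_on ball w0 \<rho>"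
        by (intro holomorphic_intros)
      then have "(\<lambda>w. d1 f z0 w) holomorphic_on ball w0 \<rho>"
        by (rule holomorphic_transform) (use d1 \<rho> in auto)
      then show ?thesis
        using \<rho>(1) by (intro holomorphic_on_imp_differentiable_at[of _ "ball w0 \<rho>"]) auto
    qed
    then show ?thesis
      unfolding holomorphic_on_def using field_differentiable_at_within by blast
  qed
qed

lemma holomorphic2_d2:
  assumes "holomorphic2_on f S T" "open S" "open T"
  shows "holomorphic2_on (d2 f) S T"
proof -
  have "d2 f = (\<lambda>z w. d1 (\<lambda>z w. f w z) w z)"
    by (intro HOL.ext) (simp add: d1_def d2_def)
  then show ?thesis
    using holomorphic2_swap[OF holomorphic2_d1[OF holomorphic2_swap[OF assms(1)] assms(3,2)]] by simp
qed

section \<open>Closure properties of holomorphy in two variables\<close>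

lemma holomorphic2_mult:
  "holomorphic2_on f S T \<Longrightarrow> holomorphic2_on g S T \<Longrightarrow> holomorphic2_on (\<lambda>z w. f z w * g z w) S T"
  unfolding holomorphic2_on_def case_prod_unfold by (auto intro!: continuous_intros holomorphic_intros)

lemma holomorphic2_add:
  "holomorphic2_on f S T \<Longrightarrow> holomorphic2_on g S T \<Longrightarrow> holomorphic2_on (\<lambda>z w. f z w + g z w) S T"
  unfolding holomorphic2_on_def case_prod_unfold by (auto intro!: continuous_intros holomorphic_intros)

lemma holomorphic2_const: "holomorphic2_on (\<lambda>z w. c) S T"
  unfolding holomorphic2_on_def case_prod_unfold by (auto intro!: continuous_intros holomorphic_intros)

lemma holomorphic2_fst: "holomorphic2_on (\<lambda>z w. z) S T"
  unfolding holomorphic2_on_def case_prod_unfold by (auto intro!: continuous_intros holomorphic_intros)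

lemma holomorphic2_snd: "holomorphic2_on (\<lambda>z w. w) S T"
  unfolding holomorphic2_on_def case_prod_unfold by (auto intro!: continuous_intros holomorphic_intros)

lemmas holomorphic2_intros = holomorphic2_mult holomorphic2_add holomorphic2_const holomorphic2_fst
  holomorphic2_snd holomorphic2_d1[OF _ open_ball open_ball] holomorphic2_d2[OF _ open_ball open_ball]

lemma holomorphic2_dilate:
  assumes "holomorphic2_on f S T" "\<And>z. z \<in> S' \<Longrightarrow> a * z \<in> S" "\<And>w. w \<in> T' \<Longrightarrow> b * w \<in> T"
  shows "holomorphic2_on (\<lambda>z w. f (a * z) (b * w)) S' T'"
  unfolding holomorphic2_on_def case_prod_unfold
  using assms(2,3) by (auto intro!: holomorphic2_continuous_compose[OF assms(1)] continuous_intros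
    holomorphic_on_compose_gen[of "\<lambda>z. a * z" _ _ S, unfolded o_def]
    holomorphic_on_compose_gen[of "\<lambda>z. b * z" _ _ T, unfolded o_def]
    holomorphic_intros holomorphic2_holomorphic_fst[OF assms(1)] holomorphic2_holomorphic_snd[OF assms(1)])

lemma mult_mem_ball:
  fixes z :: complex
  assumes "cmod a \<le> 1" "z \<in> ball 0 R"
  shows "a * z \<in> ball 0 R"
  using assms mult_left_le_one_le[of "cmod z" "cmod a"] by (auto simp: norm_mult)

section \<open>The pairing of holomorphic functions of two variables\<close>

definition bidisk_measure :: "real \<Rightarrow> (complex \<times> complex) measure" where
  "bidisk_measure \<alpha> = disk_measure \<alpha> \<Otimes>\<^sub>M disk_measure \<alpha>"

text \<open>The identity map is measurable in both directions, and each direction gives one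
  inclusion of the sigma-algebras.\<close>

lemma sets_pair_restrict_space:
  assumes "A \<in> sets M" "B \<in> sets N"
  shows "sets (restrict_space M A \<Otimes>\<^sub>M restrict_space N B) = sets (restrict_space (M \<Otimes>\<^sub>M N) (A \<times> B))"
proof -
  let ?L = "restrict_space M A \<Otimes>\<^sub>M restrict_space N B" and ?R = "restrict_space (M \<Otimes>\<^sub>M N) (A \<times> B)"
  have AB: "A \<subseteq> space M" "B \<subseteq> space N"
    using assms by (auto dest: sets.sets_into_space)
  then have space: "space ?L = A \<times> B" "space ?R = A \<times> B"
    by (auto simp: space_pair_measure space_restrict_space)
  have "(\<lambda>x. (fst x, snd x)) \<in> measurable ?R ?L"
    using space by (intro measurable_Pair measurable_restrict_space2 measurable_restrict_space1) auto
  then have 1: "(\<lambda>x. x) \<in> measurable ?R ?L" by simp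
  have "(\<lambda>x. (fst x, snd x)) \<in> measurable ?L ?R"
  proof (rule measurable_restrict_space2)
    have "fst \<in> measurable ?L M" "snd \<in> measurable ?L N"
      using measurable_compose[OF measurable_fst[of "restrict_space M A" "restrict_space N B"] measurable_restrict_space1[OF measurable_ident]]
       measurable_compose[OF measurable_snd[of "restrict_space M A" "restrict_space N B"] measurable_restrict_space1[OF measurable_ident]]
      by (simp_all add: id_def)
    then show "(\<lambda>x. (fst x, snd x)) \<in> measurable ?L (M \<Otimes>\<^sub>M N)"
      by (intro measurable_Pair)
  qed (use space in auto)
  then have 2: "(\<lambda>x. x) \<in> measurable ?L ?R" by simp
  show ?thesis
  proof
    show "sets ?L \<subseteq> sets ?R"
    proof
      fix X assume X: "X \<in> sets ?L"
      then have "X \<subseteq> A \<times> B" using sets.sets_into_space space(1) by blast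
      with measurable_sets[OF 1 X] show "X \<in> sets ?R"
        by (simp add: space Int_absorb2 vimage_def)
    qed
    show "sets ?R \<subseteq> sets ?L"
    proof
      fix X assume X: "X \<in> sets ?R"
      then have "X \<subseteq> A \<times> B" using sets.sets_into_space space(2) by blast
      with measurable_sets[OF 2 X] show "X \<in> sets ?L"
        by (simp add: space Int_absorb2 vimage_def)
    qed
  qed
qed

lemma space_bidisk_measure [simp]: "space (bidisk_measure \<alpha>) = disk \<times> disk"
  by (simp add: bidisk_measure_def space_pair_measure)

lemma sets_bidisk_measure: "sets (bidisk_measure \<alpha>) = sets (restrict_space borel (disk \<times> disk))"
proof -
  have "sets (bidisk_measure \<alpha>) = sets (restrict_space borel disk \<Otimes>\<^sub>M restrict_space borel (disk :: complex set))"
    unfolding bidisk_measure_def by (intro sets_pair_measure_cong sets_disk_measure)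
  also have "\<dots> = sets (restrict_space (borel \<Otimes>\<^sub>M borel) (disk \<times> disk))"
    by (rule sets_pair_restrict_space) auto
  finally show ?thesis by (simp add: borel_prod)
qed

lemma measurable_bidisk_measure [simp]:
  "measurable (bidisk_measure \<alpha>) N = measurable (restrict_space borel (disk \<times> disk)) N"
  by (intro measurable_cong_sets; simp add: sets_bidisk_measure)

lemma bidisk_measure_density:
  assumes "\<alpha> > 1"
  shows "bidisk_measure \<alpha> = density (restrict_space lborel (disk \<times> disk)) (\<lambda>(z, u). ennreal (weight \<alpha> z * weight \<alpha> u))"
proof -
  have sf: "sigma_finite_measure (restrict_space lborel (disk :: complex set))"
    by (rule sigma_finite_measure_restrict_space) (auto simp: lborel.sigma_finite_measure_axioms)
  interpret finite_measure "disk_measure \<alpha>"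
    by (rule finite_measure_disk_measure[OF assms])
  have "restrict_space lborel disk \<Otimes>\<^sub>M restrict_space lborel disk = restrict_space lborel (disk \<times> disk :: (complex \<times> complex) set)"
  proof (rule pair_measure_eqI[OF sf sf])
    have "sets (restrict_space lborel disk \<Otimes>\<^sub>M restrict_space lborel (disk :: complex set)) =
       sets (restrict_space (lborel \<Otimes>\<^sub>M lborel) (disk \<times> disk :: (complex \<times> complex) set))"
      by (rule sets_pair_restrict_space) auto
    then show "sets (restrict_space lborel disk \<Otimes>\<^sub>M restrict_space lborel (disk :: complex set)) =
       sets (restrict_space lborel (disk \<times> disk :: (complex \<times> complex) set))"
      by (simp only: lborel_prod)
    fix A B :: "complex set"
    assume A: "A \<in> sets (restrict_space lborel disk)" and B: "B \<in> sets (restrict_space lborel disk)"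
    then have A': "A \<in> sets lborel" "A \<subseteq> disk" and B': "B \<in> sets lborel" "B \<subseteq> disk"
      by (auto simp: sets_restrict_space)
    have "emeasure (lborel \<Otimes>\<^sub>M lborel) (A \<times> B) = emeasure lborel A * emeasure lborel B"
      by (rule lborel.emeasure_pair_measure_Times[OF A'(1) B'(1)])
    then show "emeasure (restrict_space lborel disk) A * emeasure (restrict_space lborel disk) B =
        emeasure (restrict_space lborel (disk \<times> disk)) (A \<times> B)"
      using A' B' by (simp add: emeasure_restrict_space lborel_prod open_Times Sigma_mono)
  qed
  moreover have "bidisk_measure \<alpha> = density (restrict_space lborel disk \<Otimes>\<^sub>M restrict_space lborel disk)
       (\<lambda>(z, u). ennreal (weight \<alpha> z) * ennreal (weight \<alpha> u))"
    unfolding bidisk_measure_def disk_measure_def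
    by (rule pair_measure_density) 
      (use sf sigma_finite_measure_axioms in \<open>auto simp: disk_measure_def\<close>)
  ultimately show ?thesis
    by (simp add: ennreal_mult')
qed

text \<open>This links the weighted set integral that defines \<open>J\<close> to a product measure,
  for which Fubini's theorem is available.\<close>

lemma set_integral_bidisk:
  fixes F :: "complex \<Rightarrow> complex \<Rightarrow> complex"
  assumes "\<alpha> > 1" "(\<lambda>(z, u). F z u) \<in> borel_measurable (restrict_space borel (disk \<times> disk))"
  shows "set_lebesgue_integral lborel (disk \<times> disk) (\<lambda>(z, u). F z u * of_real (weight \<alpha> z) * of_real (weight \<alpha> u))
     = (\<integral>(z, u). F z u \<partial>bidisk_measure \<alpha>)"
proof -
  let ?R = "restrict_space lborel (disk \<times> disk) :: (complex \<times> complex) measure"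
  have sets: "measurable ?R N = measurable (restrict_space borel (disk \<times> disk)) N" for N :: "'b measure"
    by (rule measurable_cong_sets) (simp_all add: sets_restrict_space)
  have "(\<lambda>x::complex \<times> complex. weight \<alpha> (fst x) * weight \<alpha> (snd x)) \<in> borel_measurable (borel \<Otimes>\<^sub>M borel)"
    by measurable
  then have w: "(\<lambda>(z, u). weight \<alpha> z * weight \<alpha> u) \<in> borel_measurable ?R"
    unfolding sets case_prod_unfold by (intro measurable_restrict_space1) (simp only: borel_prod)
  have "(\<integral>(z, u). F z u \<partial>bidisk_measure \<alpha>) = (\<integral>x. (case x of (z, u) \<Rightarrow> weight \<alpha> z * weight \<alpha> u) *\<^sub>R (case x of (z, u) \<Rightarrow> F z u) \<partial>?R)"
  proof -
    have "bidisk_measure \<alpha> = density ?R (\<lambda>x. ennreal (case x of (z, u) \<Rightarrow> weight \<alpha> z * weight \<alpha> u))"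
      unfolding bidisk_measure_density[OF assms(1)] by (simp add: case_prod_unfold)
    then show ?thesis
      using w assms(2) by (simp only:) (intro integral_density; simp add: sets case_prod_unfold)
  qed
  also have "\<dots> = (\<integral>x. (case x of (z, u) \<Rightarrow> F z u * of_real (weight \<alpha> z) * of_real (weight \<alpha> u)) \<partial>?R)"
    by (simp add: case_prod_unfold scaleR_conv_of_real mult_ac)
  also have "\<dots> = set_lebesgue_integral lborel (disk \<times> disk) (\<lambda>(z, u). F z u * of_real (weight \<alpha> z) * of_real (weight \<alpha> u))"
    unfolding set_lebesgue_integral_def by (subst integral_restrict_space) (auto simp: open_Times)
  finally show ?thesis by simp
qed

lemma finite_measure_bidisk_measure: "\<alpha> > 1 \<Longrightarrow> finite_measure (bidisk_measure \<alpha>)"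
  unfolding bidisk_measure_def by (intro finite_measure_pair_measure finite_measure_disk_measure)

lemma pair_sigma_finite_disk_measure:
  assumes "\<alpha> > 1"
  shows "pair_sigma_finite (disk_measure \<alpha>) (disk_measure \<alpha>)"
proof -
  interpret finite_measure "disk_measure \<alpha>"
    by (rule finite_measure_disk_measure[OF assms])
  show ?thesis ..
qed

definition pairing2 :: "real \<Rightarrow> (complex \<Rightarrow> complex \<Rightarrow> complex) \<Rightarrow> (complex \<Rightarrow> complex \<Rightarrow> complex) \<Rightarrow> complex" where
  "pairing2 \<alpha> k h = (\<integral>(z, u). k (cnj z) u * h z (cnj u) \<partial>bidisk_measure \<alpha>)"

lemma holomorphic2_bounded:
  assumes "R > 1" "holomorphic2_on f (ball 0 R) (ball 0 R)"
  obtains B where "B \<ge> 0" "\<And>z w. z \<in> cball 0 1 \<Longrightarrow> w \<in> cball 0 1 \<Longrightarrow> cmod (f z w) \<le> B"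
proof -
  have "continuous_on (cball 0 1 \<times> cball 0 1) (\<lambda>x. f (fst x) (snd x))"
    using assms(1) by (intro holomorphic2_continuous_compose[OF assms(2)] continuous_intros) auto
  then have "compact ((\<lambda>x. f (fst x) (snd x)) ` (cball 0 1 \<times> cball 0 1))"
    by (intro compact_continuous_image compact_Times compact_cball)
  then obtain B where B: "\<forall>y\<in>(\<lambda>x. f (fst x) (snd x)) ` (cball 0 1 \<times> cball 0 1). norm y \<le> B"
    using compact_imp_bounded bounded_iff by blast
  show ?thesis
  proof (rule that[of "max B 0"])
    fix z w :: complex assume "z \<in> cball 0 1" "w \<in> cball 0 1"
    then have "(z, w) \<in> cball 0 1 \<times> cball 0 1" by blast
    from bspec[OF B imageI[OF this]] show "cmod (f z w) \<le> max B 0" by simp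
  qed simp
qed

lemma continuous_on_pairing2:
  assumes "holomorphic2_on k disk disk" "holomorphic2_on h disk disk"
  shows "continuous_on (disk \<times> disk) (\<lambda>(z, u). k (cnj z) u * h z (cnj u))"
  unfolding case_prod_unfold
  by (intro continuous_intros holomorphic2_continuous_compose[OF assms(1)] holomorphic2_continuous_compose[OF assms(2)]) auto

lemma integrable_pairing2:
  assumes "\<alpha> > 1" "R > 1" and k: "holomorphic2_on k (ball 0 R) (ball 0 R)" and h: "holomorphic2_on h (ball 0 R) (ball 0 R)"
  shows "integrable (bidisk_measure \<alpha>) (\<lambda>(z, u). k (cnj z) u * h z (cnj u))"
proof -
  interpret finite_measure "bidisk_measure \<alpha>"
    by (rule finite_measure_bidisk_measure[OF assms(1)])
  obtain B where B: "B \<ge> 0" "\<And>z w. z \<in> cball 0 1 \<Longrightarrow> w \<in> cball 0 1 \<Longrightarrow> cmod (k z w) \<le> B"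
    using holomorphic2_bounded[OF assms(2) k] by blast
  obtain C where C: "C \<ge> 0" "\<And>z w. z \<in> cball 0 1 \<Longrightarrow> w \<in> cball 0 1 \<Longrightarrow> cmod (h z w) \<le> C"
    using holomorphic2_bounded[OF assms(2) h] by blast
  have sub: "disk \<subseteq> ball 0 R" using assms(2) by auto
  show ?thesis
  proof (rule integrable_const_bound[where B = "B * C"])
    show "(\<lambda>(z, u). k (cnj z) u * h z (cnj u)) \<in> borel_measurable (bidisk_measure \<alpha>)"
      using continuous_on_pairing2[OF holomorphic2_subset[OF k sub sub] holomorphic2_subset[OF h sub sub]]
      by (simp add: borel_measurable_continuous_on_restrict)
    show "AE x in bidisk_measure \<alpha>. cmod (case x of (z, u) \<Rightarrow> k (cnj z) u * h z (cnj u)) \<le> B * C"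
      by (rule AE_I2) (auto simp: norm_mult B C intro!: mult_mono)
  qed
qed

text \<open>By Fubini's theorem, an identity between one-variable pairings for each fixed
  \<open>u\<close> integrates to an identity on the bidisk. All adjoint relations in the first
  variable are obtained in this way.\<close>

lemma pairing2_cong_fst:
  assumes "\<alpha> > 1" "R > 1"
    and "holomorphic2_on k (ball 0 R) (ball 0 R)" "holomorphic2_on h (ball 0 R) (ball 0 R)"
    and "holomorphic2_on k' (ball 0 R) (ball 0 R)" "holomorphic2_on h' (ball 0 R) (ball 0 R)"
    and eq: "\<And>u. u \<in> disk \<Longrightarrow> (\<integral>z. k (cnj z) u * h z (cnj u) \<partial>disk_measure \<alpha>) =
        (\<integral>z. k' (cnj z) u * h' z (cnj u) \<partial>disk_measure \<alpha>)"
  shows "pairing2 \<alpha> k h = pairing2 \<alpha> k' h'"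
proof -
  interpret pair_sigma_finite "disk_measure \<alpha>" "disk_measure \<alpha>"
    by (rule pair_sigma_finite_disk_measure[OF assms(1)])
  have *: "pairing2 \<alpha> k h = (\<integral>u. (\<integral>z. k (cnj z) u * h z (cnj u) \<partial>disk_measure \<alpha>) \<partial>disk_measure \<alpha>)"
    if "holomorphic2_on k (ball 0 R) (ball 0 R)" "holomorphic2_on h (ball 0 R) (ball 0 R)" for k h
    using integral_snd[OF integrable_pairing2[OF assms(1,2) that, unfolded bidisk_measure_def]]
    by (simp add: pairing2_def bidisk_measure_def)
  show ?thesis
    unfolding *[OF assms(3,4)] *[OF assms(5,6)]
    by (rule Bochner_Integration.integral_cong[OF refl]) (simp add: eq)
qed

text \<open>In \<open>u\<close> it is \<open>h\<close> that is evaluated at the conjugate point, so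
  the factors are written in the opposite order to match the one-variable pairing.\<close>

lemma pairing2_cong_snd:
  assumes "\<alpha> > 1" "R > 1"
    and "holomorphic2_on k (ball 0 R) (ball 0 R)" "holomorphic2_on h (ball 0 R) (ball 0 R)"
    and "holomorphic2_on k' (ball 0 R) (ball 0 R)" "holomorphic2_on h' (ball 0 R) (ball 0 R)"
    and eq: "\<And>z. z \<in> disk \<Longrightarrow> (\<integral>u. h z (cnj u) * k (cnj z) u \<partial>disk_measure \<alpha>) =
        (\<integral>u. h' z (cnj u) * k' (cnj z) u \<partial>disk_measure \<alpha>)"
  shows "pairing2 \<alpha> k h = pairing2 \<alpha> k' h'"
proof -
  interpret pair_sigma_finite "disk_measure \<alpha>" "disk_measure \<alpha>"
    by (rule pair_sigma_finite_disk_measure[OF assms(1)])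
  have *: "pairing2 \<alpha> k h = (\<integral>z. (\<integral>u. h z (cnj u) * k (cnj z) u \<partial>disk_measure \<alpha>) \<partial>disk_measure \<alpha>)"
    if "holomorphic2_on k (ball 0 R) (ball 0 R)" "holomorphic2_on h (ball 0 R) (ball 0 R)" for k h
    using integral_fst[OF integrable_pairing2[OF assms(1,2) that, unfolded bidisk_measure_def]]
    by (simp add: pairing2_def bidisk_measure_def mult.commute)
  show ?thesis
    unfolding *[OF assms(3,4)] *[OF assms(5,6)]
    by (rule Bochner_Integration.integral_cong[OF refl]) (simp add: eq)
qed

section \<open>Adjoint operators and dilations on the bidisk\<close>

context
  fixes \<alpha> R :: real and k h :: "complex \<Rightarrow> complex \<Rightarrow> complex"
  assumes \<alpha>: "\<alpha> > 1" and R: "R > 1"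
    and k: "holomorphic2_on k (ball 0 R) (ball 0 R)" and h: "holomorphic2_on h (ball 0 R) (ball 0 R)"
begin

lemma holomorphic_sections:
  assumes "u \<in> disk"
  shows "(\<lambda>x. k x u) holomorphic_on ball 0 R" "(\<lambda>x. h x (cnj u)) holomorphic_on ball 0 R"
    "k (cnj u) holomorphic_on ball 0 R" "h u holomorphic_on ball 0 R"
  using assms R holomorphic2_holomorphic_fst[OF k, of u] holomorphic2_holomorphic_fst[OF h, of "cnj u"]
    holomorphic2_holomorphic_snd[OF k, of "cnj u"] holomorphic2_holomorphic_snd[OF h, of u]
  by auto

lemma pairing2_euler_fst:
  "pairing2 \<alpha> (\<lambda>z w. z * d1 k z w) h = pairing2 \<alpha> k (\<lambda>z w. z * d1 h z w)"
  by (rule pairing2_cong_fst[OF \<alpha> R _ h k];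
      (intro holomorphic2_intros k h)?)
     (use pairing_euler[OF \<alpha> R holomorphic_sections(1,2)] in \<open>simp add: d1_def\<close>)

lemma pairing2_deriv_fst:
  "pairing2 \<alpha> (d1 k) h = pairing2 \<alpha> k (\<lambda>z w. z * (z * d1 h z w + of_real \<alpha> * h z w))"
  by (rule pairing2_cong_fst[OF \<alpha> R _ h k];
      (intro holomorphic2_intros k h)?)
     (use pairing_deriv[OF \<alpha> R holomorphic_sections(1,2)] in \<open>simp add: d1_def\<close>)

lemma pairing2_shift_fst:
  "pairing2 \<alpha> (\<lambda>z w. z * (z * d1 k z w + of_real \<alpha> * k z w)) h = pairing2 \<alpha> k (d1 h)"
  by (rule pairing2_cong_fst[OF \<alpha> R _ h k];
      (intro holomorphic2_intros k h)?)
     (use pairing_shift[OF \<alpha> R holomorphic_sections(1,2)] in \<open>simp add: d1_def\<close>)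

lemma pairing2_euler_snd:
  "pairing2 \<alpha> (\<lambda>z w. w * d2 k z w) h = pairing2 \<alpha> k (\<lambda>z w. w * d2 h z w)"
  by (rule pairing2_cong_snd[OF \<alpha> R _ h k];
      (intro holomorphic2_intros k h)?)
     (use pairing_euler[OF \<alpha> R holomorphic_sections(4,3), symmetric] in \<open>simp add: d2_def\<close>)

text \<open>In the second variable the derivative falls on the factor that is not conjugated, so
  \<open>pairing_shift\<close> takes the place that \<open>pairing_deriv\<close> has in the first
  variable.\<close>

lemma pairing2_deriv_snd:
  "pairing2 \<alpha> (d2 k) h = pairing2 \<alpha> k (\<lambda>z w. w * (w * d2 h z w + of_real \<alpha> * h z w))"
  by (rule pairing2_cong_snd[OF \<alpha> R _ h k];
      (intro holomorphic2_intros k h)?)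
     (use pairing_shift[OF \<alpha> R holomorphic_sections(4,3), symmetric] in \<open>simp add: d2_def\<close>)

lemma pairing2_shift_snd:
  "pairing2 \<alpha> (\<lambda>z w. w * (w * d2 k z w + of_real \<alpha> * k z w)) h = pairing2 \<alpha> k (d2 h)"
  by (rule pairing2_cong_snd[OF \<alpha> R _ h k];
      (intro holomorphic2_intros k h)?)
     (use pairing_deriv[OF \<alpha> R holomorphic_sections(4,3), symmetric] in \<open>simp add: d2_def\<close>)

lemma pairing2_dilation_fst:
  assumes r: "cmod r \<le> 1"
  shows "pairing2 \<alpha> (\<lambda>z w. k (r * z) w) h = pairing2 \<alpha> k (\<lambda>z w. h (r * z) w)"
proof (rule pairing2_cong_fst[OF \<alpha> R _ h k])
  show "holomorphic2_on (\<lambda>z w. k (r * z) w) (ball 0 R) (ball 0 R)"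
    using holomorphic2_dilate[OF k, of "ball 0 R" r "ball 0 R" 1] mult_mem_ball[OF r] by simp
  show "holomorphic2_on (\<lambda>z w. h (r * z) w) (ball 0 R) (ball 0 R)"
    using holomorphic2_dilate[OF h, of "ball 0 R" r "ball 0 R" 1] mult_mem_ball[OF r] by simp
  show "(\<integral>z. k (r * cnj z) u * h z (cnj u) \<partial>disk_measure \<alpha>) =
      (\<integral>z. k (cnj z) u * h (r * z) (cnj u) \<partial>disk_measure \<alpha>)" if "u \<in> disk" for u
    using pairing_dilation[OF \<alpha> R holomorphic_sections(1)[OF that] holomorphic_sections(2)[OF that] r] .
qed

lemma pairing2_dilation_snd:
  assumes r: "cmod r \<le> 1"
  shows "pairing2 \<alpha> (\<lambda>z w. k z (r * w)) h = pairing2 \<alpha> k (\<lambda>z w. h z (r * w))"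
proof (rule pairing2_cong_snd[OF \<alpha> R _ h k])
  show "holomorphic2_on (\<lambda>z w. k z (r * w)) (ball 0 R) (ball 0 R)"
    using holomorphic2_dilate[OF k, of "ball 0 R" 1 "ball 0 R" r] mult_mem_ball[OF r] by simp
  show "holomorphic2_on (\<lambda>z w. h z (r * w)) (ball 0 R) (ball 0 R)"
    using holomorphic2_dilate[OF h, of "ball 0 R" 1 "ball 0 R" r] mult_mem_ball[OF r] by simp
  show "(\<integral>u. h z (cnj u) * k (cnj z) (r * u) \<partial>disk_measure \<alpha>) =
      (\<integral>u. h z (r * cnj u) * k (cnj z) u \<partial>disk_measure \<alpha>)" if "z \<in> disk" for z
    using pairing_dilation[OF \<alpha> R holomorphic_sections(4)[OF that] holomorphic_sections(3)[OF that] r, symmetric] .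
qed

end

lemma pairing2_dilation:
  assumes \<alpha>: "\<alpha> > 1" and R: "R > 1"
    and k: "holomorphic2_on k (ball 0 R) (ball 0 R)" and h: "holomorphic2_on h (ball 0 R) (ball 0 R)"
    and r: "cmod r \<le> 1"
  shows "pairing2 \<alpha> (\<lambda>z w. k (r * z) (r * w)) h = pairing2 \<alpha> k (\<lambda>z w. h (r * z) (r * w))"
proof -
  have kr: "holomorphic2_on (\<lambda>z w. k z (r * w)) (ball 0 R) (ball 0 R)"
    using holomorphic2_dilate[OF k, of "ball 0 R" 1 "ball 0 R" r] mult_mem_ball[OF r] by simp
  have hr: "holomorphic2_on (\<lambda>z w. h (r * z) w) (ball 0 R) (ball 0 R)"
    using holomorphic2_dilate[OF h, of "ball 0 R" r "ball 0 R" 1] mult_mem_ball[OF r] by simp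
  show ?thesis
    using pairing2_dilation_fst[OF \<alpha> R kr h r] pairing2_dilation_snd[OF \<alpha> R k hr r] by simp
qed

section \<open>The kernel\<close>

text \<open>The principal powers are written through \<open>Ln\<close>, so that the dependence on
  \<open>p\<close> is visibly entire at every point. The angle is complex: derivatives in \<phi>
  become complex derivatives in \<zeta>, restricted to the real line.\<close>

definition kern :: "real \<Rightarrow> complex \<Rightarrow> complex \<Rightarrow> complex \<Rightarrow> complex \<Rightarrow> complex" where
  "kern \<alpha> p \<zeta> Z U = exp (- p * Ln (1 - Z * exp (\<i> * \<zeta>)) - p * Ln (1 - U * exp (- \<i> * \<zeta>))
     + (p - of_real \<alpha>) * Ln (1 - Z * U))"

lemma one_minus_not_nonpos_Reals:
  fixes x :: complex
  assumes "cmod x < 1"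
  shows "1 - x \<notin> \<real>\<^sub>\<le>\<^sub>0"
  using assms abs_Re_le_cmod[of x] by (auto simp: complex_nonpos_Reals_iff)

lemma one_minus_nonzero:
  fixes x :: complex
  assumes "cmod x < 1"
  shows "1 - x \<noteq> 0"
  using assms by auto

lemma exp_Ln_one_minus:
  fixes x :: complex
  assumes "cmod x < 1"
  shows "exp (Ln (1 - x)) = 1 - x"
  using one_minus_nonzero[OF assms] by (rule exp_Ln)

text \<open>Under these conditions the three bases lie in the right half-plane, where
  \<open>Ln\<close> is holomorphic. Both situations that occur are covered: the open bidisk with a
  real angle, and the dilated closed bidisk with an angle in a strip.\<close>

definition kern_dom :: "complex \<Rightarrow> complex \<Rightarrow> complex \<Rightarrow> bool" where
  "kern_dom \<zeta> Z U \<longleftrightarrow> cmod (Z * exp (\<i> * \<zeta>)) < 1 \<and> cmod (U * exp (- \<i> * \<zeta>)) < 1 \<and> cmod (Z * U) < 1"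

lemma
  assumes "kern_dom \<zeta> Z U"
  shows kern_dom_not_nonpos: "1 - Z * exp (\<i> * \<zeta>) \<notin> \<real>\<^sub>\<le>\<^sub>0" "1 - U * exp (- \<i> * \<zeta>) \<notin> \<real>\<^sub>\<le>\<^sub>0" "1 - Z * U \<notin> \<real>\<^sub>\<le>\<^sub>0"
    and kern_dom_nonzero: "1 - Z * exp (\<i> * \<zeta>) \<noteq> 0" "1 - U * exp (- \<i> * \<zeta>) \<noteq> 0" "1 - Z * U \<noteq> 0"
  using assms by (simp_all only: kern_dom_def one_minus_not_nonpos_Reals one_minus_nonzero not_False_eq_True)

lemma cmod_exp_i_real: "cmod (exp (\<i> * of_real x)) = 1" "cmod (exp (- \<i> * of_real x)) = 1"
  by (simp_all add: norm_exp)

lemma kern_dom_disk: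
  assumes "Z \<in> disk" "U \<in> disk"
  shows "kern_dom (of_real \<phi>) Z U"
  using assms mult_strict_mono[of "cmod Z" 1 "cmod U" 1]
  by (auto simp: kern_dom_def norm_mult cmod_exp_i_real simp del: mult_minus_left minus_mult_left)

lemma K_eq_kern:
  assumes "z \<in> disk" "u \<in> disk"
  shows "K \<alpha> \<phi> s z u = kern \<alpha> (1/2 + \<i> * of_real s) (of_real \<phi>) (cnj z) u"
proof -
  have "kern_dom (of_real \<phi>) (cnj z) u"
    using assms by (intro kern_dom_disk) auto
  note nz = kern_dom_nonzero[OF this]
  show ?thesis
    unfolding K_def kern_def powr_def using nz
    by (simp add: exp_add[symmetric] exp_diff[symmetric] del: right_minus_eq)
      (simp add: algebra_simps)
qed

lemma kern_p_minus_one: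
  assumes "kern_dom \<zeta> Z U"
  shows "kern \<alpha> (p - 1) \<zeta> Z U = kern \<alpha> p \<zeta> Z U *
    ((1 - Z * exp (\<i> * \<zeta>)) * (1 - U * exp (- \<i> * \<zeta>)) / (1 - Z * U))"
proof -
  let ?a = "1 - Z * exp (\<i> * \<zeta>)" and ?b = "1 - U * exp (- \<i> * \<zeta>)" and ?c = "1 - Z * U"
  have "kern \<alpha> (p - 1) \<zeta> Z U = kern \<alpha> p \<zeta> Z U * (exp (Ln ?a) * exp (Ln ?b) / exp (Ln ?c))"
    unfolding kern_def by (simp only: exp_add[symmetric] exp_diff[symmetric]) (simp add: algebra_simps)
  then show ?thesis
    using assms unfolding kern_dom_def by (simp only: exp_Ln_one_minus)
qed

lemma kern_p_plus_one:
  assumes "kern_dom \<zeta> Z U"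
  shows "kern \<alpha> (p + 1) \<zeta> Z U = kern \<alpha> p \<zeta> Z U *
    ((1 - Z * U) / ((1 - Z * exp (\<i> * \<zeta>)) * (1 - U * exp (- \<i> * \<zeta>))))"
proof -
  let ?a = "1 - Z * exp (\<i> * \<zeta>)" and ?b = "1 - U * exp (- \<i> * \<zeta>)" and ?c = "1 - Z * U"
  have "kern \<alpha> (p + 1) \<zeta> Z U = kern \<alpha> p \<zeta> Z U * (exp (Ln ?c) / (exp (Ln ?a) * exp (Ln ?b)))"
    unfolding kern_def by (simp only: exp_add[symmetric] exp_diff[symmetric]) (simp add: algebra_simps)
  then show ?thesis
    using assms unfolding kern_dom_def by (simp only: exp_Ln_one_minus)
qed

lemma kern_has_derivative:
  fixes Z U \<zeta> :: "complex \<Rightarrow> complex"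
  assumes dom: "kern_dom (\<zeta> x) (Z x) (U x)"
    and Z: "(Z has_field_derivative Z') (at x)" and U: "(U has_field_derivative U') (at x)"
    and \<zeta>: "(\<zeta> has_field_derivative \<zeta>') (at x)"
  shows "((\<lambda>x. kern \<alpha> p (\<zeta> x) (Z x) (U x)) has_field_derivative
     kern \<alpha> p (\<zeta> x) (Z x) (U x) *
      (p * ((Z' + \<i> * \<zeta>' * Z x) * exp (\<i> * \<zeta> x)) / (1 - Z x * exp (\<i> * \<zeta> x)) +
       p * ((U' - \<i> * \<zeta>' * U x) * exp (- \<i> * \<zeta> x)) / (1 - U x * exp (- \<i> * \<zeta> x)) +
       (of_real \<alpha> - p) * (Z' * U x + Z x * U') / (1 - Z x * U x))) (at x)"
proof -
  note np = kern_dom_not_nonpos[OF dom]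
  show ?thesis
    unfolding kern_def
    by (rule derivative_eq_intros Z U \<zeta> np refl)+ (simp add: algebra_simps divide_inverse)
qed

lemma d1_kern:
  assumes "kern_dom \<zeta> Z U"
  shows "d1 (kern \<alpha> p \<zeta>) Z U = kern \<alpha> p \<zeta> Z U *
    (p * exp (\<i> * \<zeta>) / (1 - Z * exp (\<i> * \<zeta>)) + (of_real \<alpha> - p) * U / (1 - Z * U))"
proof -
  have "((\<lambda>x. kern \<alpha> p \<zeta> x U) has_field_derivative kern \<alpha> p \<zeta> Z U *
      (p * ((1 + \<i> * 0 * Z) * exp (\<i> * \<zeta>)) / (1 - Z * exp (\<i> * \<zeta>)) +
       p * ((0 - \<i> * 0 * U) * exp (- \<i> * \<zeta>)) / (1 - U * exp (- \<i> * \<zeta>)) +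
       (of_real \<alpha> - p) * (1 * U + Z * 0) / (1 - Z * U))) (at Z)"
    by (rule kern_has_derivative[where Z = "\<lambda>x. x"]) (auto intro!: derivative_eq_intros assms)
  from DERIV_imp_deriv[OF this] show ?thesis by (simp add: d1_def)
qed

lemma d2_kern:
  assumes "kern_dom \<zeta> Z U"
  shows "d2 (kern \<alpha> p \<zeta>) Z U = kern \<alpha> p \<zeta> Z U *
    (p * exp (- \<i> * \<zeta>) / (1 - U * exp (- \<i> * \<zeta>)) + (of_real \<alpha> - p) * Z / (1 - Z * U))"
proof -
  have "((\<lambda>x. kern \<alpha> p \<zeta> Z x) has_field_derivative kern \<alpha> p \<zeta> Z U *
      (p * ((0 + \<i> * 0 * Z) * exp (\<i> * \<zeta>)) / (1 - Z * exp (\<i> * \<zeta>)) +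
       p * ((1 - \<i> * 0 * U) * exp (- \<i> * \<zeta>)) / (1 - U * exp (- \<i> * \<zeta>)) +
       (of_real \<alpha> - p) * (0 * U + Z * 1) / (1 - Z * U))) (at U)"
    by (rule kern_has_derivative[where U = "\<lambda>x. x"]) (auto intro!: derivative_eq_intros assms)
  from DERIV_imp_deriv[OF this] show ?thesis by (simp add: d2_def)
qed

section \<open>Derivatives of the kernel in the angle\<close>

definition kern_dzeta :: "real \<Rightarrow> complex \<Rightarrow> complex \<Rightarrow> complex \<Rightarrow> complex \<Rightarrow> complex" where
  "kern_dzeta \<alpha> p \<zeta> Z U = kern \<alpha> p \<zeta> Z U * (\<i> * p *
     (Z * exp (\<i> * \<zeta>) / (1 - Z * exp (\<i> * \<zeta>)) - U * exp (- \<i> * \<zeta>) / (1 - U * exp (- \<i> * \<zeta>))))"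

text \<open>For x = Z exp(i \<zeta>) the derivative of x / (1 - x) is i x / (1 - x)^2. The term in
  \<open>U\<close> acquires the opposite sign, which turns the difference in the first derivative
  into the sum in the last summand here.\<close>

definition kern_dzeta2 :: "real \<Rightarrow> complex \<Rightarrow> complex \<Rightarrow> complex \<Rightarrow> complex \<Rightarrow> complex" where
  "kern_dzeta2 \<alpha> p \<zeta> Z U = kern \<alpha> p \<zeta> Z U * (- p\<^sup>2 *
     (Z * exp (\<i> * \<zeta>) / (1 - Z * exp (\<i> * \<zeta>)) - U * exp (- \<i> * \<zeta>) / (1 - U * exp (- \<i> * \<zeta>)))\<^sup>2
     - p * (Z * exp (\<i> * \<zeta>) / (1 - Z * exp (\<i> * \<zeta>))\<^sup>2 + U * exp (- \<i> * \<zeta>) / (1 - U * exp (- \<i> * \<zeta>))\<^sup>2))"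

lemma kern_has_derivative_zeta:
  assumes "kern_dom \<zeta> Z U"
  shows "((\<lambda>\<zeta>. kern \<alpha> p \<zeta> Z U) has_field_derivative kern_dzeta \<alpha> p \<zeta> Z U) (at \<zeta>)"
proof -
  have "((\<lambda>x. kern \<alpha> p x Z U) has_field_derivative kern \<alpha> p \<zeta> Z U *
      (p * ((0 + \<i> * 1 * Z) * exp (\<i> * \<zeta>)) / (1 - Z * exp (\<i> * \<zeta>)) +
       p * ((0 - \<i> * 1 * U) * exp (- \<i> * \<zeta>)) / (1 - U * exp (- \<i> * \<zeta>)) +
       (of_real \<alpha> - p) * (0 * U + Z * 0) / (1 - Z * U))) (at \<zeta>)"
    by (rule kern_has_derivative[where \<zeta> = "\<lambda>x. x"]) (auto intro!: derivative_eq_intros assms)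
  then show ?thesis
    by (rule back_subst[where P = "\<lambda>D. (_ has_field_derivative D) _"])
      (simp add: kern_dzeta_def algebra_simps)
qed

lemma kern_dzeta_has_derivative_zeta:
  assumes "kern_dom \<zeta> Z U"
  shows "((\<lambda>\<zeta>. kern_dzeta \<alpha> p \<zeta> Z U) has_field_derivative kern_dzeta2 \<alpha> p \<zeta> Z U) (at \<zeta>)"
proof -
  let ?x = "\<lambda>\<zeta>. Z * exp (\<i> * \<zeta>)" and ?y = "\<lambda>\<zeta>. U * exp (- \<i> * \<zeta>)"
  note nz = kern_dom_nonzero(1,2)[OF assms]
  have x: "(?x has_field_derivative \<i> * ?x \<zeta>) (at \<zeta>)" and y: "(?y has_field_derivative - (\<i> * ?y \<zeta>)) (at \<zeta>)"
    by (auto intro!: derivative_eq_intros)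
  have q: "((\<lambda>\<zeta>. g \<zeta> / (1 - g \<zeta>)) has_field_derivative g' / (1 - g \<zeta>)\<^sup>2) (at \<zeta>)"
    if "(g has_field_derivative g') (at \<zeta>)" "1 - g \<zeta> \<noteq> 0" for g g'
  proof -
    have "((\<lambda>\<zeta>. g \<zeta> / (1 - g \<zeta>)) has_field_derivative
       (g' * (1 - g \<zeta>) - g \<zeta> * (0 - g')) / ((1 - g \<zeta>) * (1 - g \<zeta>))) (at \<zeta>)"
      by (intro DERIV_divide DERIV_diff DERIV_const that)
    then show ?thesis
      by (simp add: algebra_simps power2_eq_square)
  qed
  show ?thesis
    unfolding kern_dzeta_def
    by (rule DERIV_cong[OF DERIV_mult'[OF kern_has_derivative_zeta[OF assms]
         DERIV_cmult[OF DERIV_diff[OF q[OF x nz(1)] q[OF y nz(2)]]]]])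
       (simp add: kern_dzeta_def kern_dzeta2_def algebra_simps power2_eq_square)
qed

text \<open>These are the relations for \<open>Q0\<close> and \<open>Q1\<close> after division by
  the kernel at \<open>p\<close>, in the variables x = Z e and y = U / e that absorb the angle.
  \<open>T\<close> and \<open>S\<close> are the factors by which the shifts to \<open>p - 1\<close>
  and \<open>p + 1\<close> change the kernel; \<open>A\<close> and \<open>B\<close> come from its
  angular derivatives.\<close>

lemma kern_coeff_identities:
  fixes x y p a :: complex
  assumes nz: "1 - x \<noteq> 0" "1 - y \<noteq> 0" "1 - x * y \<noteq> 0" "2 * p - 1 \<noteq> 0" "p - 1 \<noteq> 0"
  defines "T \<equiv> (1 - x) * (1 - y) / (1 - x * y)"
  defines "S \<equiv> (1 - x * y) / ((1 - x) * (1 - y))"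
  defines "A \<equiv> x / (1 - x) - y / (1 - y)"
  defines "B \<equiv> x / (1 - x)\<^sup>2 + y / (1 - y)\<^sup>2"
  shows "- ((p - 1) * (p - a) / (2 * p - 1)) * T + p * (p + a - 1) / (2 * p - 1) * S
     - (p - a) / ((2 * p - 1) * (p - 1)) * (T * (- (p - 1)\<^sup>2 * A\<^sup>2 - (p - 1) * B)) =
     p * x / (1 - x) + p * y / (1 - y) + 2 * (a - p) * x * y / (1 - x * y) + a" (is ?Q0)
  and "p * (p - a) / (2 * p - 1) * T + p * (p + a - 1) / (2 * p - 1) * S
     - (p - a) / ((2 * p - 1) * (p - 1)) * (T * (- (p - 1)\<^sup>2 * A\<^sup>2 - (p - 1) * B)) +
       (p - a) * T * A =
     p / (1 - x) + (a - p) * y / (1 - x * y) + y * (p * y / (1 - y) + (a - p) * x * y / (1 - x * y) + a)" (is ?Q1)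
proof -
  \<comment> \<open>A common denominator: each of \<open>T\<close>, \<open>S\<close>,
    \<open>T * A\<close>, \<open>T * A\<^sup>2\<close> and \<open>T * B\<close> becomes a polynomial
    when multiplied by \<open>?D\<close>. After a further factor \<open>2 * p - 1\<close> only
    polynomial identities remain.\<close>
  let ?D = "(1 - x) * (1 - y) * (1 - x * y)"
  have D: "?D \<noteq> 0" using nz by simp
  have T: "T * ?D = ((1 - x) * (1 - y))\<^sup>2" and S: "S * ?D = (1 - x * y)\<^sup>2"
    unfolding T_def S_def using nz by (simp_all add: power2_eq_square)
  have TA: "T * A * ?D = (1 - x) * (1 - y) * (x - y)"
    unfolding T_def A_def using nz by (simp add: divide_simps) algebra
  have TA2: "T * A\<^sup>2 * ?D = (x - y)\<^sup>2"
    unfolding T_def A_def using nz by (simp add: divide_simps) algebra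
  have TB: "T * B * ?D = x * (1 - y)\<^sup>2 + y * (1 - x)\<^sup>2"
    unfolding T_def B_def using nz by (simp add: divide_simps) algebra
  \<comment> \<open>The factor \<open>p - 1\<close> in the denominator cancels against the one
    produced by the two angular derivatives.\<close>
  have third: "(p - a) / ((2 * p - 1) * (p - 1)) * (T * (- (p - 1)\<^sup>2 * A\<^sup>2 - (p - 1) * B)) =
     - ((p - a) / (2 * p - 1) * ((p - 1) * (T * A\<^sup>2) + T * B))"
    using nz by (simp add: divide_simps) algebra
  have c: "p * x / (1 - x) * ?D = p * x * (1 - y) * (1 - x * y)"
     "p / (1 - x) * ?D = p * (1 - y) * (1 - x * y)"
     "p * y / (1 - y) * ?D = p * y * (1 - x) * (1 - x * y)"
     "(a - p) * y / (1 - x * y) * ?D = (a - p) * y * (1 - x) * (1 - y)"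
     "2 * (a - p) * x * y / (1 - x * y) * ?D = 2 * (a - p) * x * y * (1 - x) * (1 - y)"
     "(a - p) * x * y / (1 - x * y) * ?D = (a - p) * x * y * (1 - x) * (1 - y)"
    using nz by simp_all
  have cancel: "L = R" if "(2 * p - 1) * (L * ?D) = (2 * p - 1) * (R * ?D)" for L R
    using that nz by simp
  have e1: "(2 * p - 1) * ((- ((p - 1) * (p - a) / (2 * p - 1)) * T + p * (p + a - 1) / (2 * p - 1) * S
     - - ((p - a) / (2 * p - 1) * ((p - 1) * (T * A\<^sup>2) + T * B))) * ?D) =
     - ((p - 1) * (p - a)) * (T * ?D) + p * (p + a - 1) * (S * ?D) + (p - a) * ((p - 1) * (T * A\<^sup>2 * ?D) + T * B * ?D)"
    using nz(4) by (simp add: divide_simps) algebra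
  show ?Q0
    unfolding third
    by (rule cancel) (simp only: e1 T S TA2 TB distrib_right c, algebra)
  have e2: "(2 * p - 1) * ((p * (p - a) / (2 * p - 1) * T + p * (p + a - 1) / (2 * p - 1) * S
     - - ((p - a) / (2 * p - 1) * ((p - 1) * (T * A\<^sup>2) + T * B)) + (p - a) * T * A) * ?D) =
     p * (p - a) * (T * ?D) + p * (p + a - 1) * (S * ?D) + (p - a) * ((p - 1) * (T * A\<^sup>2 * ?D) + T * B * ?D)
      + (2 * p - 1) * (p - a) * (T * A * ?D)"
    using nz(4) by (simp add: divide_simps) algebra
  have e3: "(u + v + y * (w + t + a)) * ?D = u * ?D + v * ?D + y * (w * ?D + t * ?D + a * ?D)" for u v w t
    by (simp only: distrib_right mult.assoc)
  show ?Q1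
    unfolding third
    by (rule cancel) (simp only: e2 e3 T S TA TA2 TB c, algebra)
qed

text \<open>The inverse \<open>e'\<close> of \<open>e\<close> is kept as a variable of its own. The
  hypotheses are then symmetric under exchanging \<open>Z, e\<close> with \<open>U, e'\<close>, so
  that the third relation can be obtained as an instance of the second.\<close>

lemma kern_rational_identities:
  fixes e e' Z U p a :: complex
  assumes ee: "e * e' = 1" and nz: "1 - Z * e \<noteq> 0" "1 - U * e' \<noteq> 0" "1 - Z * U \<noteq> 0" "2 * p - 1 \<noteq> 0" "p - 1 \<noteq> 0"
  defines "T \<equiv> (1 - Z * e) * (1 - U * e') / (1 - Z * U)"
  defines "S \<equiv> (1 - Z * U) / ((1 - Z * e) * (1 - U * e'))"
  defines "A \<equiv> Z * e / (1 - Z * e) - U * e' / (1 - U * e')"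
  defines "B \<equiv> Z * e / (1 - Z * e)\<^sup>2 + U * e' / (1 - U * e')\<^sup>2"
  defines "D1 \<equiv> p * e / (1 - Z * e) + (a - p) * U / (1 - Z * U)"
  defines "D2 \<equiv> p * e' / (1 - U * e') + (a - p) * Z / (1 - Z * U)"
  shows "- ((p - 1) * (p - a) / (2 * p - 1)) * T + p * (p + a - 1) / (2 * p - 1) * S
     - (p - a) / ((2 * p - 1) * (p - 1)) * (T * (- (p - 1)\<^sup>2 * A\<^sup>2 - (p - 1) * B)) =
     Z * D1 + U * D2 + a" (is ?Q0)
  and "e * (p * (p - a) / (2 * p - 1) * T + p * (p + a - 1) / (2 * p - 1) * S
     - (p - a) / ((2 * p - 1) * (p - 1)) * (T * (- (p - 1)\<^sup>2 * A\<^sup>2 - (p - 1) * B)) + (p - a) * T * A) =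
     D1 + U * (U * D2 + a)" (is ?Q1)
proof -
  define x y where "x = Z * e" and "y = U * e'"
  have ZU: "Z * U = x * y"
    unfolding x_def y_def using ee by (metis mult.assoc mult.commute mult_1)
  have U: "U = e * y"
    unfolding y_def using ee by (metis mult.assoc mult.commute mult_1)
  have nz': "1 - x \<noteq> 0" "1 - y \<noteq> 0" "1 - x * y \<noteq> 0"
    using nz by (simp_all add: x_def y_def ZU[unfolded x_def y_def])
  have "Z * D1 + U * D2 + a = p * x / (1 - x) + p * y / (1 - y) + 2 * (a - p) * (Z * U) / (1 - Z * U) + a"
    unfolding D1_def D2_def x_def y_def using nz by (simp add: algebra_simps)
  also have "\<dots> = p * x / (1 - x) + p * y / (1 - y) + 2 * (a - p) * x * y / (1 - x * y) + a"
    by (simp add: ZU)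
  finally show ?Q0
    using kern_coeff_identities(1)[OF nz' nz(4,5), of a]
    unfolding T_def S_def A_def B_def ZU x_def[symmetric] y_def[symmetric] by simp
  have UD2: "U * D2 = p * y / (1 - y) + (a - p) * x * y / (1 - x * y)"
  proof -
    have "U * D2 = p * y / (1 - y) + (a - p) * (Z * U) / (1 - Z * U)"
      unfolding D2_def y_def by (simp add: algebra_simps)
    then show ?thesis by (simp add: ZU)
  qed
  have "D1 = e * (p / (1 - x)) + (a - p) * U / (1 - x * y)"
    unfolding D1_def ZU x_def by simp
  also have "\<dots> = e * (p / (1 - x) + (a - p) * y / (1 - x * y))"
    by (subst U) (simp add: algebra_simps)
  finally have "D1 + U * (U * D2 + a) = e * (p / (1 - x) + (a - p) * y / (1 - x * y)) +
     (e * y) * (p * y / (1 - y) + (a - p) * x * y / (1 - x * y) + a)"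
    unfolding UD2 by (simp only: U[symmetric])
  then have "D1 + U * (U * D2 + a) = e * (p / (1 - x) + (a - p) * y / (1 - x * y) +
     y * (p * y / (1 - y) + (a - p) * x * y / (1 - x * y) + a))"
    by (simp only: distrib_left mult.assoc)
  then show ?Q1
    using kern_coeff_identities(2)[OF nz' nz(4,5), of a]
    unfolding T_def S_def A_def B_def ZU x_def[symmetric] y_def[symmetric] by simp
qed

lemma exp_i_cancel: "exp (\<i> * \<zeta>) * exp (- \<i> * \<zeta>) = (1 :: complex)"
  "exp (- \<i> * \<zeta>) * exp (\<i> * \<zeta>) = (1 :: complex)"
  by (simp_all add: exp_minus)

lemma
  fixes \<alpha> :: real and p \<zeta> Z U :: complex
  assumes dom: "kern_dom \<zeta> Z U" and p: "2 * p - 1 \<noteq> 0" "p - 1 \<noteq> 0"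
  defines "a \<equiv> complex_of_real \<alpha>"
  shows kern_Q0: "- ((p - 1) * (p - a) / (2 * p - 1)) * kern \<alpha> (p - 1) \<zeta> Z U
     + p * (p + a - 1) / (2 * p - 1) * kern \<alpha> (p + 1) \<zeta> Z U
     - (p - a) / ((2 * p - 1) * (p - 1)) * kern_dzeta2 \<alpha> (p - 1) \<zeta> Z U =
   Z * d1 (kern \<alpha> p \<zeta>) Z U + U * d2 (kern \<alpha> p \<zeta>) Z U + a * kern \<alpha> p \<zeta> Z U" (is ?Q0)
  and kern_Q1: "exp (\<i> * \<zeta>) * (p * (p - a) / (2 * p - 1) * kern \<alpha> (p - 1) \<zeta> Z U
     + p * (p + a - 1) / (2 * p - 1) * kern \<alpha> (p + 1) \<zeta> Z U
     - (p - a) / ((2 * p - 1) * (p - 1)) * kern_dzeta2 \<alpha> (p - 1) \<zeta> Z U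
     + (p - a) / (p - 1) * (1 / \<i>) * kern_dzeta \<alpha> (p - 1) \<zeta> Z U) =
   d1 (kern \<alpha> p \<zeta>) Z U + U * (U * d2 (kern \<alpha> p \<zeta>) Z U + a * kern \<alpha> p \<zeta> Z U)" (is ?Q1)
  and kern_Qm1: "exp (- \<i> * \<zeta>) * (p * (p - a) / (2 * p - 1) * kern \<alpha> (p - 1) \<zeta> Z U
     + p * (p + a - 1) / (2 * p - 1) * kern \<alpha> (p + 1) \<zeta> Z U
     - (p - a) / ((2 * p - 1) * (p - 1)) * kern_dzeta2 \<alpha> (p - 1) \<zeta> Z U
     - (p - a) / (p - 1) * (1 / \<i>) * kern_dzeta \<alpha> (p - 1) \<zeta> Z U) =
   d2 (kern \<alpha> p \<zeta>) Z U + Z * (Z * d1 (kern \<alpha> p \<zeta>) Z U + a * kern \<alpha> p \<zeta> Z U)" (is ?Qm1)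
proof -
  define e e' where "e = exp (\<i> * \<zeta>)" and "e' = exp (- \<i> * \<zeta>)"
  define k where "k = kern \<alpha> p \<zeta> Z U"
  define T S A B where "T = (1 - Z * e) * (1 - U * e') / (1 - Z * U)"
    and "S = (1 - Z * U) / ((1 - Z * e) * (1 - U * e'))"
    and "A = Z * e / (1 - Z * e) - U * e' / (1 - U * e')"
    and "B = Z * e / (1 - Z * e)\<^sup>2 + U * e' / (1 - U * e')\<^sup>2"
  define D1 D2 where "D1 = p * e / (1 - Z * e) + (a - p) * U / (1 - Z * U)"
    and "D2 = p * e' / (1 - U * e') + (a - p) * Z / (1 - Z * U)"
  have ee: "e * e' = 1" "e' * e = 1"
    unfolding e_def e'_def by (rule exp_i_cancel)+
  have nz: "1 - Z * e \<noteq> 0" "1 - U * e' \<noteq> 0" "1 - Z * U \<noteq> 0" "1 - U * Z \<noteq> 0"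
    using kern_dom_nonzero[OF dom] by (simp_all only: e_def e'_def mult.commute not_False_eq_True)
  have k1: "kern \<alpha> (p - 1) \<zeta> Z U = k * T" and k2: "kern \<alpha> (p + 1) \<zeta> Z U = k * S"
    unfolding kern_p_minus_one[OF dom] kern_p_plus_one[OF dom] k_def T_def S_def e_def e'_def
    by (rule refl)+
  have k3: "kern_dzeta \<alpha> (p - 1) \<zeta> Z U = k * T * (\<i> * (p - 1) * A)"
    and k4: "kern_dzeta2 \<alpha> (p - 1) \<zeta> Z U = k * T * (- (p - 1)\<^sup>2 * A\<^sup>2 - (p - 1) * B)"
    unfolding kern_dzeta_def kern_dzeta2_def k1 A_def B_def e_def e'_def by (rule refl)+
  have k5: "d1 (kern \<alpha> p \<zeta>) Z U = k * D1" and k6: "d2 (kern \<alpha> p \<zeta>) Z U = k * D2"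
    unfolding d1_kern[OF dom] d2_kern[OF dom] k_def D1_def D2_def e_def e'_def a_def by (rule refl)+
  have k3': "(p - a) / (p - 1) * (1 / \<i>) * kern_dzeta \<alpha> (p - 1) \<zeta> Z U = k * ((p - a) * T * A)"
  proof -
    have "(p - a) / (p - 1) * (1 / \<i>) * (k * T * (\<i> * (p - 1) * A)) =
      ((p - 1) / (p - 1)) * (\<i> / \<i>) * (k * ((p - a) * T * A))"
      by (simp only: times_divide_times_eq times_divide_eq_left times_divide_eq_right mult_ac mult_1_right mult_1_left divide_divide_eq_left)
    then show ?thesis
      unfolding k3 using p(2) by simp
  qed
  have fac: "c1 * (k * T) + c2 * (k * S) - c3 * (k * T * X) = k * (c1 * T + c2 * S - c3 * (T * X))"
    for c1 c2 c3 X :: complex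
    by (simp add: algebra_simps)
  have alg0: "k * (Z * D1 + U * D2 + a) = Z * (k * D1) + U * (k * D2) + a * k"
    and alg1: "k * (D1 + U * (U * D2 + a)) = k * D1 + U * (U * (k * D2) + a * k)"
    and algm1: "k * (D2 + Z * (Z * D1 + a)) = k * D2 + Z * (Z * (k * D1) + a * k)"
    by (simp_all add: algebra_simps)
  show ?Q0
    unfolding k1 k2 k4 k5 k6 fac k_def[symmetric]
      kern_rational_identities(1)[where a = a, OF ee(1) nz(1-3) p, folded T_def S_def A_def B_def D1_def D2_def] alg0
    by (rule refl)
  show ?Q1
    unfolding k1 k2 k4 k3' k5 k6 fac k_def[symmetric] distrib_left[symmetric] e_def[symmetric] mult.left_commute[of e k]
      kern_rational_identities(2)[where a = a, OF ee(1) nz(1-3) p, folded T_def S_def A_def B_def D1_def D2_def] alg1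
    by (rule refl)
  \<comment> \<open>The exchange of \<open>Z, e\<close> with \<open>U, e'\<close> fixes
    \<open>T\<close>, \<open>S\<close> and \<open>B\<close>, swaps \<open>D1\<close> with
    \<open>D2\<close>, and reverses the sign of \<open>A\<close>. That reversal is the sign in which
    \<open>Qm1\<close> differs from \<open>Q1\<close>.\<close>
  have m1: "e' * (p * (p - a) / (2 * p - 1) * T + p * (p + a - 1) / (2 * p - 1) * S
     - (p - a) / ((2 * p - 1) * (p - 1)) * (T * (- (p - 1)\<^sup>2 * A\<^sup>2 - (p - 1) * B)) - (p - a) * T * A) =
     D2 + Z * (Z * D1 + a)"
  proof -
    have *: "(1 - U * e') * (1 - Z * e) / (1 - U * Z) = T" "(1 - U * Z) / ((1 - U * e') * (1 - Z * e)) = S"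
      "U * e' / (1 - U * e') - Z * e / (1 - Z * e) = - A" "U * e' / (1 - U * e')\<^sup>2 + Z * e / (1 - Z * e)\<^sup>2 = B"
      "p * e' / (1 - U * e') + (a - p) * Z / (1 - U * Z) = D2"
      "p * e / (1 - Z * e) + (a - p) * U / (1 - U * Z) = D1"
      unfolding T_def S_def A_def B_def D1_def D2_def by (simp_all add: mult.commute add.commute)
    show ?thesis
      using kern_rational_identities(2)[OF ee(2) nz(2,1,4) p, of a] unfolding * by simp
  qed
  show ?Qm1
    unfolding k1 k2 k4 k3' k5 k6 fac k_def[symmetric] right_diff_distrib[symmetric] e'_def[symmetric] mult.left_commute[of e' k]
      m1 algm1
    by (rule refl)
qed

section \<open>Continuity and holomorphy of the kernel\<close>

lemma continuous_on_kern:
  assumes "continuous_on A p" "continuous_on A \<zeta>" "continuous_on A Z" "continuous_on A U"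
    and dom: "\<And>x. x \<in> A \<Longrightarrow> kern_dom (\<zeta> x) (Z x) (U x)"
  shows "continuous_on A (\<lambda>x. kern \<alpha> (p x) (\<zeta> x) (Z x) (U x))"
  unfolding kern_def
  by (intro continuous_intros assms(1-4) kern_dom_not_nonpos[OF dom])

lemma continuous_on_kern_dzeta:
  assumes "continuous_on A p" "continuous_on A \<zeta>" "continuous_on A Z" "continuous_on A U"
    and dom: "\<And>x. x \<in> A \<Longrightarrow> kern_dom (\<zeta> x) (Z x) (U x)"
  shows "continuous_on A (\<lambda>x. kern_dzeta \<alpha> (p x) (\<zeta> x) (Z x) (U x))"
  unfolding kern_dzeta_def using kern_dom_nonzero[OF dom]
  by (intro continuous_intros continuous_on_kern assms) auto

lemma holomorphic_on_kern_p: "(\<lambda>p. kern \<alpha> p \<zeta> Z U) holomorphic_on A"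
  unfolding kern_def by (intro holomorphic_intros)

lemma holomorphic2_of_fst:
  assumes "g holomorphic_on S"
  shows "holomorphic2_on (\<lambda>z w. g z) S T"
proof -
  have "continuous_on (S \<times> T) (\<lambda>x. g (fst x))"
    by (rule continuous_on_compose2[OF holomorphic_on_imp_continuous_on[OF assms] continuous_on_fst[OF continuous_on_id]]) auto
  then show ?thesis
    unfolding holomorphic2_on_def case_prod_unfold using assms by simp
qed

lemma holomorphic2_of_snd:
  assumes "g holomorphic_on T"
  shows "holomorphic2_on (\<lambda>z w. g w) S T"
  by (rule holomorphic2_swap[OF holomorphic2_of_fst[OF assms]])

lemma holomorphic2_kern: "holomorphic2_on (kern \<alpha> p (of_real \<phi>)) disk disk"
  unfolding holomorphic2_on_def
proof (intro conjI ballI)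
  show "continuous_on (disk \<times> disk) (\<lambda>(z, w). kern \<alpha> p (of_real \<phi>) z w)"
    unfolding case_prod_unfold
    by (intro continuous_on_kern continuous_intros) (auto intro!: kern_dom_disk)
  show "(\<lambda>z. kern \<alpha> p (of_real \<phi>) z w) holomorphic_on disk" if "w \<in> disk" for w
    unfolding kern_def using kern_dom_not_nonpos[OF kern_dom_disk[OF _ that]]
    by (intro holomorphic_intros) auto
  show "(\<lambda>w. kern \<alpha> p (of_real \<phi>) z w) holomorphic_on disk" if "z \<in> disk" for z
    unfolding kern_def using kern_dom_not_nonpos[OF kern_dom_disk[OF that]]
    by (intro holomorphic_intros) auto
qed

lemma holomorphic2_kern_dzeta:
  "holomorphic2_on (kern_dzeta \<alpha> p (of_real \<phi>)) disk disk"
  "holomorphic2_on (kern_dzeta2 \<alpha> p (of_real \<phi>)) disk disk"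
proof -
  have nz: "1 - z * exp (\<i> * of_real \<phi>) \<noteq> 0" "1 - z * exp (- \<i> * of_real \<phi>) \<noteq> 0" if "z \<in> disk" for z
    using kern_dom_nonzero[OF kern_dom_disk[OF that that]] by blast+
  define A where "A z = z * exp (\<i> * of_real \<phi>) / (1 - z * exp (\<i> * of_real \<phi>))" for z :: complex
  define B where "B z = z * exp (- \<i> * of_real \<phi>) / (1 - z * exp (- \<i> * of_real \<phi>))" for z :: complex
  define A' where "A' z = z * exp (\<i> * of_real \<phi>) / (1 - z * exp (\<i> * of_real \<phi>))\<^sup>2" for z :: complex
  define B' where "B' z = z * exp (- \<i> * of_real \<phi>) / (1 - z * exp (- \<i> * of_real \<phi>))\<^sup>2" for z :: complex
  have hol: "A holomorphic_on disk" "B holomorphic_on disk" "A' holomorphic_on disk" "B' holomorphic_on disk"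
    unfolding A_def B_def A'_def B'_def using nz by (auto intro!: holomorphic_intros)
  have 1: "kern_dzeta \<alpha> p (of_real \<phi>) = (\<lambda>z w. kern \<alpha> p (of_real \<phi>) z w * (\<i> * p * (A z + (-1) * B w)))"
    by (intro HOL.ext) (simp add: kern_dzeta_def A_def B_def)
  have 2: "kern_dzeta2 \<alpha> p (of_real \<phi>) = (\<lambda>z w. kern \<alpha> p (of_real \<phi>) z w *
     (- p\<^sup>2 * ((A z + (-1) * B w) * (A z + (-1) * B w)) + (- p) * (A' z + B' w)))"
    by (intro HOL.ext) (simp add: kern_dzeta2_def A_def B_def A'_def B'_def power2_eq_square)
  show "holomorphic2_on (kern_dzeta \<alpha> p (of_real \<phi>)) disk disk" "holomorphic2_on (kern_dzeta2 \<alpha> p (of_real \<phi>)) disk disk"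
    unfolding 1 2 by (intro holomorphic2_mult holomorphic2_add holomorphic2_const holomorphic2_kern
      holomorphic2_of_fst hol holomorphic2_of_snd)+
qed

section \<open>Integrals depending on a parameter\<close>

text \<open>Cauchy's inequality on circles of radius \<open>\<epsilon> / 4\<close>, which stay
  inside the larger ball for every centre in the half ball.\<close>

lemma cauchy_deriv_bound:
  assumes "f holomorphic_on ball \<zeta>0 \<epsilon>" "\<epsilon> > 0" "\<And>\<zeta>. \<zeta> \<in> ball \<zeta>0 \<epsilon> \<Longrightarrow> cmod (f \<zeta>) \<le> B" "\<xi> \<in> ball \<zeta>0 (\<epsilon> / 2)"
  shows "cmod (deriv f \<xi>) \<le> 4 * B / \<epsilon>"
proof -
  have sub: "cball \<xi> (\<epsilon> / 4) \<subseteq> ball \<zeta>0 \<epsilon>"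
  proof
    fix x assume "x \<in> cball \<xi> (\<epsilon> / 4)"
    then show "x \<in> ball \<zeta>0 \<epsilon>"
      using assms(2,4) dist_triangle[of \<zeta>0 x \<xi>] by auto
  qed
  have "cmod ((deriv ^^ 1) f \<xi>) \<le> fact 1 * B / (\<epsilon> / 4) ^ 1"
  proof (rule Cauchy_inequality)
    show "f holomorphic_on ball \<xi> (\<epsilon> / 4)"
      using sub ball_subset_cball by (intro holomorphic_on_subset[OF assms(1)]) blast
    show "continuous_on (cball \<xi> (\<epsilon> / 4)) f"
      by (rule continuous_on_subset[OF holomorphic_on_imp_continuous_on[OF assms(1)] sub])
    show "cmod (f x) \<le> B" if "cmod (\<xi> - x) = \<epsilon> / 4" for x
      using sub that by (intro assms(3)) (auto simp: dist_norm)
  qed (use assms(2) in simp)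
  then show ?thesis by (simp add: mult.commute)
qed

text \<open>A bound on \<open>f\<close> alone suffices: Cauchy's inequality turns it into a bound on
  the derivative and hence on the difference quotients, and dominated convergence applies with a
  constant majorant.\<close>

lemma (in finite_measure) has_field_derivative_integral:
  fixes f :: "complex \<Rightarrow> 'a \<Rightarrow> complex"
  assumes \<epsilon>: "\<epsilon> > 0"
    and meas: "\<And>\<zeta>. \<zeta> \<in> ball \<zeta>0 \<epsilon> \<Longrightarrow> f \<zeta> \<in> borel_measurable M"
    and hol: "\<And>x. x \<in> space M \<Longrightarrow> (\<lambda>\<zeta>. f \<zeta> x) holomorphic_on ball \<zeta>0 \<epsilon>"
    and bound: "\<And>\<zeta> x. \<zeta> \<in> ball \<zeta>0 \<epsilon> \<Longrightarrow> x \<in> space M \<Longrightarrow> cmod (f \<zeta> x) \<le> B"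
  shows "((\<lambda>\<zeta>. \<integral>x. f \<zeta> x \<partial>M) has_field_derivative (\<integral>x. deriv (\<lambda>\<zeta>. f \<zeta> x) \<zeta>0 \<partial>M)) (at \<zeta>0)"
  unfolding has_field_derivative_iff tendsto_at_iff_sequentially o_def
proof (intro allI impI)
  fix X :: "nat \<Rightarrow> complex"
  assume X: "\<forall>i. X i \<in> UNIV - {\<zeta>0}" "X \<longlonglongrightarrow> \<zeta>0"
  let ?V = "ball \<zeta>0 (\<epsilon> / 2)"
  \<comment> \<open>Dominated convergence asks for a bound at every index, so the quotient is
    replaced by 0 for the finitely many \<open>n\<close> with \<open>X n\<close> outside the half
    ball.\<close>
  define q where "q n x = (if X n \<in> ?V then (f (X n) x - f \<zeta>0 x) / (X n - \<zeta>0) else 0)" for n x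
  have V: "?V \<subseteq> ball \<zeta>0 \<epsilon>" "\<zeta>0 \<in> ?V" "\<zeta>0 \<in> ball \<zeta>0 \<epsilon>" using \<epsilon> by auto
  have int: "integrable M (f \<zeta>)" if "\<zeta> \<in> ball \<zeta>0 \<epsilon>" for \<zeta>
    using bound[OF that] by (intro integrable_const_bound[where B = B] AE_I2 meas that)
  have ev: "eventually (\<lambda>n. X n \<in> ?V) sequentially"
    using topological_tendstoD[OF X(2) open_ball V(2)] .
  have D: "((\<lambda>\<zeta>. f \<zeta> x) has_field_derivative deriv (\<lambda>\<zeta>. f \<zeta> x) \<xi>) (at \<xi>)"
    if "x \<in> space M" "\<xi> \<in> ball \<zeta>0 \<epsilon>" for x \<xi>
    using hol[OF that(1)] that(2) by (rule holomorphic_derivI[OF _ open_ball])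
  have q_meas: "q n \<in> borel_measurable M" for n
    unfolding q_def using V meas by (cases "X n \<in> ?V") auto
  have q_lim: "(\<lambda>n. q n x) \<longlonglongrightarrow> deriv (\<lambda>\<zeta>. f \<zeta> x) \<zeta>0" if "x \<in> space M" for x
  proof -
    have "(\<lambda>n. (f (X n) x - f \<zeta>0 x) / (X n - \<zeta>0)) \<longlonglongrightarrow> deriv (\<lambda>\<zeta>. f \<zeta> x) \<zeta>0"
      using D[OF that V(3)] X unfolding has_field_derivative_iff tendsto_at_iff_sequentially o_def by blast
    then show ?thesis
      by (rule Lim_transform_eventually) (use ev in eventually_elim, simp add: q_def)
  qed
  have q_bound: "cmod (q n x) \<le> 4 * B / \<epsilon>" if "x \<in> space M" for n x
  proof (cases "X n \<in> ?V")
    case True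
    have "cmod (f (X n) x - f \<zeta>0 x) \<le> 4 * B / \<epsilon> * cmod (X n - \<zeta>0)"
    proof (rule field_differentiable_bound[OF convex_ball _ _ True V(2)])
      fix \<xi> assume "\<xi> \<in> ?V"
      with V(1) show "((\<lambda>\<zeta>. f \<zeta> x) has_field_derivative deriv (\<lambda>\<zeta>. f \<zeta> x) \<xi>) (at \<xi> within ?V)"
        by (blast intro: has_field_derivative_at_within[OF D[OF that]])
      show "cmod (deriv (\<lambda>\<zeta>. f \<zeta> x) \<xi>) \<le> 4 * B / \<epsilon>"
        by (rule cauchy_deriv_bound[OF hol[OF that] \<epsilon> bound[OF _ that] \<open>\<xi> \<in> ?V\<close>])
    qed
    then show ?thesis
      using X(1) True by (simp add: q_def norm_divide divide_le_eq)
  next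
    case False
    have "0 \<le> B" using bound[OF V(3) that] norm_ge_zero order_trans by blast
    then show ?thesis using False \<epsilon> by (simp add: q_def)
  qed
  have "(\<lambda>n. \<integral>x. q n x \<partial>M) \<longlonglongrightarrow> (\<integral>x. deriv (\<lambda>\<zeta>. f \<zeta> x) \<zeta>0 \<partial>M)"
  proof (rule integral_dominated_convergence[where w = "\<lambda>_. 4 * B / \<epsilon>"])
    show "(\<lambda>x. deriv (\<lambda>\<zeta>. f \<zeta> x) \<zeta>0) \<in> borel_measurable M"
      by (rule borel_measurable_LIMSEQ_metric[OF q_meas q_lim])
  qed (use q_meas q_lim q_bound in auto)
  then show "(\<lambda>n. ((\<integral>x. f (X n) x \<partial>M) - (\<integral>x. f \<zeta>0 x \<partial>M)) / (X n - \<zeta>0)) \<longlonglongrightarrow> (\<integral>x. deriv (\<lambda>\<zeta>. f \<zeta> x) \<zeta>0 \<partial>M)"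
  proof (rule Lim_transform_eventually, use ev in eventually_elim)
    fix n assume n: "X n \<in> ?V"
    then have "integrable M (f (X n))" "integrable M (f \<zeta>0)" using int V by auto
    then show "(\<integral>x. q n x \<partial>M) = ((\<integral>x. f (X n) x \<partial>M) - (\<integral>x. f \<zeta>0 x \<partial>M)) / (X n - \<zeta>0)"
      using n by (simp add: q_def)
  qed
qed

text \<open>Continuity up to the closed bidisk provides, by compactness, the uniform bound needed to
  differentiate under the integral. The derivative \<open>kf'\<close> itself need only exist at
  points of the open bidisk.\<close>

lemma pairing2_has_derivative:
  assumes \<alpha>: "\<alpha> > 1" and R: "R > 1" and h: "holomorphic2_on h (ball 0 R) (ball 0 R)"
    and S: "open S" "\<zeta>0 \<in> S"
    and cont: "continuous_on (S \<times> (cball 0 1 \<times> cball 0 1)) (\<lambda>(\<zeta>, Z, U). kf \<zeta> Z U)"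
    and der: "\<And>\<zeta> Z U. \<zeta> \<in> S \<Longrightarrow> Z \<in> disk \<Longrightarrow> U \<in> disk \<Longrightarrow>
        ((\<lambda>\<zeta>. kf \<zeta> Z U) has_field_derivative kf' \<zeta> Z U) (at \<zeta>)"
  shows "((\<lambda>\<zeta>. pairing2 \<alpha> (kf \<zeta>) h) has_field_derivative pairing2 \<alpha> (kf' \<zeta>0) h) (at \<zeta>0)"
proof -
  interpret finite_measure "bidisk_measure \<alpha>"
    by (rule finite_measure_bidisk_measure[OF \<alpha>])
  obtain \<epsilon> where \<epsilon>: "\<epsilon> > 0" "cball \<zeta>0 \<epsilon> \<subseteq> S"
    using S open_contains_cball by blast
  have ballS: "ball \<zeta>0 \<epsilon> \<subseteq> S" using \<epsilon>(2) ball_subset_cball by blast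
  have "compact ((\<lambda>(\<zeta>, Z, U). kf \<zeta> Z U) ` (cball \<zeta>0 \<epsilon> \<times> (cball 0 1 \<times> cball 0 1)))"
    by (intro compact_continuous_image compact_Times compact_cball continuous_on_subset[OF cont])
      (use \<epsilon> in auto)
  then obtain B where B: "\<forall>y\<in>(\<lambda>(\<zeta>, Z, U). kf \<zeta> Z U) ` (cball \<zeta>0 \<epsilon> \<times> (cball 0 1 \<times> cball 0 1)). norm y \<le> B"
    using compact_imp_bounded bounded_iff by blast
  have kB: "cmod (kf \<zeta> Z U) \<le> B" if "\<zeta> \<in> ball \<zeta>0 \<epsilon>" "Z \<in> disk" "U \<in> disk" for \<zeta> Z U
  proof -
    have "(\<zeta>, Z, U) \<in> cball \<zeta>0 \<epsilon> \<times> (cball 0 1 \<times> cball 0 1)" using that by auto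
    from bspec[OF B imageI[OF this]] show ?thesis by simp
  qed
  obtain C where C: "C \<ge> 0" "\<And>z w. z \<in> cball 0 1 \<Longrightarrow> w \<in> cball 0 1 \<Longrightarrow> cmod (h z w) \<le> C"
    using holomorphic2_bounded[OF R h] by blast
  have hd: "holomorphic2_on h disk disk"
    using R by (intro holomorphic2_subset[OF h]) auto
  define f where "f \<zeta> x = kf \<zeta> (cnj (fst x)) (snd x) * h (fst x) (cnj (snd x))" for \<zeta> x
  have f_der: "((\<lambda>\<zeta>. f \<zeta> x) has_field_derivative kf' \<zeta> (cnj (fst x)) (snd x) * h (fst x) (cnj (snd x))) (at \<zeta>)"
    if "\<zeta> \<in> S" "x \<in> disk \<times> disk" for \<zeta> x
    unfolding f_def using that by (intro DERIV_cmult_right der) auto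
  have "((\<lambda>\<zeta>. \<integral>x. f \<zeta> x \<partial>bidisk_measure \<alpha>) has_field_derivative (\<integral>x. deriv (\<lambda>\<zeta>. f \<zeta> x) \<zeta>0 \<partial>bidisk_measure \<alpha>)) (at \<zeta>0)"
  proof (rule has_field_derivative_integral[OF \<epsilon>(1), where B = "B * C"])
    fix \<zeta> assume \<zeta>: "\<zeta> \<in> ball \<zeta>0 \<epsilon>"
    have "continuous_on (disk \<times> disk) (\<lambda>x. (\<lambda>(\<zeta>, Z, U). kf \<zeta> Z U) (\<zeta>, cnj (fst x), snd x))"
      by (rule continuous_on_compose2[OF cont]) (use \<zeta> ballS in \<open>auto intro!: continuous_intros\<close>)
    then have "continuous_on (disk \<times> disk) (f \<zeta>)"
      unfolding f_def by (intro continuous_intros holomorphic2_continuous_compose[OF hd]) auto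
    then show "f \<zeta> \<in> borel_measurable (bidisk_measure \<alpha>)"
      by (simp add: borel_measurable_continuous_on_restrict)
    fix x assume "x \<in> space (bidisk_measure \<alpha>)"
    then show "cmod (f \<zeta> x) \<le> B * C"
      unfolding f_def norm_mult using \<zeta> kB[OF \<zeta>] C
      by (intro mult_mono order_trans[OF norm_ge_zero kB[OF \<zeta>, of 0 0]]) auto
  next
    fix x assume "x \<in> space (bidisk_measure \<alpha>)"
    then have x: "x \<in> disk \<times> disk" by simp
    show "(\<lambda>\<zeta>. f \<zeta> x) holomorphic_on ball \<zeta>0 \<epsilon>"
      unfolding holomorphic_on_def field_differentiable_def
      using has_field_derivative_at_within[OF f_der[OF _ x]] ballS by blast
  qed
  moreover have "(\<integral>x. deriv (\<lambda>\<zeta>. f \<zeta> x) \<zeta>0 \<partial>bidisk_measure \<alpha>) = pairing2 \<alpha> (kf' \<zeta>0) h"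
    unfolding pairing2_def
    by (rule Bochner_Integration.integral_cong[OF refl])
      (use DERIV_imp_deriv[OF f_der[OF S(2)]] in \<open>auto simp: case_prod_unfold\<close>)
  ultimately show ?thesis
    by (simp add: pairing2_def f_def case_prod_unfold)
qed

text \<open>The points 1 - x and 1 - t x differ by at most 1 - t, and 1 - t is itself at most |1 - t
  x|; hence the factor 2. It allows the dilated kernels to be dominated in terms of the undilated
  bases.\<close>

lemma cmod_one_minus_scaled:
  fixes x :: complex
  assumes "cmod x \<le> 1" "0 \<le> t" "t \<le> 1"
  shows "cmod (1 - x) / 2 \<le> cmod (1 - of_real t * x)"
proof -
  have 1: "cmod (1 - x) \<le> cmod (1 - of_real t * x) + (1 - t)"
  proof -
    have "cmod (of_real t * x - x) = (1 - t) * cmod x"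
    proof -
      have "of_real t * x - x = - (of_real (1 - t) * x)" by (simp add: algebra_simps)
      then show ?thesis using assms by (simp only: norm_minus_cancel norm_mult norm_of_real abs_of_nonneg diff_ge_0_iff_ge)
    qed
    also have "\<dots> \<le> 1 - t" using assms by (simp add: mult_left_le)
    finally show ?thesis
      using norm_triangle_ineq[of "1 - of_real t * x" "of_real t * x - x"] by simp
  qed
  have "1 - t \<le> 1 - cmod (of_real t * x)"
    using assms by (simp add: norm_mult mult_left_le)
  also have "\<dots> \<le> cmod (1 - of_real t * x)"
    using norm_triangle_ineq2[of 1 "of_real t * x"] by simp
  finally show ?thesis using 1 by simp
qed

text \<open>The product of the two boundary factors, each of exponent -1/2, is replaced by a sum of
  exponents -1. In each summand one variable then occurs in the factor with \<open>Z * U\<close>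
  only, so the integration can be done one variable at a time.\<close>

definition kern_majorant :: "real \<Rightarrow> real \<Rightarrow> complex \<Rightarrow> complex \<Rightarrow> real" where
  "kern_majorant \<alpha> \<phi> Z U = (cmod (1 - Z * exp (\<i> * of_real \<phi>)) powr (-1) + cmod (1 - U * exp (- \<i> * of_real \<phi>)) powr (-1))
      * cmod (1 - Z * U) powr (- (\<alpha> - 1/2))"

lemma cmod_kern:
  assumes "kern_dom (of_real \<phi>) Z U"
  shows "cmod (kern \<alpha> (1/2 + \<i> * of_real s) (of_real \<phi>) Z U) \<le>
     cmod (1 - Z * exp (\<i> * of_real \<phi>)) powr (-1/2) * cmod (1 - U * exp (- \<i> * of_real \<phi>)) powr (-1/2)
      * cmod (1 - Z * U) powr (- (\<alpha> - 1/2)) * exp (3 * pi * \<bar>s\<bar>)"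
proof -
  note nz = kern_dom_nonzero[OF assms]
  define a b c where "a = 1 - Z * exp (\<i> * of_real \<phi>)" and "b = 1 - U * exp (- \<i> * of_real \<phi>)" and "c = 1 - Z * U"
  have nz: "a \<noteq> 0" "b \<noteq> 0" "c \<noteq> 0"
    using nz unfolding a_def b_def c_def by blast+
  have im: "\<bar>Im (Ln w)\<bar> \<le> pi" if "w \<noteq> 0" for w
    using mpi_less_Im_Ln[OF that] Im_Ln_le_pi[OF that] by simp
  have "Re (- (1/2 + \<i> * of_real s) * Ln a - (1/2 + \<i> * of_real s) * Ln b + (1/2 + \<i> * of_real s - of_real \<alpha>) * Ln c) =
    (-1/2) * ln (cmod a) + (-1/2) * ln (cmod b) + (- (\<alpha> - 1/2)) * ln (cmod c) + s * (Im (Ln a) + Im (Ln b) - Im (Ln c))"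
    using nz by (simp add: algebra_simps)
  \<comment> \<open>The imaginary part of the exponent acts only through the arguments of the three
    bases, each at most pi in absolute value.\<close>
  also have "s * (Im (Ln a) + Im (Ln b) - Im (Ln c)) \<le> 3 * pi * \<bar>s\<bar>"
  proof -
    have "\<bar>s * (Im (Ln a) + Im (Ln b) - Im (Ln c))\<bar> \<le> \<bar>s\<bar> * (3 * pi)"
      unfolding abs_mult using im[OF nz(1)] im[OF nz(2)] im[OF nz(3)] by (intro mult_left_mono) auto
    then show ?thesis by (simp add: mult_ac)
  qed
  finally have "cmod (kern \<alpha> (1/2 + \<i> * of_real s) (of_real \<phi>) Z U) \<le>
     exp ((-1/2) * ln (cmod a) + (-1/2) * ln (cmod b) + (- (\<alpha> - 1/2)) * ln (cmod c) + 3 * pi * \<bar>s\<bar>)"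
    unfolding kern_def norm_exp a_def b_def c_def by simp
  also have "\<dots> = cmod a powr (-1/2) * cmod b powr (-1/2) * cmod c powr (- (\<alpha> - 1/2)) * exp (3 * pi * \<bar>s\<bar>)"
    unfolding powr_def using nz by (simp only: exp_add norm_eq_zero if_False)
  finally show ?thesis unfolding a_def b_def c_def .
qed

text \<open>The bound is uniform in \<open>t\<close>, including \<open>t = 1\<close>, and so serves
  as the dominating function when the dilation tends to the identity. The powers of 2 come from
  halving the three bases.\<close>

lemma kern_le_majorant:
  assumes \<alpha>: "\<alpha> > 1" and Z: "Z \<in> disk" and U: "U \<in> disk" and t: "0 \<le> t" "t \<le> 1"
  shows "cmod (kern \<alpha> (1/2 + \<i> * of_real s) (of_real \<phi>) (of_real t * Z) (of_real t * U)) \<le>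
    (2 * 2 powr (\<alpha> - 1/2) * exp (3 * pi * \<bar>s\<bar>)) * kern_majorant \<alpha> \<phi> Z U"
proof -
  note dom = kern_dom_disk[OF Z U, of \<phi>]
  note nz = kern_dom_nonzero[OF dom]
  have tZ: "of_real t * Z \<in> disk" "of_real t * U \<in> disk"
    using mult_mem_ball[of "of_real t" Z 1] mult_mem_ball[of "of_real t" U 1] t Z U by auto
  define a b c where "a = cmod (1 - Z * exp (\<i> * of_real \<phi>))" and "b = cmod (1 - U * exp (- \<i> * of_real \<phi>))" and "c = cmod (1 - Z * U)"
  define a' b' c' where "a' = cmod (1 - of_real t * Z * exp (\<i> * of_real \<phi>))" and "b' = cmod (1 - of_real t * U * exp (- \<i> * of_real \<phi>))"
    and "c' = cmod (1 - (of_real t * Z) * (of_real t * U))"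
  have pos: "a > 0" "b > 0" "c > 0"
    unfolding a_def b_def c_def zero_less_norm_iff using nz by blast+
  have le: "a / 2 \<le> a'" "b / 2 \<le> b'" "c / 2 \<le> c'"
  proof -
    show "a / 2 \<le> a'" unfolding a_def a'_def mult.assoc
      using dom t unfolding kern_dom_def by (intro cmod_one_minus_scaled) auto
    show "b / 2 \<le> b'" unfolding b_def b'_def mult.assoc
      using dom t unfolding kern_dom_def by (intro cmod_one_minus_scaled) auto
    have "(of_real t * Z) * (of_real t * U) = of_real (t * t) * (Z * U)" by simp
    moreover have "cmod (1 - Z * U) / 2 \<le> cmod (1 - of_real (t * t) * (Z * U))"
      using dom t unfolding kern_dom_def by (intro cmod_one_minus_scaled) (auto simp: mult_le_one)
    ultimately show "c / 2 \<le> c'" unfolding c_def c'_def by (simp only:)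
  qed
  have "cmod (kern \<alpha> (1/2 + \<i> * of_real s) (of_real \<phi>) (of_real t * Z) (of_real t * U)) \<le>
     a' powr (-1/2) * b' powr (-1/2) * c' powr (- (\<alpha> - 1/2)) * exp (3 * pi * \<bar>s\<bar>)"
    unfolding a'_def b'_def c'_def by (rule cmod_kern[OF kern_dom_disk[OF tZ]])
  also have "\<dots> \<le> (a / 2) powr (-1/2) * (b / 2) powr (-1/2) * (c / 2) powr (- (\<alpha> - 1/2)) * exp (3 * pi * \<bar>s\<bar>)"
    using le pos \<alpha> by (intro mult_right_mono mult_mono powr_mono2') auto
  also have "(a / 2) powr (-1/2) * (b / 2) powr (-1/2) \<le> 2 * (a powr (-1) + b powr (-1))"
  proof -
    have sq: "(x / 2) powr (-1/2) * (x / 2) powr (-1/2) = 2 * x powr (-1)" if "x > 0" for x :: real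
      using that by (simp add: powr_add[symmetric] powr_minus_divide)
    have "p * q \<le> p * p + q * q" for p q :: real
    proof -
      have "0 \<le> (p - q) * (p - q) + p * p + q * q"
        by (intro add_nonneg_nonneg zero_le_square)
      then show ?thesis by (simp add: algebra_simps)
    qed
    from this[of "(a / 2) powr (-1/2)" "(b / 2) powr (-1/2)"] show ?thesis
      using pos by (simp only: sq distrib_left)
  qed
  also have "(c / 2) powr (- (\<alpha> - 1/2)) = 2 powr (\<alpha> - 1/2) * c powr (- (\<alpha> - 1/2))"
    using pos by (simp add: powr_divide powr_minus_divide field_simps)
  finally have "cmod (kern \<alpha> (1/2 + \<i> * of_real s) (of_real \<phi>) (of_real t * Z) (of_real t * U)) \<le>
     2 * (a powr (-1) + b powr (-1)) * (2 powr (\<alpha> - 1/2) * c powr (- (\<alpha> - 1/2))) * exp (3 * pi * \<bar>s\<bar>)"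
    by (simp add: mult_right_mono)
  then show ?thesis
    unfolding kern_majorant_def a_def[symmetric] b_def[symmetric] c_def[symmetric]
    by (simp only: mult_ac)
qed

lemma borel_measurable_ennreal_powr_continuous:
  fixes f :: "'a::topological_space \<Rightarrow> real"
  assumes "continuous_on UNIV f"
  shows "(\<lambda>x. ennreal (f x powr c)) \<in> borel_measurable borel"
proof -
  have [measurable]: "f \<in> borel_measurable borel"
    by (rule borel_measurable_continuous_onI[OF assms])
  show ?thesis by measurable
qed

text \<open>In each summand the variable absent from the boundary factor is integrated first:
  \<open>forelli_rudin\<close> with exponent \<alpha> - 1/2 bounds the inner integral by
  \<open>C2\<close> for every value of the other variable. The outer integral is then bounded by
  \<open>C1\<close>, belonging to exponent 1.\<close>

lemma nn_integral_kern_majorant_finite: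
  assumes \<alpha>: "\<alpha> > 1"
  shows "(\<integral>\<^sup>+x. ennreal (kern_majorant \<alpha> \<phi> (cnj (fst x)) (snd x)) \<partial>bidisk_measure \<alpha>) < \<infinity>"
proof -
  interpret pair_sigma_finite "disk_measure \<alpha>" "disk_measure \<alpha>"
    by (rule pair_sigma_finite_disk_measure[OF \<alpha>])
  let ?\<beta> = "\<alpha> - 1/2"
  define C1 where "C1 = (\<Sum>n. ((-1/2) gchoose n)\<^sup>2 * moment \<alpha> n)"
  define C2 where "C2 = (\<Sum>n. ((-?\<beta>/2) gchoose n)\<^sup>2 * moment \<alpha> n)"
  define g1 where "g1 z = ennreal (cmod (1 - cnj z * exp (\<i> * of_real \<phi>)) powr (-1))" for z
  define g2 where "g2 u = ennreal (cmod (1 - u * exp (- \<i> * of_real \<phi>)) powr (-1))" for u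
  define g where "g z u = ennreal (cmod (1 - cnj z * u) powr (- ?\<beta>))" for z u
  have cnj_eq: "cmod (1 - cnj a * b) = cmod (1 - cnj b * a)" for a b
    by (subst complex_mod_cnj[symmetric]) (simp del: complex_mod_cnj add: mult.commute)
  have F1: "(\<integral>\<^sup>+z. ennreal (cmod (1 - a * z) powr (-1)) \<partial>disk_measure \<alpha>) \<le> ennreal C1" if "cmod a \<le> 1" for a
    unfolding C1_def using forelli_rudin[OF \<alpha> _ _ that, of 1] \<alpha> by simp
  have F2: "(\<integral>\<^sup>+z. ennreal (cmod (1 - a * z) powr (- ?\<beta>)) \<partial>disk_measure \<alpha>) \<le> ennreal C2" if "cmod a \<le> 1" for a
    unfolding C2_def by (rule forelli_rudin[OF \<alpha> _ _ that]) (use \<alpha> in auto)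
  have G1: "(\<integral>\<^sup>+z. g1 z \<partial>disk_measure \<alpha>) \<le> ennreal C1"
  proof -
    have "g1 z = ennreal (cmod (1 - cnj (exp (\<i> * of_real \<phi>)) * z) powr (-1))" for z
      unfolding g1_def cnj_eq[symmetric] by (rule refl)
    then show ?thesis using F1[of "cnj (exp (\<i> * of_real \<phi>))"] by (simp add: cmod_exp_i_real)
  qed
  have G2: "(\<integral>\<^sup>+u. g2 u \<partial>disk_measure \<alpha>) \<le> ennreal C1"
    unfolding g2_def using F1[OF eq_refl[OF cmod_exp_i_real(2)[of \<phi>]]] by (simp only: mult.commute)
  have Gu: "(\<integral>\<^sup>+u. g z u \<partial>disk_measure \<alpha>) \<le> ennreal C2" if "z \<in> disk" for z
    unfolding g_def using that by (intro F2) simp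
  have Gz: "(\<integral>\<^sup>+z. g z u \<partial>disk_measure \<alpha>) \<le> ennreal C2" if "u \<in> disk" for u
    unfolding g_def cnj_eq[of _ u] using that by (intro F2) simp
  have [measurable]: "g1 \<in> borel_measurable borel" "g2 \<in> borel_measurable borel"
    unfolding g1_def g2_def by (intro borel_measurable_ennreal_powr_continuous continuous_intros)+
  have m1: "g1 \<in> borel_measurable (disk_measure \<alpha>)" "g2 \<in> borel_measurable (disk_measure \<alpha>)"
    by (simp_all add: measurable_restrict_space1)
  have m2: "(\<lambda>x. g1 (fst x)) \<in> borel_measurable (disk_measure \<alpha> \<Otimes>\<^sub>M disk_measure \<alpha>)"
    "(\<lambda>x. g2 (snd x)) \<in> borel_measurable (disk_measure \<alpha> \<Otimes>\<^sub>M disk_measure \<alpha>)"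
    using measurable_compose[OF measurable_fst m1(1)] measurable_compose[OF measurable_snd m1(2)] by auto
  have m3: "(\<lambda>x. g (fst x) (snd x)) \<in> borel_measurable (disk_measure \<alpha> \<Otimes>\<^sub>M disk_measure \<alpha>)"
  proof -
    have "(\<lambda>x. g (fst x) (snd x)) \<in> borel_measurable borel"
      unfolding g_def by (intro borel_measurable_ennreal_powr_continuous continuous_intros)
    then show ?thesis
      using measurable_restrict_space1 by (fold bidisk_measure_def) simp
  qed
  have gm: "g z \<in> borel_measurable (disk_measure \<alpha>)" "(\<lambda>z. g z u) \<in> borel_measurable (disk_measure \<alpha>)" for z u
  proof -
    have "g z \<in> borel_measurable borel" "(\<lambda>z. g z u) \<in> borel_measurable borel"
      unfolding g_def by (intro borel_measurable_ennreal_powr_continuous continuous_intros)+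
    then show "g z \<in> borel_measurable (disk_measure \<alpha>)" "(\<lambda>z. g z u) \<in> borel_measurable (disk_measure \<alpha>)"
      by (simp_all add: measurable_restrict_space1)
  qed
  have "ennreal (kern_majorant \<alpha> \<phi> (cnj (fst x)) (snd x)) = g1 (fst x) * g (fst x) (snd x) + g2 (snd x) * g (fst x) (snd x)" for x
    unfolding kern_majorant_def g1_def g2_def g_def by (simp only: distrib_right ennreal_plus ennreal_mult mult_nonneg_nonneg powr_ge_zero)
  then have "(\<integral>\<^sup>+x. ennreal (kern_majorant \<alpha> \<phi> (cnj (fst x)) (snd x)) \<partial>bidisk_measure \<alpha>) =
     (\<integral>\<^sup>+x. g1 (fst x) * g (fst x) (snd x) \<partial>(disk_measure \<alpha> \<Otimes>\<^sub>M disk_measure \<alpha>)) +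
     (\<integral>\<^sup>+x. g2 (snd x) * g (fst x) (snd x) \<partial>(disk_measure \<alpha> \<Otimes>\<^sub>M disk_measure \<alpha>))"
    unfolding bidisk_measure_def using m2 m3 by (simp only: nn_integral_add borel_measurable_times_ennreal)
  also have "(\<integral>\<^sup>+x. g1 (fst x) * g (fst x) (snd x) \<partial>(disk_measure \<alpha> \<Otimes>\<^sub>M disk_measure \<alpha>)) =
     (\<integral>\<^sup>+z. g1 z * (\<integral>\<^sup>+u. g z u \<partial>disk_measure \<alpha>) \<partial>disk_measure \<alpha>)"
    by (subst M1.nn_integral_fst[symmetric]) (use m2 m3 gm in \<open>auto simp: nn_integral_cmult simp del: measurable_disk_measure\<close>)
  also have "\<dots> \<le> (\<integral>\<^sup>+z. g1 z * ennreal C2 \<partial>disk_measure \<alpha>)"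
    by (intro nn_integral_mono mult_left_mono Gu) auto
  also have "\<dots> \<le> ennreal C1 * ennreal C2"
    using G1 m1 by (subst nn_integral_multc) (auto intro: mult_right_mono)
  also have "(\<integral>\<^sup>+x. g2 (snd x) * g (fst x) (snd x) \<partial>(disk_measure \<alpha> \<Otimes>\<^sub>M disk_measure \<alpha>)) =
     (\<integral>\<^sup>+u. g2 u * (\<integral>\<^sup>+z. g z u \<partial>disk_measure \<alpha>) \<partial>disk_measure \<alpha>)"
    by (subst nn_integral_snd[symmetric]) (use m2 m3 gm in \<open>auto simp: nn_integral_cmult case_prod_unfold simp del: measurable_disk_measure\<close>)
  also have "\<dots> \<le> (\<integral>\<^sup>+u. g2 u * ennreal C2 \<partial>disk_measure \<alpha>)"
    by (intro nn_integral_mono mult_left_mono Gz) auto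
  also have "\<dots> \<le> ennreal C1 * ennreal C2"
    using G2 m1 by (subst nn_integral_multc) (auto intro: mult_right_mono)
  finally have "(\<integral>\<^sup>+x. ennreal (kern_majorant \<alpha> \<phi> (cnj (fst x)) (snd x)) \<partial>bidisk_measure \<alpha>) \<le>
     ennreal C1 * ennreal C2 + ennreal C1 * ennreal C2"
    by (simp add: add_mono)
  also have "\<dots> < \<infinity>"
    by (simp add: ennreal_mult_less_top)
  finally show ?thesis .
qed

lemma integrable_kern_majorant:
  assumes "\<alpha> > 1"
  shows "integrable (bidisk_measure \<alpha>) (\<lambda>x. kern_majorant \<alpha> \<phi> (cnj (fst x)) (snd x))"
proof (rule integrableI_nonneg)
  have [measurable]: "(\<lambda>x::complex \<times> complex. cmod (1 - cnj (fst x) * exp (\<i> * of_real \<phi>))) \<in> borel_measurable borel"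
    "(\<lambda>x::complex \<times> complex. cmod (1 - snd x * exp (- \<i> * of_real \<phi>))) \<in> borel_measurable borel"
    "(\<lambda>x::complex \<times> complex. cmod (1 - cnj (fst x) * snd x)) \<in> borel_measurable borel"
    by (intro borel_measurable_continuous_onI continuous_intros)+
  have "(\<lambda>x. kern_majorant \<alpha> \<phi> (cnj (fst x)) (snd x)) \<in> borel_measurable borel"
    unfolding kern_majorant_def by measurable
  then show "(\<lambda>x. kern_majorant \<alpha> \<phi> (cnj (fst x)) (snd x)) \<in> borel_measurable (bidisk_measure \<alpha>)"
    by (simp add: measurable_restrict_space1)
  show "AE x in bidisk_measure \<alpha>. 0 \<le> kern_majorant \<alpha> \<phi> (cnj (fst x)) (snd x)"
    unfolding kern_majorant_def by (intro AE_I2 mult_nonneg_nonneg add_nonneg_nonneg powr_ge_zero)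
qed (rule nn_integral_kern_majorant_finite[OF assms])

section \<open>Moving a dilation onto the singular kernel\<close>

lemma holomorphic2_dilated_kern:
  assumes "0 \<le> t" "t * R \<le> 1"
  shows "holomorphic2_on (\<lambda>Z U. kern \<alpha> p (of_real \<phi>) (of_real t * Z) (of_real t * U)) (ball 0 R) (ball 0 R)"
proof -
  have m: "of_real t * z \<in> disk" if "z \<in> ball 0 R" for z :: complex
  proof (cases "t = 0")
    case False
    then have "t * cmod z < t * R" using that assms by (intro mult_strict_left_mono) auto
    then show ?thesis using assms by (simp add: norm_mult)
  qed simp
  show ?thesis
    by (rule holomorphic2_dilate[OF holomorphic2_kern m m])
qed

text \<open>Dominated convergence on the line where the real part of \<open>p\<close> is 1/2, for
  which the majorant is available. The limit \<tau>0 may be 1, where the kernel is singular on the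
  boundary.\<close>

lemma pairing2_kern_tendsto:
  assumes \<alpha>: "\<alpha> > 1" and R: "R > 1" and h: "holomorphic2_on h (ball 0 R) (ball 0 R)"
    and \<tau>: "\<And>n. 0 \<le> \<tau> n" "\<And>n. \<tau> n \<le> 1" and lim: "\<tau> \<longlonglongrightarrow> \<tau>0"
  shows "(\<lambda>n. pairing2 \<alpha> (\<lambda>Z U. kern \<alpha> (1/2 + \<i> * of_real s) (of_real \<phi>) (of_real (\<tau> n) * Z) (of_real (\<tau> n) * U)) h) \<longlonglongrightarrow>
      pairing2 \<alpha> (\<lambda>Z U. kern \<alpha> (1/2 + \<i> * of_real s) (of_real \<phi>) (of_real \<tau>0 * Z) (of_real \<tau>0 * U)) h"
proof -
  let ?k = "\<lambda>t Z U. kern \<alpha> (1/2 + \<i> * of_real s) (of_real \<phi>) (of_real t * Z) (of_real t * U)"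
  let ?M = "2 * 2 powr (\<alpha> - 1/2) * exp (3 * pi * \<bar>s\<bar>)"
  obtain C where C: "C \<ge> 0" "\<And>z w. z \<in> cball 0 1 \<Longrightarrow> w \<in> cball 0 1 \<Longrightarrow> cmod (h z w) \<le> C"
    using holomorphic2_bounded[OF R h] by blast
  have hd: "holomorphic2_on h disk disk"
    using R by (intro holomorphic2_subset[OF h]) auto
  have \<tau>0: "0 \<le> \<tau>0" "\<tau>0 \<le> 1"
    using \<tau> LIMSEQ_le_const[OF lim, of 0] LIMSEQ_le_const2[OF lim, of 1] by auto
  have meas: "(\<lambda>(z, u). ?k t (cnj z) u * h z (cnj u)) \<in> borel_measurable (bidisk_measure \<alpha>)"
    if "0 \<le> t" "t \<le> 1" for t
    using continuous_on_pairing2[OF holomorphic2_dilated_kern hd] that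
    by (simp add: borel_measurable_continuous_on_restrict)
  show ?thesis
    unfolding pairing2_def
  proof (rule integral_dominated_convergence[where w = "\<lambda>x. ?M * kern_majorant \<alpha> \<phi> (cnj (fst x)) (snd x) * C"])
    show "integrable (bidisk_measure \<alpha>) (\<lambda>x. ?M * kern_majorant \<alpha> \<phi> (cnj (fst x)) (snd x) * C)"
      by (intro integrable_mult_left integrable_mult_right integrable_kern_majorant[OF \<alpha>])
    show "AE x in bidisk_measure \<alpha>. (\<lambda>n. case x of (z, u) \<Rightarrow> ?k (\<tau> n) (cnj z) u * h z (cnj u)) \<longlonglongrightarrow>
        (case x of (z, u) \<Rightarrow> ?k \<tau>0 (cnj z) u * h z (cnj u))"
    proof (rule AE_I2)
      fix x assume "x \<in> space (bidisk_measure \<alpha>)"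
      then obtain z u where x: "x = (z, u)" and z: "cnj z \<in> disk" and u: "u \<in> disk" by auto
      have "continuous_on {0..1} (\<lambda>t. ?k t (cnj z) u)"
        by (intro continuous_on_kern continuous_intros kern_dom_disk)
          (use z u mult_mem_ball[of _ _ 1] in auto)
      from continuous_on_tendsto_compose[OF this lim] \<tau> \<tau>0
      have "(\<lambda>n. ?k (\<tau> n) (cnj z) u) \<longlonglongrightarrow> ?k \<tau>0 (cnj z) u" by simp
      then show "(\<lambda>n. case x of (z, u) \<Rightarrow> ?k (\<tau> n) (cnj z) u * h z (cnj u)) \<longlonglongrightarrow>
        (case x of (z, u) \<Rightarrow> ?k \<tau>0 (cnj z) u * h z (cnj u))"
        unfolding x prod.case by (rule tendsto_mult_right)
    qed
    show "AE x in bidisk_measure \<alpha>. cmod (case x of (z, u) \<Rightarrow> ?k (\<tau> n) (cnj z) u * h z (cnj u)) \<le>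
        ?M * kern_majorant \<alpha> \<phi> (cnj (fst x)) (snd x) * C" for n
    proof (rule AE_I2)
      fix x assume "x \<in> space (bidisk_measure \<alpha>)"
      then obtain z u where x: "x = (z, u)" and z: "cnj z \<in> disk" and u: "u \<in> disk" by auto
      have "0 \<le> ?M * kern_majorant \<alpha> \<phi> (cnj z) u"
        using norm_ge_zero kern_le_majorant[OF \<alpha> z u \<tau>(1)[of n] \<tau>(2)[of n], of s \<phi>] order_trans by blast
      then show "cmod (case x of (z, u) \<Rightarrow> ?k (\<tau> n) (cnj z) u * h z (cnj u)) \<le>
        ?M * kern_majorant \<alpha> \<phi> (cnj (fst x)) (snd x) * C"
        unfolding x prod.case norm_mult fst_conv snd_conv
        using z u by (intro mult_mono kern_le_majorant[OF \<alpha> z u \<tau>] C) auto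
    qed
  qed (use meas \<tau> \<tau>0 in auto)
qed

text \<open>\<open>pairing2_dilation\<close> requires both factors to be holomorphic beyond the
  closed bidisk, and the kernel is not. The identity is therefore proved for the kernel shrunk by
  \<open>t n\<close> below 1, and then \<open>t n\<close> tends to 1 on both sides.\<close>

lemma pairing2_kern_dilate:
  assumes \<alpha>: "\<alpha> > 1" and \<rho>: "\<rho> > 1" and h: "holomorphic2_on h (ball 0 (\<rho>\<^sup>2)) (ball 0 (\<rho>\<^sup>2))"
  shows "pairing2 \<alpha> (kern \<alpha> (1/2 + \<i> * of_real s) (of_real \<phi>)) h =
    pairing2 \<alpha> (\<lambda>Z U. kern \<alpha> (1/2 + \<i> * of_real s) (of_real \<phi>) (of_real (1/\<rho>) * Z) (of_real (1/\<rho>) * U))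
      (\<lambda>z w. h (of_real \<rho> * z) (of_real \<rho> * w))"
proof -
  let ?k = "\<lambda>t Z U. kern \<alpha> (1/2 + \<i> * of_real s) (of_real \<phi>) (of_real t * Z) (of_real t * U)"
  let ?h = "\<lambda>z w. h (of_real \<rho> * z) (of_real \<rho> * w)"
  define t where "t n = 1 - 1 / (real n + 2)" for n
  have t: "0 < t n" "t n < 1" for n by (auto simp: t_def field_simps)
  have t_lim: "t \<longlonglongrightarrow> 1" unfolding t_def by real_asymp
  have \<rho>2: "\<rho>\<^sup>2 > 1" "\<rho> < \<rho>\<^sup>2" using \<rho> less_1_mult[OF \<rho> \<rho>] by (auto simp: power2_eq_square)
  have h': "holomorphic2_on ?h (ball 0 \<rho>) (ball 0 \<rho>)"
    using \<rho> by (intro holomorphic2_dilate[OF h]) (auto simp: norm_mult power2_eq_square)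
  have eq: "pairing2 \<alpha> (?k (t n)) h = pairing2 \<alpha> (?k (t n / \<rho>)) ?h" for n
  proof -
    \<comment> \<open>The shrunk kernel is holomorphic up to radius \<open>1 / t n\<close> and
      \<open>?h\<close> up to \<rho>. The common radius tends to 1 with growing \<open>n\<close>,
      but the resulting identity does not involve it.\<close>
    define R where "R = min (1 / t n) \<rho>"
    have R: "R > 1" "t n * R \<le> 1" "R \<le> \<rho>"
      using t[of n] \<rho> by (auto simp: R_def field_simps min_def)
    have "pairing2 \<alpha> (\<lambda>Z U. ?k (t n) (of_real (1/\<rho>) * Z) (of_real (1/\<rho>) * U)) ?h =
      pairing2 \<alpha> (?k (t n)) (\<lambda>z w. ?h (of_real (1/\<rho>) * z) (of_real (1/\<rho>) * w))"
    proof (rule pairing2_dilation[OF \<alpha> R(1)])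
      show "holomorphic2_on (?k (t n)) (ball 0 R) (ball 0 R)"
        using t[of n] R by (intro holomorphic2_dilated_kern) auto
      show "holomorphic2_on ?h (ball 0 R) (ball 0 R)"
        using R by (intro holomorphic2_subset[OF h']) auto
      show "cmod (of_real (1/\<rho>)) \<le> 1" using \<rho> by (simp add: norm_divide)
    qed
    then show ?thesis using \<rho> by (simp add: mult.assoc[symmetric])
  qed
  have "(\<lambda>n. pairing2 \<alpha> (?k (t n)) h) \<longlonglongrightarrow> pairing2 \<alpha> (?k 1) h"
    using t by (intro pairing2_kern_tendsto[OF \<alpha> \<rho>2(1) h] t_lim) (auto intro: less_imp_le)
  moreover have "(\<lambda>n. pairing2 \<alpha> (?k (t n / \<rho>)) ?h) \<longlonglongrightarrow> pairing2 \<alpha> (?k (1 / \<rho>)) ?h"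
  proof (rule pairing2_kern_tendsto[OF \<alpha> \<rho> h'])
    show "0 \<le> t n / \<rho>" "t n / \<rho> \<le> 1" for n
      using t[of n] \<rho> by (auto simp: divide_le_eq)
    show "(\<lambda>n. t n / \<rho>) \<longlonglongrightarrow> 1 / \<rho>"
      using \<rho> by (intro tendsto_intros t_lim) auto
  qed
  ultimately have "pairing2 \<alpha> (?k 1) h = pairing2 \<alpha> (?k (1 / \<rho>)) ?h"
    unfolding eq by (rule LIMSEQ_unique)
  then show ?thesis by simp
qed

section \<open>The transform as a pairing, its extension in \<open>s\<close> and smoothness in the
  angle\<close>

lemma pairing2_cong:
  assumes "\<And>z w. z \<in> disk \<Longrightarrow> w \<in> disk \<Longrightarrow> k z w = k' z w" "\<And>z w. z \<in> disk \<Longrightarrow> w \<in> disk \<Longrightarrow> h z w = h' z w"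
  shows "pairing2 \<alpha> k h = pairing2 \<alpha> k' h'"
  unfolding pairing2_def by (rule Bochner_Integration.integral_cong[OF refl]) (auto simp: assms)

lemma J_eq_pairing2:
  assumes \<alpha>: "\<alpha> > 1" and h: "holomorphic2_on h disk disk"
  shows "J \<alpha> h \<phi> s = pairing2 \<alpha> (kern \<alpha> (1/2 + \<i> * of_real s) (of_real \<phi>)) h"
proof -
  let ?F = "\<lambda>z u. kern \<alpha> (1/2 + \<i> * of_real s) (of_real \<phi>) (cnj z) u * h z (cnj u)"
  have "J \<alpha> h \<phi> s = set_lebesgue_integral lborel (disk \<times> disk)
      (\<lambda>(z, u). ?F z u * of_real (weight \<alpha> z) * of_real (weight \<alpha> u))"
    unfolding J_def by (rule set_lebesgue_integral_cong) (auto simp: K_eq_kern open_Times)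
  also have "\<dots> = (\<integral>(z, u). ?F z u \<partial>bidisk_measure \<alpha>)"
    by (intro set_integral_bidisk[OF \<alpha>] borel_measurable_continuous_on_restrict continuous_on_pairing2 holomorphic2_kern h)
  finally show ?thesis by (simp add: pairing2_def)
qed

lemma J_cong:
  assumes "\<And>z w. z \<in> disk \<Longrightarrow> w \<in> disk \<Longrightarrow> f z w = g z w"
  shows "J \<alpha> f = J \<alpha> g"
proof (intro HOL.ext)
  show "J \<alpha> f \<phi> s = J \<alpha> g \<phi> s" for \<phi> s
    unfolding J_def by (rule set_lebesgue_integral_cong) (auto simp: assms open_Times)
qed

lemma entire_extension_unique:
  assumes "entire_extension g h"
  shows "ext g = h"
  unfolding ext_def
proof (rule the_equality)
  show "entire_extension g h" by fact
  fix h' assume h': "entire_extension g h'"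
  \<comment> \<open>The real line accumulates at 0, which is all that the identity theorem
    needs.\<close>
  have lp: "(0::complex) islimpt range of_real"
    unfolding islimpt_approachable
  proof (intro allI impI)
    fix e :: real assume "e > 0"
    then show "\<exists>x\<in>range complex_of_real. x \<noteq> 0 \<and> dist x 0 < e"
      by (intro bexI[of _ "of_real (e / 2)"] rangeI) (auto simp: dist_norm norm_divide)
  qed
  show "h' = h"
  proof
    fix w
    have "h' w - h w = 0"
      using assms h' unfolding entire_extension_def
      by (intro analytic_continuation[of "\<lambda>w. h' w - h w" UNIV "range complex_of_real" 0 w] lp)
        (auto intro!: holomorphic_intros)
    then show "h' w = h w" by simp
  qed
qed

lemma D\<phi>_of_real_compose:
  assumes "g holomorphic_on S" "open S" "\<And>x. of_real x \<in> S"
  shows "D\<phi> (\<lambda>x. g (of_real x)) = (\<lambda>x. deriv g (of_real x))"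
proof
  fix x
  have "(g has_field_derivative deriv g (of_real x)) (at (of_real x))"
    by (rule holomorphic_derivI[OF assms])
  then have "((\<lambda>x. g (of_real x)) has_vector_derivative deriv g (of_real x)) (at x)"
    by (rule has_vector_derivative_real_field)
  then show "D\<phi> (\<lambda>x. g (of_real x)) x = deriv g (of_real x)"
    unfolding D\<phi>_def by (rule vector_derivative_at)
qed

text \<open>Every application of \<open>D\<phi>\<close> is a complex derivative, holomorphic on the
  same open set, so all orders follow by induction.\<close>

lemma smooth_of_real_compose:
  assumes "g holomorphic_on S" "open S" "\<And>x. of_real x \<in> S"
  shows "smooth (\<lambda>x. g (of_real x))"
proof -
  have hol: "(deriv ^^ n) g holomorphic_on S" for n
    by (rule holomorphic_higher_deriv[OF assms(1,2)])
  have "(D\<phi> ^^ n) (\<lambda>x. g (of_real x)) = (\<lambda>x. (deriv ^^ n) g (of_real x))" for n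
  proof (induction n)
    case (Suc n)
    then show ?case using D\<phi>_of_real_compose[OF hol[of n] assms(2,3)] by simp
  qed simp
  moreover have "(\<lambda>x. (deriv ^^ n) g (of_real x)) differentiable (at x)" for n x
    using has_vector_derivative_real_field[OF holomorphic_derivI[OF hol assms(2,3)]]
    by (auto intro: differentiableI_vector)
  ultimately show ?thesis unfolding smooth_def by simp
qed

section \<open>The intertwining relations\<close>

lemma pairing2_cmult: "pairing2 \<alpha> (\<lambda>Z U. c * k Z U) h = c * pairing2 \<alpha> k h"
  "pairing2 \<alpha> k (\<lambda>z w. c * h z w) = c * pairing2 \<alpha> k h"
  unfolding pairing2_def case_prod_unfold by (simp_all only: mult.assoc mult.left_commute[of _ c] integral_mult_right_zero)

lemma pairing2_add_left:
  assumes "\<alpha> > 1" "R > 1" "holomorphic2_on k (ball 0 R) (ball 0 R)" "holomorphic2_on k' (ball 0 R) (ball 0 R)"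
    "holomorphic2_on h (ball 0 R) (ball 0 R)"
  shows "pairing2 \<alpha> (\<lambda>Z U. k Z U + k' Z U) h = pairing2 \<alpha> k h + pairing2 \<alpha> k' h"
  using Bochner_Integration.integral_add[OF integrable_pairing2[OF assms(1-3,5)] integrable_pairing2[OF assms(1,2,4,5)]]
  unfolding pairing2_def case_prod_unfold by (simp add: distrib_right)

lemma pairing2_add_right:
  assumes "\<alpha> > 1" "R > 1" "holomorphic2_on k (ball 0 R) (ball 0 R)" "holomorphic2_on h (ball 0 R) (ball 0 R)"
    "holomorphic2_on h' (ball 0 R) (ball 0 R)"
  shows "pairing2 \<alpha> k (\<lambda>z w. h z w + h' z w) = pairing2 \<alpha> k h + pairing2 \<alpha> k h'"
  using Bochner_Integration.integral_add[OF integrable_pairing2[OF assms(1-4)] integrable_pairing2[OF assms(1-3,5)]]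
  unfolding pairing2_def case_prod_unfold by (simp add: distrib_left)

lemma d1_dilate:
  assumes "holomorphic2_on f S T" "open S" "a * z \<in> S" "b * w \<in> T"
  shows "d1 (\<lambda>z w. f (a * z) (b * w)) z w = a * d1 f (a * z) (b * w)"
  unfolding d1_def
  using holomorphic_on_imp_differentiable_at[OF holomorphic2_holomorphic_fst[OF assms(1,4)] assms(2,3)]
  by (rule deriv_compose_linear)

lemma d2_dilate:
  assumes "holomorphic2_on f S T" "open T" "a * z \<in> S" "b * w \<in> T"
  shows "d2 (\<lambda>z w. f (a * z) (b * w)) z w = b * d2 f (a * z) (b * w)"
  unfolding d2_def
  using holomorphic_on_imp_differentiable_at[OF holomorphic2_holomorphic_snd[OF assms(1,3)] assms(2,4)]
  by (rule deriv_compose_linear)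

text \<open>The radius is the square of \<rho> because one factor \<rho> is spent on dilating
  \<open>h\<close>, while the other keeps the dilated function holomorphic beyond the closed unit
  bidisk.\<close>

locale dilated_pairing =
  fixes \<alpha> \<rho> :: real and h :: "complex \<Rightarrow> complex \<Rightarrow> complex"
  assumes \<alpha>: "\<alpha> > 1" and \<rho>: "\<rho> > 1"
    and h: "holomorphic2_on h (ball 0 (\<rho>\<^sup>2)) (ball 0 (\<rho>\<^sup>2))"
begin

abbreviation c :: complex where "c \<equiv> of_real (1 / \<rho>)"

abbreviation dil :: "(complex \<Rightarrow> complex \<Rightarrow> complex) \<Rightarrow> complex \<Rightarrow> complex \<Rightarrow> complex" where
  "dil k \<equiv> \<lambda>Z U. k (c * Z) (c * U)"

abbreviation infl :: "(complex \<Rightarrow> complex \<Rightarrow> complex) \<Rightarrow> complex \<Rightarrow> complex \<Rightarrow> complex" where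
  "infl f \<equiv> \<lambda>z w. f (of_real \<rho> * z) (of_real \<rho> * w)"

text \<open>The condition says that exp(i \<zeta>) and its inverse both have modulus below \<rho>.
  The dilation by 1 / \<rho> compensates for this, so the kernel stays regular on the whole closed
  bidisk.\<close>

definition strip :: "complex set" where
  "strip = {\<zeta>. \<bar>Im \<zeta>\<bar> < ln \<rho>}"

lemma c_mem_disk: "z \<in> ball 0 \<rho> \<Longrightarrow> c * z \<in> disk"
  using \<rho> by (simp add: norm_mult norm_divide)

lemma \<rho>_mem_ball: "z \<in> ball 0 \<rho> \<Longrightarrow> complex_of_real \<rho> * z \<in> ball 0 (\<rho>\<^sup>2)"
  using \<rho> by (simp add: norm_mult power2_eq_square)

lemma disk_subset: "disk \<subseteq> ball 0 \<rho>" and disk_subset2: "disk \<subseteq> ball 0 (\<rho>\<^sup>2)"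
  using \<rho> less_1_mult[OF \<rho> \<rho>] by (auto simp: power2_eq_square)

lemma holomorphic2_dil:
  "holomorphic2_on k disk disk \<Longrightarrow> holomorphic2_on (dil k) (ball 0 \<rho>) (ball 0 \<rho>)"
  by (rule holomorphic2_dilate[OF _ c_mem_disk c_mem_disk])

lemma holomorphic2_infl:
  "holomorphic2_on f (ball 0 (\<rho>\<^sup>2)) (ball 0 (\<rho>\<^sup>2)) \<Longrightarrow> holomorphic2_on (infl f) (ball 0 \<rho>) (ball 0 \<rho>)"
  by (rule holomorphic2_dilate[OF _ \<rho>_mem_ball \<rho>_mem_ball])

lemma open_strip: "open strip"
  unfolding strip_def by (intro open_Collect_less continuous_intros)

lemma of_real_in_strip: "of_real x \<in> strip"
  using \<rho> by (simp add: strip_def)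

lemma kern_dom_strip:
  assumes "\<zeta> \<in> strip" "Z \<in> cball 0 1" "U \<in> cball 0 1"
  shows "kern_dom \<zeta> (c * Z) (c * U)"
proof -
  have e: "exp x < \<rho>" if "x < ln \<rho>" for x
    using that \<rho> by (metis exp_less_cancel_iff exp_ln less_trans zero_less_one)
  have "cmod Z * exp (- Im \<zeta>) \<le> 1 * exp (- Im \<zeta>)" "cmod U * exp (Im \<zeta>) \<le> 1 * exp (Im \<zeta>)"
    using assms(2,3) by (intro mult_right_mono; simp)+
  moreover have "exp (- Im \<zeta>) < \<rho>" "exp (Im \<zeta>) < \<rho>"
    using assms(1) by (auto intro!: e simp: strip_def)
  ultimately have 1: "cmod Z * exp (- Im \<zeta>) < \<rho>" "cmod U * exp (Im \<zeta>) < \<rho>"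
    by linarith+
  have "cmod Z * cmod U \<le> 1"
    using assms(2,3) by (auto intro!: mult_le_one)
  also have "1 < \<rho> * \<rho>" by (rule less_1_mult[OF \<rho> \<rho>])
  finally show ?thesis
    using 1 \<rho> by (simp add: kern_dom_def norm_mult norm_divide norm_exp)
qed

lemma kern_has_derivative_pairing:
  assumes "\<zeta> \<in> strip"
  shows "((\<lambda>\<zeta>. pairing2 \<alpha> (dil (kern \<alpha> p \<zeta>)) (infl h)) has_field_derivative
     pairing2 \<alpha> (dil (kern_dzeta \<alpha> p \<zeta>)) (infl h)) (at \<zeta>)"
proof (rule pairing2_has_derivative[OF \<alpha> \<rho> holomorphic2_infl[OF h] open_strip assms])
  show "continuous_on (strip \<times> (cball 0 1 \<times> cball 0 1)) (\<lambda>(\<zeta>, Z, U). dil (kern \<alpha> p \<zeta>) Z U)"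
    unfolding case_prod_unfold
    by (intro continuous_on_kern continuous_intros kern_dom_strip) auto
  show "((\<lambda>\<zeta>. dil (kern \<alpha> p \<zeta>) Z U) has_field_derivative dil (kern_dzeta \<alpha> p \<zeta>) Z U) (at \<zeta>)"
    if "\<zeta> \<in> strip" "Z \<in> disk" "U \<in> disk" for \<zeta> Z U
    using that by (intro kern_has_derivative_zeta kern_dom_strip) auto
qed

lemma kern_dzeta_has_derivative_pairing:
  assumes "\<zeta> \<in> strip"
  shows "((\<lambda>\<zeta>. pairing2 \<alpha> (dil (kern_dzeta \<alpha> p \<zeta>)) (infl h)) has_field_derivative
     pairing2 \<alpha> (dil (kern_dzeta2 \<alpha> p \<zeta>)) (infl h)) (at \<zeta>)"
proof (rule pairing2_has_derivative[OF \<alpha> \<rho> holomorphic2_infl[OF h] open_strip assms])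
  show "continuous_on (strip \<times> (cball 0 1 \<times> cball 0 1)) (\<lambda>(\<zeta>, Z, U). dil (kern_dzeta \<alpha> p \<zeta>) Z U)"
    unfolding case_prod_unfold
    by (intro continuous_on_kern_dzeta continuous_intros kern_dom_strip) auto
  show "((\<lambda>\<zeta>. dil (kern_dzeta \<alpha> p \<zeta>) Z U) has_field_derivative dil (kern_dzeta2 \<alpha> p \<zeta>) Z U) (at \<zeta>)"
    if "\<zeta> \<in> strip" "Z \<in> disk" "U \<in> disk" for \<zeta> Z U
    using that by (intro kern_dzeta_has_derivative_zeta kern_dom_strip) auto
qed

lemma holomorphic_pairing_p: "(\<lambda>p. pairing2 \<alpha> (dil (kern \<alpha> p (of_real \<phi>))) (infl h)) holomorphic_on UNIV"
proof -
  have "((\<lambda>p. pairing2 \<alpha> (dil (kern \<alpha> p (of_real \<phi>))) (infl h)) has_field_derivative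
     pairing2 \<alpha> (\<lambda>Z U. deriv (\<lambda>p. dil (kern \<alpha> p (of_real \<phi>)) Z U) p0) (infl h)) (at p0)" for p0
  proof (rule pairing2_has_derivative[OF \<alpha> \<rho> holomorphic2_infl[OF h] open_UNIV UNIV_I])
    show "continuous_on (UNIV \<times> (cball 0 1 \<times> cball 0 1)) (\<lambda>(p, Z, U). dil (kern \<alpha> p (of_real \<phi>)) Z U)"
      unfolding case_prod_unfold
      by (intro continuous_on_kern continuous_intros kern_dom_strip) (auto intro: of_real_in_strip)
    show "((\<lambda>p. dil (kern \<alpha> p (of_real \<phi>)) Z U) has_field_derivative
        deriv (\<lambda>p. dil (kern \<alpha> p (of_real \<phi>)) Z U) p) (at p)" for p Z U
      by (rule holomorphic_derivI[OF holomorphic_on_kern_p open_UNIV UNIV_I])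
  qed
  then show ?thesis
    by (auto simp: holomorphic_on_def field_differentiable_def intro: has_field_derivative_at_within)
qed

lemma J_eq_dilated:
  assumes "holomorphic2_on f (ball 0 (\<rho>\<^sup>2)) (ball 0 (\<rho>\<^sup>2))"
  shows "J \<alpha> f \<phi> s = pairing2 \<alpha> (dil (kern \<alpha> (1/2 + \<i> * of_real s) (of_real \<phi>))) (infl f)"
  using J_eq_pairing2[OF \<alpha> holomorphic2_subset[OF assms disk_subset2 disk_subset2]]
    pairing2_kern_dilate[OF \<alpha> \<rho> assms] by simp

text \<open>\<open>J_eq_dilated\<close> is available for real \<open>s\<close> only, but its
  right-hand side is entire in \<open>p\<close> and hence in \<open>w\<close>.\<close>

lemma entire_extension_J:
  "entire_extension (J \<alpha> h \<phi>) (\<lambda>w. pairing2 \<alpha> (dil (kern \<alpha> (1/2 + \<i> * w) (of_real \<phi>))) (infl h))"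
proof -
  have "(\<lambda>p. pairing2 \<alpha> (dil (kern \<alpha> p (of_real \<phi>))) (infl h)) \<circ> (\<lambda>w. 1/2 + \<i> * w) holomorphic_on UNIV"
    by (rule holomorphic_on_compose_gen[OF _ holomorphic_pairing_p]) (auto intro!: holomorphic_intros)
  then show ?thesis
    by (simp add: entire_extension_def J_eq_dilated[OF h] o_def)
qed

lemma ext_J: "ext (J \<alpha> h \<phi>) w = pairing2 \<alpha> (dil (kern \<alpha> (1/2 + \<i> * w) (of_real \<phi>))) (infl h)"
  by (simp add: entire_extension_unique[OF entire_extension_J])

lemma holomorphic_pairing_zeta: "(\<lambda>\<zeta>. pairing2 \<alpha> (dil (kern \<alpha> p \<zeta>)) (infl h)) holomorphic_on strip"
  using kern_has_derivative_pairing
  by (auto simp: holomorphic_on_def field_differentiable_def intro: has_field_derivative_at_within)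

lemma J_Q_domain: "J \<alpha> h \<in> Q_domain"
  unfolding Q_domain_def
proof (intro CollectI conjI allI)
  show "\<exists>g. entire_extension (J \<alpha> h \<phi>) g" for \<phi>
    by (rule exI, rule entire_extension_J)
  show "smooth (\<lambda>\<phi>. ext (J \<alpha> h \<phi>) w)" for w
    unfolding ext_J by (rule smooth_of_real_compose[OF holomorphic_pairing_zeta open_strip of_real_in_strip])
qed

lemma D\<phi>_pairing:
  "D\<phi> (\<lambda>\<theta>. pairing2 \<alpha> (dil (kern \<alpha> p (of_real \<theta>))) (infl h)) =
     (\<lambda>\<theta>. pairing2 \<alpha> (dil (kern_dzeta \<alpha> p (of_real \<theta>))) (infl h))"
  "D\<phi> (\<lambda>\<theta>. pairing2 \<alpha> (dil (kern_dzeta \<alpha> p (of_real \<theta>))) (infl h)) =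
     (\<lambda>\<theta>. pairing2 \<alpha> (dil (kern_dzeta2 \<alpha> p (of_real \<theta>))) (infl h))"
proof -
  have "D\<phi> (\<lambda>\<theta>. g (of_real \<theta>)) = (\<lambda>\<theta>. g' (of_real \<theta>))"
    if "\<And>\<zeta>. \<zeta> \<in> strip \<Longrightarrow> (g has_field_derivative g' \<zeta>) (at \<zeta>)" for g g' :: "complex \<Rightarrow> complex"
    unfolding D\<phi>_def
    by (intro HOL.ext vector_derivative_at has_vector_derivative_real_field that of_real_in_strip)
  from this[OF kern_has_derivative_pairing] this[OF kern_dzeta_has_derivative_pairing]
  show "D\<phi> (\<lambda>\<theta>. pairing2 \<alpha> (dil (kern \<alpha> p (of_real \<theta>))) (infl h)) =
     (\<lambda>\<theta>. pairing2 \<alpha> (dil (kern_dzeta \<alpha> p (of_real \<theta>))) (infl h))"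
  "D\<phi> (\<lambda>\<theta>. pairing2 \<alpha> (dil (kern_dzeta \<alpha> p (of_real \<theta>))) (infl h)) =
     (\<lambda>\<theta>. pairing2 \<alpha> (dil (kern_dzeta2 \<alpha> p (of_real \<theta>))) (infl h))"
    by auto
qed

section \<open>The three relations at a fixed angle and a fixed real \<open>s\<close>\<close>

context
  fixes \<phi> s :: real
begin

abbreviation p :: complex where "p \<equiv> 1/2 + \<i> * of_real s"

abbreviation k :: "complex \<Rightarrow> complex \<Rightarrow> complex" where "k \<equiv> kern \<alpha> p (of_real \<phi>)"

lemma k_dil: "holomorphic2_on (dil k) (ball 0 \<rho>) (ball 0 \<rho>)"
  by (rule holomorphic2_dil[OF holomorphic2_kern])

lemma h_infl: "holomorphic2_on (infl h) (ball 0 \<rho>) (ball 0 \<rho>)"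
  by (rule holomorphic2_infl[OF h])

lemma c_disk: "z \<in> disk \<Longrightarrow> c * z \<in> disk"
  by (rule c_mem_disk[OF subsetD[OF disk_subset]])

lemma \<rho>_disk: "z \<in> disk \<Longrightarrow> of_real \<rho> * z \<in> ball 0 (\<rho>\<^sup>2)"
  by (rule \<rho>_mem_ball[OF subsetD[OF disk_subset]])

lemma derivs_dil:
  assumes "Z \<in> disk" "U \<in> disk"
  shows "d1 (dil k) Z U = c * d1 k (c * Z) (c * U)" "d2 (dil k) Z U = c * d2 k (c * Z) (c * U)"
  by (rule d1_dilate[OF holomorphic2_kern open_ball c_disk c_disk] d2_dilate[OF holomorphic2_kern open_ball c_disk c_disk]; fact)+

lemma derivs_infl:
  assumes "z \<in> disk" "w \<in> disk"
  shows "d1 (infl h) z w = of_real \<rho> * d1 h (of_real \<rho> * z) (of_real \<rho> * w)"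
    "d2 (infl h) z w = of_real \<rho> * d2 h (of_real \<rho> * z) (of_real \<rho> * w)"
  by (rule d1_dilate[OF h open_ball \<rho>_disk \<rho>_disk] d2_dilate[OF h open_ball \<rho>_disk \<rho>_disk]; fact)+

lemma c_\<rho>: "of_real \<rho> * c = 1" "of_real \<rho> * (c * x) = x" "c * (of_real \<rho> * x) = x" for x :: complex
  using \<rho> by simp_all

text \<open>The Euler operators commute with dilations, so no power of \<rho> appears when they pass
  from \<open>h\<close> to the kernel.\<close>

lemma J_M0:
  "J \<alpha> (\<lambda>z w. z * d1 h z w + w * d2 h z w + of_real \<alpha> * h z w) \<phi> s =
   pairing2 \<alpha> (dil (\<lambda>Z U. Z * d1 k Z U + U * d2 k Z U + of_real \<alpha> * k Z U)) (infl h)"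
proof -
  note lin = pairing2_add_left[OF \<alpha> \<rho>] pairing2_add_right[OF \<alpha> \<rho>]
  have "holomorphic2_on (\<lambda>z w. z * d1 h z w + w * d2 h z w + of_real \<alpha> * h z w) (ball 0 (\<rho>\<^sup>2)) (ball 0 (\<rho>\<^sup>2))"
    by (intro holomorphic2_intros h)
  from J_eq_dilated[OF this]
  have "J \<alpha> (\<lambda>z w. z * d1 h z w + w * d2 h z w + of_real \<alpha> * h z w) \<phi> s =
     pairing2 \<alpha> (dil k) (infl (\<lambda>z w. z * d1 h z w + w * d2 h z w + of_real \<alpha> * h z w))" .
  also have "\<dots> = pairing2 \<alpha> (dil k) (\<lambda>z w. z * d1 (infl h) z w + w * d2 (infl h) z w + of_real \<alpha> * infl h z w)"
    by (rule pairing2_cong; simp only: derivs_infl; simp only: mult_ac)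
  also have "\<dots> = pairing2 \<alpha> (dil k) (\<lambda>z w. z * d1 (infl h) z w) + pairing2 \<alpha> (dil k) (\<lambda>z w. w * d2 (infl h) z w)
      + of_real \<alpha> * pairing2 \<alpha> (dil k) (infl h)"
    by (simp only: lin pairing2_cmult(2) holomorphic2_intros k_dil h_infl)
  also have "\<dots> = pairing2 \<alpha> (\<lambda>Z U. Z * d1 (dil k) Z U) (infl h) + pairing2 \<alpha> (\<lambda>Z U. U * d2 (dil k) Z U) (infl h)
      + of_real \<alpha> * pairing2 \<alpha> (dil k) (infl h)"
    by (simp only: pairing2_euler_fst[OF \<alpha> \<rho> k_dil h_infl] pairing2_euler_snd[OF \<alpha> \<rho> k_dil h_infl])
  also have "\<dots> = pairing2 \<alpha> (\<lambda>Z U. Z * d1 (dil k) Z U + U * d2 (dil k) Z U + of_real \<alpha> * dil k Z U) (infl h)"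
    by (simp only: lin pairing2_cmult(1) holomorphic2_intros k_dil h_infl)
  also have "\<dots> = pairing2 \<alpha> (dil (\<lambda>Z U. Z * d1 k Z U + U * d2 k Z U + of_real \<alpha> * k Z U)) (infl h)"
    by (rule pairing2_cong; simp only: derivs_dil; simp only: mult_ac)
  finally show ?thesis .
qed

text \<open>The operators z^2 d/dz + \<alpha> z and d/dw raise and lower the degree by one, so
  dilating \<open>h\<close> costs the factors \<rho> and 1 / \<rho>. Taking adjoints exchanges
  raising with lowering, and the dilation of the kernel in the inverse direction absorbs exactly
  these factors.\<close>

lemma J_M1:
  "J \<alpha> (\<lambda>z w. z * (z * d1 h z w + of_real \<alpha> * h z w) + d2 h z w) \<phi> s =
   pairing2 \<alpha> (dil (\<lambda>Z U. d1 k Z U + U * (U * d2 k Z U + of_real \<alpha> * k Z U))) (infl h)"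
proof -
  note lin = pairing2_add_left[OF \<alpha> \<rho>] pairing2_add_right[OF \<alpha> \<rho>]
  have "holomorphic2_on (\<lambda>z w. z * (z * d1 h z w + of_real \<alpha> * h z w) + d2 h z w) (ball 0 (\<rho>\<^sup>2)) (ball 0 (\<rho>\<^sup>2))"
    by (intro holomorphic2_intros h)
  from J_eq_dilated[OF this]
  have "J \<alpha> (\<lambda>z w. z * (z * d1 h z w + of_real \<alpha> * h z w) + d2 h z w) \<phi> s =
     pairing2 \<alpha> (dil k) (infl (\<lambda>z w. z * (z * d1 h z w + of_real \<alpha> * h z w) + d2 h z w))" .
  also have "\<dots> = pairing2 \<alpha> (dil k) (\<lambda>z w. of_real \<rho> * (z * (z * d1 (infl h) z w + of_real \<alpha> * infl h z w)) + c * d2 (infl h) z w)"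
    by (rule pairing2_cong; simp only: derivs_infl; simp only: c_\<rho> mult_ac distrib_left)
  also have "\<dots> = of_real \<rho> * pairing2 \<alpha> (dil k) (\<lambda>z w. z * (z * d1 (infl h) z w + of_real \<alpha> * infl h z w))
      + c * pairing2 \<alpha> (dil k) (d2 (infl h))"
    by (simp only: lin pairing2_cmult(2) holomorphic2_intros k_dil h_infl)
  also have "\<dots> = of_real \<rho> * pairing2 \<alpha> (d1 (dil k)) (infl h)
      + c * pairing2 \<alpha> (\<lambda>Z U. U * (U * d2 (dil k) Z U + of_real \<alpha> * dil k Z U)) (infl h)"
    by (simp only: pairing2_deriv_fst[OF \<alpha> \<rho> k_dil h_infl] pairing2_shift_snd[OF \<alpha> \<rho> k_dil h_infl])
  also have "\<dots> = pairing2 \<alpha> (\<lambda>Z U. of_real \<rho> * d1 (dil k) Z U + c * (U * (U * d2 (dil k) Z U + of_real \<alpha> * dil k Z U))) (infl h)"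
    by (simp only: lin pairing2_cmult(1) holomorphic2_intros k_dil h_infl)
  also have "\<dots> = pairing2 \<alpha> (dil (\<lambda>Z U. d1 k Z U + U * (U * d2 k Z U + of_real \<alpha> * k Z U))) (infl h)"
    by (rule pairing2_cong; simp only: derivs_dil; simp only: c_\<rho> mult_ac distrib_left)
  finally show ?thesis .
qed

lemma J_Mm1:
  "J \<alpha> (\<lambda>z w. w * (w * d2 h z w + of_real \<alpha> * h z w) + d1 h z w) \<phi> s =
   pairing2 \<alpha> (dil (\<lambda>Z U. d2 k Z U + Z * (Z * d1 k Z U + of_real \<alpha> * k Z U))) (infl h)"
proof -
  note lin = pairing2_add_left[OF \<alpha> \<rho>] pairing2_add_right[OF \<alpha> \<rho>]
  have "holomorphic2_on (\<lambda>z w. w * (w * d2 h z w + of_real \<alpha> * h z w) + d1 h z w) (ball 0 (\<rho>\<^sup>2)) (ball 0 (\<rho>\<^sup>2))"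
    by (intro holomorphic2_intros h)
  from J_eq_dilated[OF this]
  have "J \<alpha> (\<lambda>z w. w * (w * d2 h z w + of_real \<alpha> * h z w) + d1 h z w) \<phi> s =
     pairing2 \<alpha> (dil k) (infl (\<lambda>z w. w * (w * d2 h z w + of_real \<alpha> * h z w) + d1 h z w))" .
  also have "\<dots> = pairing2 \<alpha> (dil k) (\<lambda>z w. of_real \<rho> * (w * (w * d2 (infl h) z w + of_real \<alpha> * infl h z w)) + c * d1 (infl h) z w)"
    by (rule pairing2_cong; simp only: derivs_infl; simp only: c_\<rho> mult_ac distrib_left)
  also have "\<dots> = of_real \<rho> * pairing2 \<alpha> (dil k) (\<lambda>z w. w * (w * d2 (infl h) z w + of_real \<alpha> * infl h z w))
      + c * pairing2 \<alpha> (dil k) (d1 (infl h))"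
    by (simp only: lin pairing2_cmult(2) holomorphic2_intros k_dil h_infl)
  also have "\<dots> = of_real \<rho> * pairing2 \<alpha> (d2 (dil k)) (infl h)
      + c * pairing2 \<alpha> (\<lambda>Z U. Z * (Z * d1 (dil k) Z U + of_real \<alpha> * dil k Z U)) (infl h)"
    by (simp only: pairing2_deriv_snd[OF \<alpha> \<rho> k_dil h_infl] pairing2_shift_fst[OF \<alpha> \<rho> k_dil h_infl])
  also have "\<dots> = pairing2 \<alpha> (\<lambda>Z U. of_real \<rho> * d2 (dil k) Z U + c * (Z * (Z * d1 (dil k) Z U + of_real \<alpha> * dil k Z U))) (infl h)"
    by (simp only: lin pairing2_cmult(1) holomorphic2_intros k_dil h_infl)
  also have "\<dots> = pairing2 \<alpha> (dil (\<lambda>Z U. d2 k Z U + Z * (Z * d1 k Z U + of_real \<alpha> * k Z U))) (infl h)"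
    by (rule pairing2_cong; simp only: derivs_dil; simp only: c_\<rho> mult_ac distrib_left)
  finally show ?thesis .
qed

text \<open>The common shape of the three operators; \<open>Q0\<close>, which has no first angular
  derivative, is brought to it by taking \<open>q4\<close> to be 0.\<close>

lemma pairing2_dil_combination:
  assumes "holomorphic2_on k1 disk disk" "holomorphic2_on k2 disk disk" "holomorphic2_on k3 disk disk" "holomorphic2_on k4 disk disk"
  shows "q1 * pairing2 \<alpha> (dil k1) (infl h) + q2 * pairing2 \<alpha> (dil k2) (infl h) - q3 * pairing2 \<alpha> (dil k3) (infl h)
      + q4 * pairing2 \<alpha> (dil k4) (infl h) =
    pairing2 \<alpha> (dil (\<lambda>Z U. q1 * k1 Z U + q2 * k2 Z U - q3 * k3 Z U + q4 * k4 Z U)) (infl h)"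
proof -
  have "pairing2 \<alpha> (\<lambda>Z U. q1 * dil k1 Z U + q2 * dil k2 Z U + (- q3) * dil k3 Z U + q4 * dil k4 Z U) (infl h) =
     q1 * pairing2 \<alpha> (dil k1) (infl h) + q2 * pairing2 \<alpha> (dil k2) (infl h) + (- q3) * pairing2 \<alpha> (dil k3) (infl h)
      + q4 * pairing2 \<alpha> (dil k4) (infl h)"
    by (simp only: pairing2_add_left[OF \<alpha> \<rho>] pairing2_cmult(1) holomorphic2_intros holomorphic2_dil assms h_infl)
  then show ?thesis by simp
qed

lemma shift_p: "1/2 + \<i> * (of_real s + \<i>) = p - 1" "1/2 + \<i> * (of_real s - \<i>) = p + 1"
  by (simp_all add: algebra_simps)

lemma p_coeffs: "- 1/2 + \<i> * of_real s = p - 1" "- of_real \<alpha> + 1/2 + \<i> * of_real s = p - of_real \<alpha>"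
  "of_real \<alpha> - 1/2 + \<i> * of_real s = p + of_real \<alpha> - 1" "2 * \<i> * of_real s = 2 * p - 1"
  by (simp_all add: algebra_simps)

lemma Q_J:
  assumes s: "s \<noteq> 0"
  shows "Q0 \<alpha> (J \<alpha> h) \<phi> s = J \<alpha> (\<lambda>z w. z * d1 h z w + w * d2 h z w + of_real \<alpha> * h z w) \<phi> s"
    and "Q1 \<alpha> (J \<alpha> h) \<phi> s = J \<alpha> (\<lambda>z w. z * (z * d1 h z w + of_real \<alpha> * h z w) + d2 h z w) \<phi> s"
    and "Qm1 \<alpha> (J \<alpha> h) \<phi> s = J \<alpha> (\<lambda>z w. w * (w * d2 h z w + of_real \<alpha> * h z w) + d1 h z w) \<phi> s"
proof -
  \<comment> \<open>\<open>2 * p - 1\<close> is \<open>2 * \<i> * s\<close>, which is where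
    \<open>s \<noteq> 0\<close> enters; \<open>p - 1\<close> has real part -1/2 and never
    vanishes.\<close>
  have p: "2 * p - 1 \<noteq> 0" "p - 1 \<noteq> 0"
    using s by (auto simp: complex_eq_iff)
  have dom: "kern_dom (of_real \<phi>) (c * Z) (c * U)" if "Z \<in> disk" "U \<in> disk" for Z U
    by (rule kern_dom_disk[OF c_disk[OF that(1)] c_disk[OF that(2)]])
  note comb = pairing2_dil_combination[OF holomorphic2_kern holomorphic2_kern holomorphic2_kern_dzeta(2) holomorphic2_kern_dzeta(1)]
  let ?a = "complex_of_real \<alpha>"
  let ?G = "\<lambda>p. pairing2 \<alpha> (dil (kern \<alpha> p (of_real \<phi>))) (infl h)"
  let ?G1 = "pairing2 \<alpha> (dil (kern_dzeta \<alpha> (p - 1) (of_real \<phi>))) (infl h)"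
  let ?G2 = "pairing2 \<alpha> (dil (kern_dzeta2 \<alpha> (p - 1) (of_real \<phi>))) (infl h)"
  have "Q0 \<alpha> (J \<alpha> h) \<phi> s = - ((p - 1) * (p - ?a) / (2 * p - 1)) * ?G (p - 1)
      + p * (p + ?a - 1) / (2 * p - 1) * ?G (p + 1) - (p - ?a) / ((2 * p - 1) * (p - 1)) * ?G2 + 0 * ?G1"
    unfolding Q0_def Let_def ext_J shift_p D\<phi>_pairing p_coeffs by simp
  also have "\<dots> = pairing2 \<alpha> (dil (\<lambda>Z U. Z * d1 k Z U + U * d2 k Z U + ?a * k Z U)) (infl h)"
    unfolding comb by (rule pairing2_cong) (simp_all only: kern_Q0[OF dom p, symmetric] mult_zero_left add_0_right)
  finally show "Q0 \<alpha> (J \<alpha> h) \<phi> s = J \<alpha> (\<lambda>z w. z * d1 h z w + w * d2 h z w + of_real \<alpha> * h z w) \<phi> s"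
    unfolding J_M0 .
  have "Q1 \<alpha> (J \<alpha> h) \<phi> s = exp (\<i> * of_real \<phi>) * (p * (p - ?a) / (2 * p - 1) * ?G (p - 1)
      + p * (p + ?a - 1) / (2 * p - 1) * ?G (p + 1) - (p - ?a) / ((2 * p - 1) * (p - 1)) * ?G2 + (p - ?a) / (p - 1) * (1 / \<i>) * ?G1)"
    unfolding Q1_def Let_def ext_J shift_p D\<phi>_pairing p_coeffs by (rule refl)
  also have "\<dots> = pairing2 \<alpha> (dil (\<lambda>Z U. d1 k Z U + U * (U * d2 k Z U + ?a * k Z U))) (infl h)"
    unfolding comb unfolding pairing2_cmult(1)[symmetric]
    by (rule pairing2_cong) (simp_all only: kern_Q1[OF dom p, symmetric])
  finally show "Q1 \<alpha> (J \<alpha> h) \<phi> s = J \<alpha> (\<lambda>z w. z * (z * d1 h z w + of_real \<alpha> * h z w) + d2 h z w) \<phi> s"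
    unfolding J_M1 .
  have "Qm1 \<alpha> (J \<alpha> h) \<phi> s = exp (- \<i> * of_real \<phi>) * (p * (p - ?a) / (2 * p - 1) * ?G (p - 1)
      + p * (p + ?a - 1) / (2 * p - 1) * ?G (p + 1) - (p - ?a) / ((2 * p - 1) * (p - 1)) * ?G2 + - ((p - ?a) / (p - 1) * (1 / \<i>)) * ?G1)"
    unfolding Qm1_def Let_def ext_J shift_p D\<phi>_pairing p_coeffs by simp
  also have "\<dots> = pairing2 \<alpha> (dil (\<lambda>Z U. d2 k Z U + Z * (Z * d1 k Z U + ?a * k Z U))) (infl h)"
    unfolding comb unfolding pairing2_cmult(1)[symmetric]
    by (rule pairing2_cong) (simp_all only: kern_Qm1[OF dom p, symmetric] mult_minus_left diff_conv_add_uminus)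
  finally show "Qm1 \<alpha> (J \<alpha> h) \<phi> s = J \<alpha> (\<lambda>z w. w * (w * d2 h z w + of_real \<alpha> * h z w) + d1 h z w) \<phi> s"
    unfolding J_Mm1 .
qed

end

end

theorem theorem2:
  fixes \<alpha> :: real and f :: "complex \<Rightarrow> complex \<Rightarrow> complex"
  assumes "\<alpha> > 1" and "f \<in> W \<alpha>"
  shows "J \<alpha> f \<in> Q_domain \<and>
    (\<forall>\<phi>\<in>{0..2*pi}. \<forall>s. s \<noteq> 0 \<longrightarrow>
       Q0 \<alpha> (J \<alpha> f) \<phi> s = J \<alpha> (M0 \<alpha> f) \<phi> s \<and>
       Q1 \<alpha> (J \<alpha> f) \<phi> s = J \<alpha> (M1 \<alpha> f) \<phi> s \<and>
       Qm1 \<alpha> (J \<alpha> f) \<phi> s = J \<alpha> (Mm1 \<alpha> f) \<phi> s)"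
proof -
  obtain \<delta> g where \<delta>: "\<delta> > 0" and g: "holomorphic2_on g (ball 0 (1 + \<delta>)) (ball 0 (1 + \<delta>))"
    and gf: "\<And>z w. z \<in> disk \<Longrightarrow> w \<in> disk \<Longrightarrow> g z w = f z w"
    using assms(2) unfolding W_def by blast
  \<comment> \<open>The square root splits the radius \<open>1 + \<delta>\<close> of the
    continuation into the two equal factors that the locale requires.\<close>
  interpret dilated_pairing \<alpha> "sqrt (1 + \<delta>)" g
    by unfold_locales (use assms(1) \<delta> g in auto)
  have f: "holomorphic2_on f disk disk"
    using assms(2) by (simp add: W_def HH_def)
  have gd: "holomorphic2_on g disk disk"
    using \<delta> by (intro holomorphic2_subset[OF g]) auto
  \<comment> \<open>\<open>M0\<close>, \<open>M1\<close> and \<open>Mm1\<close> differentiate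
    \<open>f\<close> and not its continuation \<open>g\<close>; at points of the open disk the
    derivatives depend only on values inside the disk, where the two agree.\<close>
  have d: "d1 g z w = d1 f z w" "d2 g z w = d2 f z w" if "z \<in> disk" "w \<in> disk" for z w
    unfolding d1_def d2_def using that gf
    by (auto simp del: mem_ball intro!: complex_derivative_transform_within_open[of _ disk]
      intro: holomorphic2_holomorphic_fst[OF f] holomorphic2_holomorphic_fst[OF gd]
        holomorphic2_holomorphic_snd[OF f] holomorphic2_holomorphic_snd[OF gd])
  have J: "J \<alpha> f = J \<alpha> g"
    by (rule J_cong) (simp only: gf)
  have M0: "J \<alpha> (M0 \<alpha> f) = J \<alpha> (\<lambda>z w. z * d1 g z w + w * d2 g z w + of_real \<alpha> * g z w)"
    by (rule J_cong) (simp only: d gf, simp add: M0_def d1_def d2_def)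
  have M1: "J \<alpha> (M1 \<alpha> f) = J \<alpha> (\<lambda>z w. z * (z * d1 g z w + of_real \<alpha> * g z w) + d2 g z w)"
    by (rule J_cong) (simp only: d gf, simp add: M1_def d1_def d2_def power2_eq_square algebra_simps)
  have Mm1: "J \<alpha> (Mm1 \<alpha> f) = J \<alpha> (\<lambda>z w. w * (w * d2 g z w + of_real \<alpha> * g z w) + d1 g z w)"
    by (rule J_cong) (simp only: d gf, simp add: Mm1_def d1_def d2_def power2_eq_square algebra_simps)
  show ?thesis
    unfolding J M0 M1 Mm1 using J_Q_domain Q_J by blast
qed

end
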